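(* Let $p\ge 1$ and $j\ge 1$ be integers with $\gcd(p,2p+j)=1$, and let $r$ be an integer with $0\le 2r+1\le 2p+j-2$. Then, for generic nonzero $z$ (with fractional powers of $z$ taken with respect to the fixed choice of $z^{1/2}$), \begin{align*} \chi_{2r+1}^{(p,2p+j)}(z;q) &= \sum_{s=0}^{j-1}z^{-\frac{1}{2}(2s+1)}q^{\frac{p}{4j}(2s+1)^2}C_{2s+1,2r+1}^{(p,2p+j)}(q)\, j(-z^{j}q^{p(j-2s-1)};q^{2pj})\\ &\quad + \frac{1}{(q)_{\infty}^3}\sum_{s=0}^{j-1}(-1)^{p}q^{-\frac{1}{8}+\frac{p(2r+2)^2}{4(2p+j)}}q^{\binom{p}{2}-p(r-s)}z^{-\frac{1}{2}(2s+1)}\, j(-q^{p(j-2s-1)}z^{j};q^{2jp})\\ &\qquad \times \sum_{m=1}^{p-1}(-1)^{m}q^{\binom{m+1}{2}+m(r-p)}\Big( j(-q^{m(2p+j)+p(2r+2)};q^{2p(2p+j)}) - q^{m(2p+j)-m(2r+2)}j(-q^{-m(2p+j)+p(2r+2)};q^{2p(2p+j)})\Big)\\ &\qquad \times \Big( q^{m(s+1)-p(2s+1)}\,m(-q^{jm-p(2s+1)},-q^{p(j+2s+1)}z^{-j};q^{2jp}) + q^{-ms}\, m(-q^{jm+p(2s+1)},-q^{p(j-2s-1)}z^{j};q^{2jp})\Big). \end{align*}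
   Context: Let $q=e^{2\pi i\tau}$ with $\mathrm{Im}\,\tau>0$. Write $(x)_\infty=(x;q)_\infty=\prod_{i\ge0}(1-q^ix)$ and $j(x;q)=(x)_\infty(q/x)_\infty(q)_\infty=\sum_{n\in\mathbb Z}(-1)^nq^{\binom n2}x^n$. The Appell function is $m(x,z;q)=\frac{1}{j(z;q)}\sum_{r\in\mathbb Z}\frac{(-1)^rq^{\binom r2}z^r}{1-q^{r-1}xz}$. For coprime integers $p'\ge2$, $p\ge1$ and $0\le\ell\le p'-2$, the admissible $A_1^{(1)}$ character of level $N=p'/p-2$ and spin $\ell$ is $$\chi_\ell^{(p,p')}(z;q)=z^{-\frac{\ell+1}{2}}q^{\frac{p(\ell+1)^2}{4p'}}\frac{j(-q^{p(\ell+1)+pp'}z^{-p'};q^{2pp'})-z^{\ell+1}j(-q^{-p(\ell+1)+pp'}z^{-p'};q^{2pp'})}{z^{-1/2}q^{1/8}j(z;q)},$$ and the string functions $C_{m,\ell}^{(p,p')}(q)$, $m\in 2\mathbb Z+\ell$, are defined by the expansion $\chi_\ell^{(p,p')}(z;q)=\sum_{m\in2\mathbb Z+\ell}C_{m,\ell}^{(p,p')}(q)q^{\frac{m^2}{4N}}z^{-\frac m2}$ (Laurent expansion in $z$ for $|q|<|z|<1$, with a fixed choice of $z^{1/2}$). *)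

theory Defs
  imports "HOL-Analysis.Analysis"
begin

definition qpoch_inf :: "complex \<Rightarrow> complex \<Rightarrow> complex" where
  "qpoch_inf x q = (\<Prod>i. 1 - q ^ i * x)"

definition jtheta :: "complex \<Rightarrow> complex \<Rightarrow> complex" where
  "jtheta x q = qpoch_inf x q * qpoch_inf (q / x) q * qpoch_inf q q"

text \<open>The binomial coefficient of an integer \<open>n\<close> over 2; the division is exact.\<close>

definition binom2 :: "int \<Rightarrow> int" where
  "binom2 n = n * (n - 1) div 2"

definition appell_m :: "complex \<Rightarrow> complex \<Rightarrow> complex \<Rightarrow> complex" where
  "appell_m x z q =
     1 / jtheta z q *
     (\<Sum>\<^sub>\<infinity>r::int. (-1) powi r * q powi binom2 r * z powi r / (1 - q powi (r - 1) * x * z))"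

text \<open>No denominator in the definition of the Appell function vanishes at the given arguments.\<close>

definition appell_defined :: "complex \<Rightarrow> complex \<Rightarrow> complex \<Rightarrow> bool" where
  "appell_defined x z q \<longleftrightarrow>
     jtheta z q \<noteq> 0 \<and> (\<forall>r::int. 1 - q powi (r - 1) * x * z \<noteq> 0)"

text \<open>Real powers of \<open>q = exp (2 \<pi> i \<tau>)\<close>; the branch is the one determined by \<open>\<tau>\<close>.\<close>

definition qpow :: "complex \<Rightarrow> real \<Rightarrow> complex" where
  "qpow \<tau> a = exp (2 * of_real pi * \<i> * \<tau> * of_real a)"

text \<open>
  The characters involve half-integral powers of \<open>z\<close>, so they are functions of a
  chosen square root \<open>w\<close> of \<open>z\<close>: a power \<open>z\<close> to the \<open>n/2\<close> is written \<open>w powi n\<close>.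
\<close>

definition adm_char :: "int \<Rightarrow> int \<Rightarrow> int \<Rightarrow> complex \<Rightarrow> complex \<Rightarrow> complex" where
  "adm_char p p' l \<tau> w =
     (let q = qpow \<tau> 1; z = w\<^sup>2 in
        w powi (- (l + 1)) * qpow \<tau> (of_int (p * (l + 1)\<^sup>2) / of_int (4 * p')) *
        (jtheta (- (q powi (p * (l + 1) + p * p')) * z powi (- p')) (q powi (2 * p * p'))
         - z powi (l + 1) *
           jtheta (- (q powi (- p * (l + 1) + p * p')) * z powi (- p')) (q powi (2 * p * p')))
        / (w powi (- 1) * qpow \<tau> (1 / 8) * jtheta z q))"

definition adm_level :: "int \<Rightarrow> int \<Rightarrow> real" where
  "adm_level p p' = of_int p' / of_int p - 2"

text \<open>
  The family \<open>C\<close> is uniquely determined by the Laurent expansion on \<open>m \<in> 2\<int> + l\<close>;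
  outside this set the string functions are undefined, and \<open>0\<close> is used as a dummy value.
\<close>

definition string_fun :: "int \<Rightarrow> int \<Rightarrow> int \<Rightarrow> complex \<Rightarrow> int \<Rightarrow> complex" where
  "string_fun p p' l \<tau> =
     (THE C. (\<forall>m. odd (m - l) \<longrightarrow> C m = 0) \<and>
        (\<forall>w. norm (qpow \<tau> 1) < norm (w\<^sup>2) \<and> norm (w\<^sup>2) < 1 \<longrightarrow>
           ((\<lambda>m. C m * qpow \<tau> ((of_int m)\<^sup>2 / (4 * adm_level p p')) * w powi (- m))
              has_sum adm_char p p' l \<tau> w) {m. even (m - l)}))"

end

theory Submission
  imports Defs "HOL-Complex_Analysis.Complex_Analysis"
begin

text \<open>
  Up to elementary factors the character is \<open>A(z) / j(z;q)\<close>, where the numerator is odd under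
  \<open>z \<mapsto> 1/z\<close>. Summing the geometric series over \<open>s\<close> turns the Appell functions of the statement
  into the sums \<open>S\<^sub>d(z) = \<Sum>\<^sub>n q\<^bsup>jpn\<^sup>2+pn\<^esup> z\<^bsup>jn\<^esup> / (1 - z q\<^bsup>2pn+d\<^esup>)\<close> with \<open>d = p + m\<close> and \<open>d = p - m\<close>.
  The character and these sums obey the same functional equation under \<open>z \<mapsto> q\<^bsup>2p\<^esup> z\<close>, and their
  simple poles on the powers of \<open>q\<close> cancel (the numerator vanishes at \<open>1\<close> and \<open>q\<^bsup>-p\<^esup>\<close>, which is
  why only \<open>0 < m < p\<close> occurs). The difference is therefore holomorphic on the punctured plane and
  its Laurent coefficients satisfy a first order recurrence of step \<open>j\<close>; by the Jacobi triple
  product it is a combination of \<open>j\<close> theta functions, with coefficients the Laurent coefficients of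
  index \<open>-1, \<dots>, -j\<close>. In the annulus \<open>\<bar>q\<bar> < \<bar>z\<bar> < 1\<close> the sums \<open>S\<^sub>d\<close> contribute nothing to these
  indices, so the coefficients are the string functions.
\<close>

subsection \<open>Sums over the integers\<close>

text \<open>The Laurent coefficients of the character in the annulus, which are the string functions
  up to elementary factors, cannot simply be compared through the functional equation: z and q^(2p)
  z lie in different annuli, and the poles between them intervene. Removing the poles repairs this,
  since the regular part has a single expansion on the whole punctured plane. One coefficient per m
  serves two classes of poles. Modulo 2p the poles of S_(p+m) lie at the exponents k = p - m and
  those of S_(p-m) at k = m - p; the oddness of the numerator ties the two residues together. For p
  = 1 there is nothing to subtract. The linear term p n in the exponent of S_d is forced: it yields
  the multiplier q^(-jp-p) z^(-j), the quotient of the multipliers of the numerator and of j(z;q).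
  The window -j, ..., -1 is at once a full set of residues modulo j, as the recurrence requires, and
  exactly the gap between the two halves of S_d: for 0 < d < 2p the terms n >= 0 give powers z^k
  with k >= 0, the terms n < 0 only k <= -j-1.\<close>

lemma summable_on_int_halves:
  fixes f :: "int \<Rightarrow> 'a :: banach"
  assumes "(\<lambda>n. f (int n)) summable_on UNIV" "(\<lambda>n. f (- int n - 1)) summable_on UNIV"
  shows "f summable_on UNIV"
proof -
  have "f summable_on {0..}"
    using assms(1)
    by (subst summable_on_reindex_bij_witness[of _ int nat UNIV "\<lambda>n. f (int n)"]) auto
  moreover have "f summable_on {..<0}"
    using assms(2)
    by (subst summable_on_reindex_bij_witness[of _ "\<lambda>n. - int n - 1" "\<lambda>k. nat (- k - 1)" UNIV
          "\<lambda>n. f (- int n - 1)"]) auto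
  ultimately have "f summable_on ({0..} \<union> {..<0})"
    by (intro summable_on_Un_disjoint) auto
  also have "{0..} \<union> {..<0} = (UNIV :: int set)"
    by auto
  finally show ?thesis .
qed

lemma has_sum_int_shift:
  fixes f :: "int \<Rightarrow> 'a :: {comm_monoid_add, topological_space}"
  shows "((\<lambda>k. f (k + c)) has_sum S) UNIV \<longleftrightarrow> (f has_sum S) UNIV"
  by (rule has_sum_reindex_bij_witness[of _ "\<lambda>k. k - c" "\<lambda>k. k + c"]) auto

text \<open>Tannery's theorem for unconditional sums: the domination makes the partial sums converge
  uniformly in n, so the two limits may be exchanged. It carries the finite triple product over to
  the infinite one.\<close>

lemma tendsto_infsum_dominated:
  fixes f :: "'a \<Rightarrow> 'b \<Rightarrow> 'c :: banach"
  assumes bound: "\<And>k n. norm (f k n) \<le> M k" and summable: "M summable_on UNIV"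
    and lim: "\<And>k. (f k \<longlongrightarrow> g k) F" and ntriv: "F \<noteq> bot"
  shows "((\<lambda>n. \<Sum>\<^sub>\<infinity>k. f k n) \<longlongrightarrow> (\<Sum>\<^sub>\<infinity>k. g k)) F" and "g summable_on UNIV"
proof -
  have gM: "norm (g k) \<le> M k" for k
    by (rule tendsto_upperbound[OF tendsto_norm[OF lim]]) (use bound ntriv in auto)
  have "(\<lambda>k. norm (g k)) summable_on UNIV"
    by (rule summable_on_comparison_test[OF summable]) (use gM in auto)
  then show g: "g summable_on UNIV"
    by (rule abs_summable_summable)
  show "((\<lambda>n. \<Sum>\<^sub>\<infinity>k. f k n) \<longlongrightarrow> (\<Sum>\<^sub>\<infinity>k. g k)) F"
  proof (rule swap_uniform_limit')
    show "uniform_limit UNIV (\<lambda>X n. \<Sum>k\<in>X. f k n) (\<lambda>n. \<Sum>\<^sub>\<infinity>k. f k n) (finite_subsets_at_top UNIV)"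
      by (rule Weierstrass_m_test_general[OF _ summable]) (use bound in auto)
    show "((\<lambda>X. \<Sum>k\<in>X. g k) \<longlongrightarrow> (\<Sum>\<^sub>\<infinity>k. g k)) (finite_subsets_at_top UNIV)"
      by (rule infsum_tendsto[OF g])
    show "\<forall>\<^sub>F X in finite_subsets_at_top UNIV. ((\<lambda>n. \<Sum>k\<in>X. f k n) \<longlongrightarrow> (\<Sum>k\<in>X. g k)) F"
      by (intro always_eventually allI tendsto_sum lim)
  qed auto
qed

lemma binom2_plus_1: "binom2 (k + 1) = binom2 k + k"
proof -
  have "(k + 1) * (k + 1 - 1) = k * (k - 1) + k * 2"
    by (simp add: algebra_simps)
  then show ?thesis
    by (simp add: binom2_def)
qed

lemma two_binom2: "2 * binom2 k = k * (k - 1)"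
  by (simp add: binom2_def)

lemma binom2_0 [simp]: "binom2 0 = 0"
  by (simp add: binom2_def)

lemma summable_gaussian_nat:
  fixes t y :: real
  assumes "0 < t" "t < 1" "0 < y"
  shows "summable (\<lambda>n. t powi binom2 (int n) * y ^ n)"
proof -
  have "(\<lambda>n. t ^ n * y) \<longlonglongrightarrow> 0 * y"
    using assms by (intro tendsto_mult LIMSEQ_power_zero tendsto_const) auto
  then have "\<forall>\<^sub>F n in sequentially. t ^ n * y < 1 / 2"
    by (rule order_tendstoD) auto
  then obtain N where N: "\<And>n. n \<ge> N \<Longrightarrow> t ^ n * y < 1 / 2"
    by (auto simp: eventually_sequentially)
  show ?thesis
  proof (rule summable_ratio_test[of "1/2" N])
    fix n assume "n \<ge> N"
    have "t powi binom2 (int (Suc n)) * y ^ Suc n = (t powi binom2 (int n) * y ^ n) * (t ^ n * y)"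
      using binom2_plus_1[of "int n"] assms by (simp add: power_int_add add.commute)
    also have "\<dots> \<le> (t powi binom2 (int n) * y ^ n) * (1 / 2)"
      using N[OF \<open>n \<ge> N\<close>] assms by (intro mult_left_mono) auto
    finally show "norm (t powi binom2 (int (Suc n)) * y ^ Suc n)
        \<le> 1 / 2 * norm (t powi binom2 (int n) * y ^ n)"
      using assms by (simp add: abs_mult)
  qed auto
qed

lemma summable_on_gaussian:
  fixes t y :: real
  assumes "0 < t" "t < 1" "0 < y"
  shows "(\<lambda>k::int. t powi binom2 k * y powi k) summable_on UNIV"
proof (rule summable_on_int_halves)
  have nonneg: "0 \<le> t powi m * x" if "0 \<le> x" for m x
    using assms that by simp
  show "(\<lambda>n. t powi binom2 (int n) * y powi int n) summable_on UNIV"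
    using summable_gaussian_nat[OF assms] assms
    by (subst summable_on_UNIV_nonneg_real_iff) auto
  \<comment> \<open>The shift by 2 comes from
    \<open>binom2 (- int n - 1) = binom2 (int (n + 2))\<close>, both being (n+1)(n+2)/2; the
    negative half is thus the nonnegative one for 1 / y, up to a factor y.\<close>
  have "summable (\<lambda>n. t powi binom2 (int (n + 2)) * (1 / y) ^ (n + 2))"
    using summable_gaussian_nat[of t "1 / y"] assms
    by (subst summable_iff_shift) auto
  then have "summable (\<lambda>n. y * (t powi binom2 (int (n + 2)) * (1 / y) ^ (n + 2)))"
    by (rule summable_mult)
  also have "(\<lambda>n. y * (t powi binom2 (int (n + 2)) * (1 / y) ^ (n + 2)))
      = (\<lambda>n. t powi binom2 (- int n - 1) * y powi (- int n - 1))"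
  proof
    fix n
    have "binom2 (- int n - 1) = binom2 (int (n + 2))"
      using two_binom2[of "- int n - 1"] two_binom2[of "int (n + 2)"] by (simp add: algebra_simps)
    moreover have "y * (1 / y) ^ (n + 2) = y powi (- int n - 1)"
      using assms by (simp add: power_int_diff power_int_minus power_one_over field_simps)
    ultimately show "y * (t powi binom2 (int (n + 2)) * (1 / y) ^ (n + 2))
        = t powi binom2 (- int n - 1) * y powi (- int n - 1)"
      by (metis mult.left_commute)
  qed
  finally show "(\<lambda>n. t powi binom2 (- int n - 1) * y powi (- int n - 1)) summable_on UNIV"
    using assms by (subst summable_on_UNIV_nonneg_real_iff) auto
qed

subsection \<open>The infinite q-Pochhammer symbol\<close>

lemma qpoch_convergent_prod:
  assumes "norm q < 1"
  shows "convergent_prod (\<lambda>i. 1 - q ^ i * x :: complex)"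
proof -
  have "summable (\<lambda>i. norm x * norm q ^ i)"
    using assms by (intro summable_mult summable_geometric) auto
  then have "summable (\<lambda>i. norm ((1 - q ^ i * x) - 1))"
    by (simp add: norm_mult norm_power mult.commute)
  then show ?thesis
    using abs_convergent_prod_conv_summable abs_convergent_prod_imp_convergent_prod by blast
qed

lemma qpoch_LIMSEQ:
  assumes "norm q < 1"
  shows "(\<lambda>n. \<Prod>i<n. 1 - q ^ i * x) \<longlonglongrightarrow> qpoch_inf x q"
  using convergent_prod_LIMSEQ[OF qpoch_convergent_prod[OF assms]]
  unfolding qpoch_inf_def by (subst LIMSEQ_lessThan_iff_atMost) simp

lemma qpoch_inf_eq_0_iff:
  assumes "norm q < 1"
  shows "qpoch_inf x q = 0 \<longleftrightarrow> (\<exists>i. q ^ i * x = 1)"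
proof -
  have "(\<lambda>i. 1 - q ^ i * x) has_prod qpoch_inf x q"
    using qpoch_convergent_prod[OF assms] unfolding qpoch_inf_def by (rule convergent_prod_has_prod)
  from has_prod_eq_0_iff[OF this] show ?thesis
    by (auto simp: image_iff)
qed

lemma qpoch_inf_rec:
  assumes "norm q < 1"
  shows "qpoch_inf x q = (1 - x) * qpoch_inf (q * x) q"
proof (rule LIMSEQ_unique)
  show "(\<lambda>n. \<Prod>i<Suc n. 1 - q ^ i * x) \<longlonglongrightarrow> qpoch_inf x q"
    using qpoch_LIMSEQ[OF assms] by (rule LIMSEQ_Suc)
  have "(\<lambda>n. (1 - x) * (\<Prod>i<n. 1 - q ^ i * (q * x))) \<longlonglongrightarrow> (1 - x) * qpoch_inf (q * x) q"
    by (intro tendsto_intros qpoch_LIMSEQ assms)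
  then show "(\<lambda>n. \<Prod>i<Suc n. 1 - q ^ i * x) \<longlonglongrightarrow> (1 - x) * qpoch_inf (q * x) q"
    by (subst prod.lessThan_Suc_shift) (simp add: mult_ac)
qed

lemma qpoch_inf_q_q_nonzero:
  assumes "norm q < 1"
  shows "qpoch_inf q q \<noteq> 0"
proof
  assume "qpoch_inf q q = 0"
  then obtain i where "q ^ i * q = 1"
    using assms by (auto simp: qpoch_inf_eq_0_iff)
  then have "norm q ^ Suc i = 1"
    by (metis norm_one norm_power power_Suc2)
  then show False
    using assms by (metis norm_ge_zero less_irrefl power_Suc_less_one zero_less_norm_iff norm_zero
        order_le_less power_0_Suc zero_neq_one)
qed

text \<open>Locally uniform limits of the polynomial partial products are holomorphic; on the closed
  unit ball about z the geometric terms (|z| + 1) |q|^n dominate the deviations of the factors from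
  1.\<close>

lemma qpoch_inf_holomorphic:
  assumes "norm q < 1"
  shows "(\<lambda>x. qpoch_inf x q) holomorphic_on A"
proof -
  have "(\<lambda>x. qpoch_inf x q) holomorphic_on UNIV"
  proof (rule holomorphic_uniform_sequence[where f = "\<lambda>n x. \<Prod>i<n. 1 + - (q ^ i * x)"])
    fix z :: complex
    let ?R = "norm z + 1"
    have ul: "uniformly_convergent_on (cball z 1) (\<lambda>N x. \<Prod>n<N. 1 + - (q ^ n * x))"
    proof (rule uniformly_convergent_on_prod)
      show "uniformly_convergent_on (cball z 1) (\<lambda>N x. \<Sum>n<N. norm (- (q ^ n * x)))"
      proof (rule Weierstrass_m_test')
        fix n x assume "x \<in> cball z 1"
        then have "norm x \<le> ?R"
          using norm_triangle_ineq2[of x z] by (simp add: dist_norm norm_minus_commute)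
        then show "norm (norm (- (q ^ n * x))) \<le> ?R * norm q ^ n"
          using mult_left_mono[of "norm x" ?R "norm q ^ n"]
          by (simp add: norm_mult norm_power mult.commute)
      next
        show "summable (\<lambda>n. ?R * norm q ^ n)"
          using assms by (intro summable_mult summable_geometric) auto
      qed
    qed (auto intro!: continuous_intros)
    then have "uniform_limit (cball z 1) (\<lambda>n x. \<Prod>i<n. 1 + - (q ^ i * x))
        (\<lambda>x. lim (\<lambda>n. \<Prod>i<n. 1 + - (q ^ i * x))) sequentially"
      by (simp add: uniformly_convergent_uniform_limit_iff)
    moreover have "lim (\<lambda>n. \<Prod>i<n. 1 + - (q ^ i * x)) = qpoch_inf x q" for x
      using qpoch_LIMSEQ[OF assms, of x] by (simp add: limI)
    ultimately show "\<exists>d>0. cball z d \<subseteq> UNIV \<and>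
        uniform_limit (cball z d) (\<lambda>n x. \<Prod>i<n. 1 + - (q ^ i * x)) (\<lambda>x. qpoch_inf x q) sequentially"
      by (intro exI[of _ 1]) auto
  qed (auto intro!: holomorphic_intros)
  then show ?thesis
    by (rule holomorphic_on_subset) auto
qed


subsection \<open>The Jacobi triple product\<close>

text \<open>The value \<open>0\<close> at negative indices makes the recurrence \<open>qfact_inv_rec\<close> hold for all integers.\<close>

definition qfact_inv :: "complex \<Rightarrow> int \<Rightarrow> complex" where
  "qfact_inv q k = (if k < 0 then 0 else 1 / (\<Prod>i<nat k. 1 - q ^ i * q))"

lemma power_neq_1_of_norm_less_1:
  fixes q :: complex
  assumes "norm q < 1"
  shows "q ^ i * q \<noteq> 1"
proof
  assume "q ^ i * q = 1"
  then have "qpoch_inf q q = 0"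
    using assms by (auto simp: qpoch_inf_eq_0_iff)
  then show False
    using qpoch_inf_q_q_nonzero[OF assms] by simp
qed

lemma qfact_inv_rec:
  assumes "norm q < 1"
  shows "qfact_inv q (k - 1) = (1 - q powi k) * qfact_inv q k"
proof (cases "k > 0")
  case True
  then obtain n where k: "k = int (Suc n)"
    by (metis Suc_pred' pos_int_cases)
  have "q ^ n * q \<noteq> 1"
    by (rule power_neq_1_of_norm_less_1[OF assms])
  moreover have "q powi k = q ^ n * q"
    unfolding k by (simp only: power_int_of_nat power_Suc2)
  moreover have "qfact_inv q (k - 1) = 1 / (\<Prod>i<n. 1 - q ^ i * q)"
      "qfact_inv q k = 1 / (\<Prod>i<Suc n. 1 - q ^ i * q)"
    unfolding k qfact_inv_def by (simp_all del: of_nat_Suc add: nat_diff_distrib' of_nat_diff)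
  ultimately show ?thesis
    by simp
qed (auto simp: qfact_inv_def)

lemma qfact_inv_tendsto:
  assumes "norm q < 1"
  shows "(\<lambda>n. qfact_inv q (int n + k)) \<longlonglongrightarrow> 1 / qpoch_inf q q"
proof -
  have "(\<lambda>n. 1 / (\<Prod>i<n. 1 - q ^ i * q)) \<longlonglongrightarrow> 1 / qpoch_inf q q"
    by (intro tendsto_intros qpoch_LIMSEQ assms qpoch_inf_q_q_nonzero)
  moreover have "filterlim (\<lambda>n. nat (int n + k)) at_top sequentially"
    unfolding filterlim_at_top
  proof
    fix Z
    have "\<forall>\<^sub>F n in sequentially. n \<ge> Z + nat \<bar>k\<bar>"
      by (rule eventually_ge_at_top)
    then show "\<forall>\<^sub>F n in sequentially. Z \<le> nat (int n + k)"
      by eventually_elim linarith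
  qed
  ultimately have "(\<lambda>n. 1 / (\<Prod>i<nat (int n + k). 1 - q ^ i * q)) \<longlonglongrightarrow> 1 / qpoch_inf q q"
    by (rule filterlim_compose)
  then show ?thesis
  proof (rule Lim_transform_eventually)
    have "\<forall>\<^sub>F n in sequentially. n \<ge> nat \<bar>k\<bar>"
      by (rule eventually_ge_at_top)
    then show "\<forall>\<^sub>F n in sequentially.
        1 / (\<Prod>i<nat (int n + k). 1 - q ^ i * q) = qfact_inv q (int n + k)"
      by eventually_elim (auto simp: qfact_inv_def)
  qed
qed

lemma qfact_inv_bounded:
  assumes "norm q < 1"
  obtains B where "B > 0" "\<And>k. norm (qfact_inv q k) \<le> B"
proof -
  have "Bseq (\<lambda>n. qfact_inv q (int n + 0))"
    by (rule convergent_imp_Bseq) (use qfact_inv_tendsto[OF assms] in \<open>blast intro: convergentI\<close>)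
  then obtain B where B: "B > 0" "\<And>n. norm (qfact_inv q (int n)) \<le> B"
    by (auto simp: Bseq_def)
  have "norm (qfact_inv q k) \<le> B" for k
  proof (cases "k < 0")
    case True
    then show ?thesis
      using B(1) by (simp add: qfact_inv_def)
  next
    case False
    then show ?thesis
      using B(2)[of "nat k"] by simp
  qed
  with B(1) that show ?thesis
    by blast
qed

text \<open>The weight is the Gaussian binomial coefficient of 2n over n+k, which vanishes for |k| >
  n, so this is the q-binomial theorem in symmetric form. In the induction step the product gains (1
  - q^n x)(1 - q^(n+1)/x) = 1 + q^(2n+1) - q^n x - q^(n+1)/x, whose terms in x and 1/x shift k by
  one; what remains is a Pascal rule for the weights.\<close>

lemma finite_jacobi_triple_product:
  fixes q x :: complex
  assumes q: "norm q < 1" "q \<noteq> 0" and x: "x \<noteq> 0"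
  shows "((\<lambda>k. (-1) powi k * q powi binom2 k * x powi k *
             ((\<Prod>i<2 * n. 1 - q ^ i * q) * qfact_inv q (int n + k) * qfact_inv q (int n - k)))
          has_sum (\<Prod>i<n. 1 - q ^ i * x) * (\<Prod>i<n. 1 - q ^ i * (q / x))) UNIV"
proof (induction n)
  case 0
  show ?case
    by (rule has_sum_finite_neutralI[of "{0}"]) (auto simp: qfact_inv_def)
next
  case (Suc n)
  define T where "T k = (-1) powi k * q powi binom2 k * x powi k" for k
  define G where "G n k = (\<Prod>i<2 * n. 1 - q ^ i * q) * qfact_inv q (int n + k) * qfact_inv q (int n - k)" for n k
  define P where "P = (\<Prod>i<n. 1 - q ^ i * x) * (\<Prod>i<n. 1 - q ^ i * (q / x))"
  define a where "a k = T k * G n k" for k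
  have a: "(a has_sum P) UNIV"
    using Suc.IH unfolding a_def[abs_def] T_def G_def P_def .
  have "((\<lambda>k. (1 + q ^ n * q ^ n * q) * a k + (- (q ^ n * x)) * a (k + -1) + (- (q ^ n * (q / x))) * a (k + 1))
      has_sum (1 + q ^ n * q ^ n * q) * P + (- (q ^ n * x)) * P + (- (q ^ n * (q / x))) * P) UNIV"
    by (intro has_sum_add has_sum_cmult_right) (use a in \<open>simp_all only: has_sum_int_shift\<close>)
  also have "(1 + q ^ n * q ^ n * q) * P + (- (q ^ n * x)) * P + (- (q ^ n * (q / x))) * P
      = (\<Prod>i<Suc n. 1 - q ^ i * x) * (\<Prod>i<Suc n. 1 - q ^ i * (q / x))"
    using x by (simp add: P_def field_simps)
  also have "(\<lambda>k. (1 + q ^ n * q ^ n * q) * a k + (- (q ^ n * x)) * a (k + -1) + (- (q ^ n * (q / x))) * a (k + 1))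
      = (\<lambda>k. T k * G (Suc n) k)"
  proof
    fix k
    \<comment> \<open>In terms of u = q^(n+1+k) and v = q^(n+1-k) all neighbouring weights are
      multiples of \<open>\<alpha> * \<beta>\<close>, and the Pascal rule becomes the rational
      identity \<open>id\<close> in u, v and q.\<close>
    define u v where "u = q powi (int n + 1 + k)" and "v = q powi (int n + 1 - k)"
    define \<alpha> \<beta> where "\<alpha> = qfact_inv q (int n + 1 + k)" and "\<beta> = qfact_inv q (int n + 1 - k)"
    define c where "c = (\<Prod>i<2 * n. 1 - q ^ i * q)"
    have uv: "u * v = q ^ n * q ^ n * q * q"
      using q by (simp add: u_def v_def power_int_add power_int_diff field_simps)
    have g1: "qfact_inv q (int n + k) = (1 - u) * \<alpha>"
      using qfact_inv_rec[OF q(1), of "int n + 1 + k"] by (simp add: u_def \<alpha>_def algebra_simps)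
    have g2: "qfact_inv q (int n - k) = (1 - v) * \<beta>"
      using qfact_inv_rec[OF q(1), of "int n + 1 - k"] by (simp add: v_def \<beta>_def algebra_simps)
    have g3: "qfact_inv q (int n + (k - 1)) = (1 - u / q) * ((1 - u) * \<alpha>)"
    proof -
      have "u / q = q powi (int n + k)"
        using q by (simp add: u_def power_int_add)
      then show ?thesis
        using qfact_inv_rec[OF q(1), of "int n + k"] by (simp add: g1[symmetric] add_diff_eq)
    qed
    have g4: "qfact_inv q (int n - (k + 1)) = (1 - v / q) * ((1 - v) * \<beta>)"
    proof -
      have "v / q = q powi (int n - k)"
        using q by (simp add: v_def power_int_add power_int_diff)
      then show ?thesis
        using qfact_inv_rec[OF q(1), of "int n - k"] by (simp add: g2[symmetric] diff_diff_eq)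
    qed
    have g5: "qfact_inv q (int n + (k + 1)) = \<alpha>" "qfact_inv q (int n - (k - 1)) = \<beta>"
      by (simp_all add: \<alpha>_def \<beta>_def algebra_simps)
    have Tm: "- (q ^ n * x) * T (k - 1) = v * T k"
    proof -
      have "binom2 k = binom2 (k - 1) + (k - 1)"
        using binom2_plus_1[of "k - 1"] by simp
      then have "q powi binom2 k = q powi binom2 (k - 1) * q powi (k - 1)"
        using q by (simp add: power_int_add)
      moreover have "v * q powi (k - 1) = q ^ n"
        using q by (simp add: v_def power_int_add[symmetric])
      moreover have "x powi k = x powi (k - 1) * x" "(-1 :: complex) powi k = - ((-1) powi (k - 1))"
        using x by (simp_all add: power_int_diff)
      ultimately show ?thesis
        by (simp add: T_def mult_ac)
    qed
    have Tp: "- (q ^ n * (q / x)) * T (k + 1) = u * T k"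
    proof -
      have "q powi binom2 (k + 1) = q powi binom2 k * q powi k"
        using q by (simp add: power_int_add binom2_plus_1)
      moreover have "u = q ^ n * q * q powi k"
        using q by (simp add: u_def power_int_add)
      ultimately show ?thesis
        using x by (simp add: T_def power_int_add field_simps)
    qed
    have id: "(1 + u * v / q) * ((1 - u) * (1 - v)) + v * ((1 - u / q) * (1 - u)) + u * ((1 - v) * (1 - v / q))
        = (1 - u * v / q) * (1 - u * v)"
      using q by (simp add: field_simps)
    have GS: "G (Suc n) k = c * ((1 - u * v / q) * (1 - u * v)) * \<alpha> * \<beta>"
    proof -
      have "(\<Prod>i<2 * Suc n. 1 - q ^ i * q) = c * (1 - q ^ (2 * n) * q) * (1 - q ^ Suc (2 * n) * q)"
        by (simp add: c_def)
      also have "q ^ (2 * n) * q = u * v / q"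
        using q unfolding uv by (simp add: mult_2 power_add)
      also have "q ^ Suc (2 * n) * q = u * v"
        unfolding uv mult_2 power_add power_Suc by (simp only: mult_ac)
      finally show ?thesis
        by (simp add: G_def \<alpha>_def \<beta>_def add_ac mult_ac)
    qed
    have "(1 + q ^ n * q ^ n * q) * a k + (- (q ^ n * x)) * a (k + -1) + (- (q ^ n * (q / x))) * a (k + 1)
        = (1 + u * v / q) * (T k * G n k) + v * T k * G n (k - 1) + u * T k * G n (k + 1)"
      using Tm Tp q by (simp add: a_def uv mult.assoc[symmetric])
    also have "\<dots> = T k * c * ((1 + u * v / q) * ((1 - u) * (1 - v)) + v * ((1 - u / q) * (1 - u))
        + u * ((1 - v) * (1 - v / q))) * \<alpha> * \<beta>"
      unfolding G_def g1 g2 g3 g4 g5 c_def[symmetric] by algebra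
    also have "\<dots> = T k * G (Suc n) k"
      unfolding id GS by (simp add: mult_ac)
    finally show "(1 + q ^ n * q ^ n * q) * a k + (- (q ^ n * x)) * a (k + -1) + (- (q ^ n * (q / x))) * a (k + 1)
        = T k * G (Suc n) k" .
  qed
  finally show ?case
    by (simp only: T_def G_def)
qed

text \<open>Let n tend to infinity in the finite version. Each weight tends to 1 / (q)_inf, and all
  are bounded uniformly in n and k, so a Gaussian series dominates. Multiplying by (q)_inf supplies
  the third factor of \<open>jtheta\<close>.\<close>

theorem jacobi_triple_product:
  fixes q x :: complex
  assumes q: "norm q < 1" "q \<noteq> 0" and x: "x \<noteq> 0"
  shows "((\<lambda>k. (-1) powi k * q powi binom2 k * x powi k) has_sum jtheta x q) UNIV"
proof -
  define c where "c n = (\<Prod>i<n. 1 - q ^ i * q)" for n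
  define Q where "Q = qpoch_inf q q"
  define f where "f k n = (-1) powi k * q powi binom2 k * x powi k *
      (c (2 * n) * qfact_inv q (int n + k) * qfact_inv q (int n - k))" for k and n :: nat
  have Q: "Q \<noteq> 0"
    unfolding Q_def by (rule qpoch_inf_q_q_nonzero[OF q(1)])
  have c: "c \<longlonglongrightarrow> Q"
    unfolding c_def Q_def by (rule qpoch_LIMSEQ[OF q(1)])
  then have "Bseq c"
    by (intro convergent_imp_Bseq convergentI)
  then obtain C where C: "C > 0" "\<And>n. norm (c n) \<le> C"
    by (auto simp: Bseq_def)
  obtain B where B: "B > 0" "\<And>k. norm (qfact_inv q k) \<le> B"
    using qfact_inv_bounded[OF q(1)] by blast
  define M where "M k = norm q powi binom2 k * norm x powi k * (C * B * B)" for k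
  have M: "M summable_on UNIV"
    unfolding M_def using q x by (intro summable_on_cmult_left summable_on_gaussian) auto
  have bound: "norm (f k n) \<le> M k" for k n
  proof -
    have "norm (c (2 * n) * qfact_inv q (int n + k) * qfact_inv q (int n - k)) \<le> C * B * B"
      unfolding norm_mult using B C by (intro mult_mono) auto
    then have "norm q powi binom2 k * norm x powi k *
        norm (c (2 * n) * qfact_inv q (int n + k) * qfact_inv q (int n - k)) \<le> M k"
      unfolding M_def by (intro mult_left_mono) auto
    then show ?thesis
      by (simp add: f_def norm_mult norm_power_int mult.assoc)
  qed
  have lim: "(f k \<longlonglongrightarrow> (-1) powi k * q powi binom2 k * x powi k * (Q * (1 / Q) * (1 / Q)))" for k
  proof -
    have "(\<lambda>n. c (2 * n)) \<longlonglongrightarrow> Q"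
      by (rule filterlim_compose[OF c]) (auto intro!: filterlim_subseq strict_monoI)
    then show ?thesis
      using qfact_inv_tendsto[OF q(1), of "- k"] qfact_inv_tendsto[OF q(1), of k]
      unfolding f_def Q_def by (intro tendsto_intros) simp_all
  qed
  have sum: "(\<Sum>\<^sub>\<infinity>k. f k n) = (\<Prod>i<n. 1 - q ^ i * x) * (\<Prod>i<n. 1 - q ^ i * (q / x))" for n
    unfolding f_def c_def by (intro infsumI finite_jacobi_triple_product assms)
  have "(\<lambda>n. \<Sum>\<^sub>\<infinity>k. f k n) \<longlonglongrightarrow> qpoch_inf x q * qpoch_inf (q / x) q"
    unfolding sum by (intro tendsto_intros qpoch_LIMSEQ q)
  then have "qpoch_inf x q * qpoch_inf (q / x) q
      = (\<Sum>\<^sub>\<infinity>k. (-1) powi k * q powi binom2 k * x powi k * (Q * (1 / Q) * (1 / Q)))"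
    using tendsto_infsum_dominated(1)[OF bound M lim] by (intro LIMSEQ_unique) auto
  then have "((\<lambda>k. (-1) powi k * q powi binom2 k * x powi k * (Q * (1 / Q) * (1 / Q)))
      has_sum (qpoch_inf x q * qpoch_inf (q / x) q)) UNIV"
    using tendsto_infsum_dominated(2)[OF bound M lim] by (simp add: has_sum_iff)
  then have "((\<lambda>k. (-1) powi k * q powi binom2 k * x powi k * (Q * (1 / Q) * (1 / Q)) * Q)
      has_sum (qpoch_inf x q * qpoch_inf (q / x) q * Q)) UNIV"
    by (rule has_sum_cmult_left)
  then show ?thesis
    using Q by (simp add: jtheta_def Q_def mult.assoc)
qed

subsection \<open>Laurent series\<close>

lemma has_contour_integral_power_int_circlepath:
  assumes "R > 0"
  shows "((\<lambda>x. x powi m) has_contour_integral (if m = -1 then 2 * of_real pi * \<i> else 0)) (circlepath 0 R)"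
proof (cases "m = -1")
  case True
  have "((\<lambda>x. 1 / (x - 0)) has_contour_integral (2 * of_real pi * \<i> * 1)) (circlepath 0 R)"
    by (rule Cauchy_integral_circlepath_simple[where f = "\<lambda>_. 1"]) (use assms in auto)
  then show ?thesis
    using True by (simp add: power_int_minus divide_inverse)
next
  case False
  have "((\<lambda>x. x powi m) has_contour_integral 0) (circlepath 0 R)"
  proof (rule Cauchy_theorem_primitive[where f = "\<lambda>x. x powi (m + 1) / of_int (m + 1)" and S = "-{0}"])
    fix x :: complex assume x: "x \<in> -{0}"
    have "of_int (m + 1) \<noteq> (0 :: complex)"
      using False by (subst of_int_eq_0_iff) linarith
    then show "((\<lambda>x. x powi (m + 1) / of_int (m + 1)) has_field_derivative x powi m) (at x within -{0})"
      using x by (auto intro!: derivative_eq_intros)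
  qed (use assms in auto)
  then show ?thesis
    using False by simp
qed

text \<open>Unconditional summability of complex numbers is absolute, so convergence at the single
  point x = R already bounds the series uniformly on the circle and permits integration term by
  term.\<close>

lemma laurent_coeff_circlepath:
  fixes c :: "int \<Rightarrow> complex"
  assumes R: "R > 0" and f: "\<And>x. norm x = R \<Longrightarrow> ((\<lambda>n. c n * x powi n) has_sum f x) UNIV"
  shows "contour_integral (circlepath 0 R) (\<lambda>x. f x * x powi (- k - 1)) = 2 * of_real pi * \<i> * c k"
proof -
  let ?g = "\<lambda>n x. c n * x powi n * x powi (- k - 1)"
  have eq: "?g n x = c n * x powi (n - k - 1)" if "norm x = R" for n x
  proof -
    have "x \<noteq> 0"
      using that R by auto
    then show ?thesis
      by (simp add: power_int_add[symmetric] mult.assoc diff_diff_eq add_diff_eq)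
  qed
  have "(\<lambda>n. c n * complex_of_real R powi n) summable_on UNIV"
    using f[of "of_real R"] R by (auto simp: has_sum_iff)
  then have "(\<lambda>n. norm (c n * complex_of_real R powi n)) summable_on UNIV"
    by (simp add: summable_on_iff_abs_summable_on_complex)
  then have summ: "(\<lambda>n. norm (c n) * R powi n * R powi (- k - 1)) summable_on UNIV"
    using R by (intro summable_on_cmult_left) (simp add: norm_mult norm_power_int)
  have ul: "uniform_limit (sphere 0 R) (\<lambda>X x. \<Sum>n\<in>X. ?g n x) (\<lambda>x. f x * x powi (- k - 1))
      (finite_subsets_at_top UNIV)"
  proof (rule Weierstrass_m_test_general'[OF _ _ summ])
    fix x :: complex assume "x \<in> sphere 0 R"
    then show "((\<lambda>n. ?g n x) has_sum f x * x powi (- k - 1)) UNIV"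
      by (intro has_sum_cmult_left f) auto
  qed (auto simp: norm_mult norm_power_int)
  have int: "(?g n has_contour_integral c n * (if n - k - 1 = -1 then 2 * of_real pi * \<i> else 0)) (circlepath 0 R)" for n
  proof (rule has_contour_integral_eq)
    show "((\<lambda>x. c n * x powi (n - k - 1)) has_contour_integral
        c n * (if n - k - 1 = -1 then 2 * of_real pi * \<i> else 0)) (circlepath 0 R)"
      by (intro has_contour_integral_lmul has_contour_integral_power_int_circlepath R)
    fix x assume "x \<in> path_image (circlepath 0 R)"
    then have "norm x = R"
      using R by simp
    then show "c n * x powi (n - k - 1) = ?g n x"
      by (rule eq[symmetric])
  qed
  have int': "((\<lambda>x. \<Sum>n\<in>X. ?g n x) has_contour_integral
      (\<Sum>n\<in>X. c n * (if n - k - 1 = -1 then 2 * of_real pi * \<i> else 0))) (circlepath 0 R)"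
    if "finite X" for X
    using that by (intro has_contour_integral_sum int)
  have ev: "\<forall>\<^sub>F X in finite_subsets_at_top UNIV. finite X \<and> k \<in> X"
    by (rule eventually_finite_subsets_at_top_weakI[THEN eventually_conj])
       (auto simp: eventually_finite_subsets_at_top intro!: exI[of _ "{k}"])
  have "((\<lambda>X. contour_integral (circlepath 0 R) (\<lambda>x. \<Sum>n\<in>X. ?g n x)) \<longlongrightarrow>
      contour_integral (circlepath 0 R) (\<lambda>x. f x * x powi (- k - 1))) (finite_subsets_at_top UNIV)"
    by (rule contour_integral_uniform_limit_circlepath(2)[OF _ ul])
       (use R in \<open>auto intro!: eventually_finite_subsets_at_top_weakI
           intro: has_contour_integral_integrable[OF int']\<close>)
  moreover have "((\<lambda>X. contour_integral (circlepath 0 R) (\<lambda>x. \<Sum>n\<in>X. ?g n x)) \<longlongrightarrow>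
      2 * of_real pi * \<i> * c k) (finite_subsets_at_top UNIV)"
  proof (rule tendsto_eventually, rule eventually_mono[OF ev])
    fix X assume X: "finite X \<and> k \<in> X"
    have "(\<Sum>n\<in>X. c n * (if n - k - 1 = -1 then 2 * of_real pi * \<i> else 0))
        = (\<Sum>n\<in>X. if n = k then c k * (2 * of_real pi * \<i>) else 0)"
      by (intro sum.cong) auto
    also have "\<dots> = 2 * of_real pi * \<i> * c k"
      using X by simp
    finally show "contour_integral (circlepath 0 R) (\<lambda>x. \<Sum>n\<in>X. ?g n x) = 2 * of_real pi * \<i> * c k"
      using X contour_integral_unique[OF int'] by simp
  qed
  ultimately show ?thesis
    by (intro tendsto_unique) auto
qed

corollary laurent_series_unique:
  fixes c d :: "int \<Rightarrow> complex"
  assumes R: "R > 0" and "\<And>x. norm x = R \<Longrightarrow> ((\<lambda>n. c n * x powi n) has_sum f x) UNIV"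
    and "\<And>x. norm x = R \<Longrightarrow> ((\<lambda>n. d n * x powi n) has_sum f x) UNIV"
  shows "c = d"
proof
  fix k
  have "2 * of_real pi * \<i> * c k = 2 * of_real pi * \<i> * d k"
    using laurent_coeff_circlepath[OF R assms(2)] laurent_coeff_circlepath[OF R assms(3)] by metis
  then show "c k = d k"
    by simp
qed

text \<open>The straight-line homotopy between the circles avoids 0, because at each parameter it
  moves along a ray from the origin.\<close>

lemma contour_integral_circlepath_eq:
  assumes f: "f holomorphic_on -{0}" and R: "R > 0" "R' > 0"
  shows "contour_integral (circlepath 0 R) f = contour_integral (circlepath 0 R') f"
proof (rule Cauchy_theorem_homotopic_loops[where S = "-{0}"])
  show "homotopic_loops (-{0}) (circlepath 0 R) (circlepath 0 R')"
  proof (rule homotopic_loops_linear)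
    fix t :: real
    show "closed_segment (circlepath 0 R t) (circlepath 0 R' t) \<subseteq> -{0}"
    proof
      fix x assume "x \<in> closed_segment (circlepath 0 R t) (circlepath 0 R' t)"
      then obtain u where u: "0 \<le> u" "u \<le> 1" "x = (1 - u) *\<^sub>R circlepath 0 R t + u *\<^sub>R circlepath 0 R' t"
        by (auto simp: in_segment)
      then have "x = of_real ((1 - u) * R + u * R') * exp (2 * of_real pi * \<i> * t)"
        by (simp add: circlepath scaleR_conv_of_real algebra_simps)
      moreover have "(1 - u) * R + u * R' > 0"
        using u R by (cases "u = 0") (auto intro!: add_nonneg_pos)
      ultimately show "x \<in> -{0}"
        by (metis ComplI exp_not_eq_zero less_irrefl mult_eq_0_iff of_real_eq_0_iff singletonD)
    qed
  qed auto
qed (use f in auto)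

text \<open>Inside the circle the kernel 1 / (x - z) is a geometric series in z / x, outside it is
  one in x / z; in the second case the exponents are the negative ones and the sign changes. Both
  cases have the same coefficients \<open>c\<close>, so that they can be glued to one Laurent
  series.\<close>

lemma cauchy_transform_expansion:
  assumes R: "R > 0" and f: "continuous_on (sphere 0 R) f" and z: "z \<noteq> 0" "norm z \<noteq> R"
  defines "c \<equiv> \<lambda>n::int. contour_integral (circlepath 0 R) (\<lambda>x. f x * x powi (- n - 1))"
    and "I \<equiv> contour_integral (circlepath 0 R) (\<lambda>x. f x / (x - z))"
  shows "norm z < R \<Longrightarrow> ((\<lambda>n. c n * z powi n) has_sum I) {0..}"
    and "norm z > R \<Longrightarrow> ((\<lambda>n. c n * z powi n) has_sum - I) {..<0}"
proof -
  have "compact (f ` sphere 0 R)"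
    using f by (intro compact_continuous_image) auto
  then have "bounded (f ` sphere 0 R)"
    by (rule compact_imp_bounded)
  then obtain B where B: "\<And>x. norm x = R \<Longrightarrow> norm (f x) \<le> B"
    by (force simp: bounded_iff)
  have nz: "x \<noteq> 0" if "norm x = R" for x :: complex
    using that R by auto
  \<comment> \<open>The sign s and the index set A are 1 and n >= 0 for z inside the circle, -1 and
    n < 0 for z outside.\<close>
  have general: "((\<lambda>n. c n * z powi n) has_sum s * I) A"
    if summ: "(\<lambda>n. (norm z / R) powi n) summable_on A"
      and sum: "\<And>x. norm x = R \<Longrightarrow> ((\<lambda>n. (z / x) powi n) has_sum s * (x / (x - z))) A" for A s
  proof -
    let ?g = "\<lambda>n x. z powi n * (f x * x powi (- n - 1))"
    have int: "?g n contour_integrable_on circlepath 0 R" for n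
      using f R nz
      by (intro contour_integrable_continuous_circlepath continuous_intros) auto
    have int0: "(\<lambda>x. f x * x powi (- n - 1)) contour_integrable_on circlepath 0 R" for n
      using f R nz
      by (intro contour_integrable_continuous_circlepath continuous_intros) auto
    have ul: "uniform_limit (sphere 0 R) (\<lambda>X x. \<Sum>n\<in>X. ?g n x) (\<lambda>x. s * (f x / (x - z)))
        (finite_subsets_at_top A)"
    proof (rule Weierstrass_m_test_general'[OF _ _ summable_on_cmult_right[OF summ, of "B / R"]])
      fix x :: complex assume "x \<in> sphere 0 R"
      then have x: "norm x = R" "x \<noteq> 0"
        using R by auto
      have "((\<lambda>n. (f x / x) * (z / x) powi n) has_sum (f x / x) * (s * (x / (x - z)))) A"
        by (intro has_sum_cmult_right sum x)
      also have "(f x / x) * (s * (x / (x - z))) = s * (f x / (x - z))"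
        using x by simp
      also have "(\<lambda>n. (f x / x) * (z / x) powi n) = (\<lambda>n. ?g n x)"
        using x by (auto simp: power_int_divide_distrib power_int_diff power_int_minus field_simps)
      finally show "((\<lambda>n. ?g n x) has_sum s * (f x / (x - z))) A" .
    next
      fix n :: int and x :: complex assume "x \<in> sphere 0 R"
      then have x: "norm x = R" "x \<noteq> 0"
        using R by auto
      have "norm (?g n x) = norm (f x) / R * (norm z / R) powi n"
        using x R by (simp add: norm_mult norm_divide norm_power_int power_int_divide_distrib power_int_diff
            power_int_minus divide_simps)
      also have "\<dots> \<le> B / R * (norm z / R) powi n"
        using B[OF x(1)] R by (intro mult_right_mono divide_right_mono) auto
      finally show "norm (?g n x) \<le> B / R * (norm z / R) powi n" .
    qed
    have lim: "((\<lambda>X. contour_integral (circlepath 0 R) (\<lambda>x. \<Sum>n\<in>X. ?g n x)) \<longlongrightarrow>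
        contour_integral (circlepath 0 R) (\<lambda>x. s * (f x / (x - z)))) (finite_subsets_at_top A)"
      by (rule contour_integral_uniform_limit_circlepath(2)[OF _ ul])
         (use R int in \<open>auto intro!: eventually_finite_subsets_at_top_weakI contour_integrable_sum\<close>)
    have lim_eq: "contour_integral (circlepath 0 R) (\<lambda>x. s * (f x / (x - z))) = s * I"
    proof -
      have "(\<lambda>x. f x / (x - z)) contour_integrable_on circlepath 0 R"
        using f R z
        by (intro contour_integrable_continuous_circlepath continuous_intros) auto
      then show ?thesis
        unfolding I_def by (rule contour_integral_lmul)
    qed
    have "\<forall>\<^sub>F X in finite_subsets_at_top A.
        contour_integral (circlepath 0 R) (\<lambda>x. \<Sum>n\<in>X. ?g n x) = (\<Sum>n\<in>X. c n * z powi n)"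
    proof (rule eventually_finite_subsets_at_top_weakI)
      fix X :: "int set" assume "finite X"
      then show "contour_integral (circlepath 0 R) (\<lambda>x. \<Sum>n\<in>X. ?g n x) = (\<Sum>n\<in>X. c n * z powi n)"
        using int int0 by (simp add: contour_integral_sum contour_integral_lmul c_def mult.commute)
    qed
    then show ?thesis
      unfolding has_sum_def by (rule Lim_transform_eventually[OF lim[unfolded lim_eq]])
  qed
  have geo: "((\<lambda>n. y powi n) has_sum 1 / (1 - y)) {0..}" if "norm y < 1" for y :: "'a :: {real_normed_field, banach}"
  proof -
    have "((\<lambda>n. y ^ n) has_sum 1 / (1 - y)) UNIV"
      using that by (intro norm_summable_imp_has_sum geometric_sums)
        (auto simp: norm_power intro!: summable_geometric)
    then show ?thesis
      by (subst has_sum_reindex_bij_witness[of _ int nat UNIV "\<lambda>n. y ^ n"]) (auto simp: power_int_def)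
  qed
  have geo': "((\<lambda>n. y powi n) has_sum - (1 / (1 - y))) {..<0}" if "norm y > 1" for y :: "'a :: {real_normed_field, banach}"
  proof -
    have y: "y \<noteq> 0" "y \<noteq> 1"
      using that by auto
    have "norm (1 / y) < 1"
      using that by (simp add: norm_divide divide_less_eq)
    note y = y this
    have "((\<lambda>n. (1 / y) * (1 / y) powi n) has_sum (1 / y) * (1 / (1 - 1 / y))) {0..}"
      by (intro has_sum_cmult_right geo y)
    also have "(1 / y) * (1 / (1 - 1 / y)) = - (1 / (1 - y))"
      using y by (simp add: divide_simps)
    finally show ?thesis
      using y by (subst has_sum_reindex_bij_witness[of _ "\<lambda>n. - n - 1" "\<lambda>n. - n - 1" "{0..}"
            "\<lambda>n. (1 / y) * (1 / y) powi n"])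
        (auto simp: power_int_diff power_int_minus power_int_divide_distrib field_simps)
  qed
  {
    assume less: "norm z < R"
    have "((\<lambda>n. c n * z powi n) has_sum 1 * I) {0..}"
    proof (rule general)
      show "(\<lambda>n. (norm z / R) powi n) summable_on {0..}"
        using geo[of "norm z / R"] less R by (auto simp: has_sum_iff)
      fix x :: complex assume x: "norm x = R"
      have "1 / (1 - z / x) = 1 * (x / (x - z))"
        using nz[OF x] by (simp add: divide_simps)
      then show "((\<lambda>n. (z / x) powi n) has_sum 1 * (x / (x - z))) {0..}"
        using geo[of "z / x"] less x R by (simp add: norm_divide)
    qed
    then show "((\<lambda>n. c n * z powi n) has_sum I) {0..}"
      by simp
  }
  {
    assume greater: "norm z > R"
    have "((\<lambda>n. c n * z powi n) has_sum (-1) * I) {..<0}"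
    proof (rule general)
      show "(\<lambda>n. (norm z / R) powi n) summable_on {..<0}"
        using geo'[of "norm z / R"] greater R by (auto simp: has_sum_iff)
      fix x :: complex assume x: "norm x = R"
      have "- (1 / (1 - z / x)) = (-1) * (x / (x - z))"
        using nz[OF x] by (simp add: divide_simps)
      then show "((\<lambda>n. (z / x) powi n) has_sum (-1) * (x / (x - z))) {..<0}"
        using geo'[of "z / x"] greater x R by (simp add: norm_divide)
    qed
    then show "((\<lambda>n. c n * z powi n) has_sum - I) {..<0}"
      by simp
  }
qed

text \<open>Cauchy's formula for an annulus around z, obtained from the difference quotient of f at
  z: it extends holomorphically over z, so its integrals over the two circles agree, and the
  integrals of 1 / (x - z), namely 2 pi i on the outer and 0 on the inner circle, isolate f z.
  Homotopy invariance makes the coefficients independent of z.\<close>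

theorem laurent_series_exists:
  assumes f: "f holomorphic_on -{0}"
  obtains c :: "int \<Rightarrow> complex" where
    "\<And>z. z \<noteq> 0 \<Longrightarrow> ((\<lambda>n. c n * z powi n) has_sum f z) UNIV"
proof -
  let ?C = "\<lambda>R n. contour_integral (circlepath 0 R) (\<lambda>x. f x * x powi (- n - 1))"
  define c where "c n = ?C 1 n / (2 * of_real pi * \<i>)" for n
  have "((\<lambda>n. c n * z powi n) has_sum f z) UNIV" if z: "z \<noteq> 0" for z
  proof -
    define r R where "r = norm z / 2" and "R = 2 * norm z"
    have r: "r > 0" "r < norm z" and R: "R > 0" "R > norm z"
      using z by (auto simp: r_def R_def)
    have C: "?C s n = 2 * of_real pi * \<i> * c n" if "s > 0" for s n
    proof -
      have "?C s n = ?C 1 n"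
        using that by (intro contour_integral_circlepath_eq holomorphic_intros f) auto
      then show ?thesis
        by (simp add: c_def)
    qed
    define I where "I s = contour_integral (circlepath 0 s) (\<lambda>x. f x / (x - z))" for s
    have cont: "continuous_on (sphere 0 s) f" if "s > 0" for s
      using holomorphic_on_imp_continuous_on[OF f] by (rule continuous_on_subset) (use that in auto)
    have 1: "((\<lambda>n. 2 * of_real pi * \<i> * c n * z powi n) has_sum I R) {0..}"
      using cauchy_transform_expansion(1)[OF R(1) cont[OF R(1)] z] R C[OF R(1)] by (simp add: I_def)
    have 2: "((\<lambda>n. 2 * of_real pi * \<i> * c n * z powi n) has_sum - I r) {..<0}"
      using cauchy_transform_expansion(2)[OF r(1) cont[OF r(1)] z] r C[OF r(1)] by (simp add: I_def)
    have "((\<lambda>n. 2 * of_real pi * \<i> * c n * z powi n) has_sum (I R + - I r)) ({0..} \<union> {..<0})"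
      by (intro has_sum_Un_disjoint 1 2) auto
    also have "{0..} \<union> {..<0} = (UNIV :: int set)"
      by auto
    also have "I R + - I r = 2 * of_real pi * \<i> * f z"
    proof -
      define g where "g x = (if x = z then deriv f z else (f x - f z) / (x - z))" for x
      have "g holomorphic_on -{0}"
        unfolding g_def by (rule pole_lemma[OF f]) (use z in \<open>simp add: interior_open open_Compl\<close>)
      then have g: "contour_integral (circlepath 0 R) g = contour_integral (circlepath 0 r) g"
        by (intro contour_integral_circlepath_eq r R)
      have split: "contour_integral (circlepath 0 s) g
          = I s - f z * contour_integral (circlepath 0 s) (\<lambda>x. 1 / (x - z))"
        if s: "s > 0" "s \<noteq> norm z" for s
      proof -
        have int: "(\<lambda>x. f x / (x - z)) contour_integrable_on circlepath 0 s"
          "(\<lambda>x. 1 / (x - z)) contour_integrable_on circlepath 0 s"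
          using s cont[OF s(1)]
          by (auto intro!: contour_integrable_continuous_circlepath continuous_intros)
        have "contour_integral (circlepath 0 s) g
            = contour_integral (circlepath 0 s) (\<lambda>x. f x / (x - z) - f z * (1 / (x - z)))"
          by (rule contour_integral_eq) (use s in \<open>auto simp: g_def diff_divide_distrib\<close>)
        also have "\<dots> = I s - f z * contour_integral (circlepath 0 s) (\<lambda>x. 1 / (x - z))"
          unfolding I_def
          by (subst contour_integral_diff[OF int(1) contour_integrable_lmul[OF int(2)]],
              subst contour_integral_lmul[OF int(2)]) rule
        finally show ?thesis .
      qed
      have iR: "contour_integral (circlepath 0 R) (\<lambda>x. 1 / (x - z)) = 2 * of_real pi * \<i> * 1"
        by (rule contour_integral_unique, rule Cauchy_integral_circlepath_simple[where f = "\<lambda>_. 1"])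
           (use R in auto)
      have ir: "contour_integral (circlepath 0 r) (\<lambda>x. 1 / (x - z)) = 0"
        by (rule contour_integral_unique, rule Cauchy_theorem_disc_simple[where a = 0 and e = "norm z"])
           (use r in \<open>auto intro!: holomorphic_intros\<close>)
      show ?thesis
        using g split[OF R(1)] split[OF r(1)] r R iR ir by (simp add: algebra_simps)
    qed
    finally have "((\<lambda>n. 2 * of_real pi * \<i> * (c n * z powi n)) has_sum 2 * of_real pi * \<i> * f z) UNIV"
      by (simp add: mult.assoc)
    then show ?thesis
      by (subst (asm) has_sum_cmult_right_iff) auto
  qed
  then show ?thesis
    using that by blast
qed

text \<open>The Taylor coefficients are extended by 0 to negative indices so that such expansions
  can be added to Laurent series coefficient by coefficient.\<close>

lemma holomorphic_power_series_int:
  assumes "f holomorphic_on ball 0 R"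
  obtains c :: "int \<Rightarrow> complex" where
    "\<And>n. n < 0 \<Longrightarrow> c n = 0" "\<And>z. norm z < R \<Longrightarrow> ((\<lambda>n. c n * z powi n) has_sum f z) UNIV"
proof -
  define a where "a n = (deriv ^^ n) f 0 / fact n" for n
  define c where "c n = (if n < 0 then 0 else a (nat n))" for n :: int
  have sums: "(\<lambda>n. a n * z ^ n) sums f z" if "norm z < R" for z
    using holomorphic_power_series[OF assms, of z] that by (simp add: a_def)
  have "((\<lambda>n. c n * z powi n) has_sum f z) UNIV" if z: "norm z < R" for z
  proof -
    obtain s where s: "norm z < s" "s < R"
      using dense[OF z] by blast
    have "summable (\<lambda>n. a n * complex_of_real s ^ n)"
      using sums[of "of_real s"] s norm_ge_zero[of z] by (auto simp: sums_iff)
    then have "summable (\<lambda>n. norm (a n * z ^ n))"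
      by (rule powser_insidea) (use s norm_ge_zero[of z] in auto)
    then have "((\<lambda>n. a n * z ^ n) has_sum f z) UNIV"
      using sums[OF z] by (rule norm_summable_imp_has_sum)
    then have "((\<lambda>n. c n * z powi n) has_sum f z) {0..}"
      by (subst has_sum_reindex_bij_witness[of _ int nat UNIV "\<lambda>n. a n * z ^ n"])
         (auto simp: power_int_def c_def)
    then show ?thesis
      by (subst has_sum_cong_neutral[where S = UNIV and T = "{0..}" and g = "\<lambda>n. c n * z powi n"])
         (auto simp: c_def)
  qed
  then show ?thesis
    using that[of c] by (auto simp: c_def)
qed

subsection \<open>The theta function\<close>

lemma powi_add: "x \<noteq> 0 \<Longrightarrow> x powi (a + b) = x powi a * x powi b" for x :: complex
  by (simp add: power_int_add)

lemma jtheta_holomorphic: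
  assumes "norm q < 1" "0 \<notin> A"
  shows "(\<lambda>x. jtheta x q) holomorphic_on A"
proof -
  have "((\<lambda>x. qpoch_inf x q) \<circ> (\<lambda>x. q / x)) holomorphic_on A"
    by (rule holomorphic_on_compose)
       (use assms in \<open>auto intro!: holomorphic_intros qpoch_inf_holomorphic\<close>)
  then show ?thesis
    unfolding jtheta_def using assms
    by (intro holomorphic_intros qpoch_inf_holomorphic) (auto simp: o_def)
qed

lemma jtheta_reflect: "q \<noteq> 0 \<Longrightarrow> x \<noteq> 0 \<Longrightarrow> jtheta (q / x) q = jtheta x q"
  by (simp add: jtheta_def mult_ac)

lemma jtheta_mult_q:
  assumes "norm q < 1" "q \<noteq> 0" "x \<noteq> 0"
  shows "jtheta (q * x) q = - jtheta x q / x"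
proof -
  have 1: "qpoch_inf (q / (q * x)) q = (1 - 1 / x) * qpoch_inf (q / x) q"
    using qpoch_inf_rec[OF assms(1), of "1 / x"] assms by simp
  have 2: "qpoch_inf x q = (1 - x) * qpoch_inf (q * x) q"
    by (rule qpoch_inf_rec[OF assms(1)])
  show ?thesis
    unfolding jtheta_def 1 2 using assms by (simp add: field_simps)
qed

lemma jtheta_mult_q_powi:
  assumes q: "norm q < 1" "q \<noteq> 0" and x: "x \<noteq> 0"
  shows "jtheta (q powi k * x) q = (-1) powi k * q powi (- binom2 k) * x powi (- k) * jtheta x q"
proof -
  have step: "jtheta (q powi (k + 1) * x) q = - jtheta (q powi k * x) q * q powi (- k) / x" for k
  proof -
    have "q powi (k + 1) * x = q * (q powi k * x)"
      using q by (simp add: power_int_add)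
    then show ?thesis
      using jtheta_mult_q[of q "q powi k * x"] assms
      by (simp add: power_int_minus divide_simps mult.assoc)
  qed
  have rhs: "(-1) powi (k + 1) * q powi (- binom2 (k + 1)) * x powi (- (k + 1)) * J
      = - ((-1) powi k * q powi (- binom2 k) * x powi (- k) * J) * q powi (- k) / x" for k J
    using q x by (simp add: binom2_plus_1 power_int_add power_int_diff power_int_minus divide_simps)
  show ?thesis
  proof (induction k rule: int_induct[where k = 0])
    case base
    show ?case
      by simp
  next
    case (step1 k)
    show ?case
      unfolding step rhs step1.IH ..
  next
    case (step2 k)
    have "- jtheta (q powi (k - 1) * x) q * q powi (- (k - 1)) / x
        = - ((-1) powi (k - 1) * q powi (- binom2 (k - 1)) * x powi (- (k - 1)) * jtheta x q)
          * q powi (- (k - 1)) / x"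
      using step2.IH step[of "k - 1"] rhs[of "k - 1" "jtheta x q"] by simp
    then show ?case
      using q x by simp
  qed
qed

text \<open>The factors (x)_inf and (q/x)_inf vanish at q^(-i) and q^(i+1) for i >= 0, which
  together are all powers of q.\<close>

lemma jtheta_eq_0_iff:
  assumes q: "norm q < 1" "q \<noteq> 0" and x: "x \<noteq> 0"
  shows "jtheta x q = 0 \<longleftrightarrow> (\<exists>k. x = q powi k)"
proof
  assume "jtheta x q = 0"
  then have "qpoch_inf x q = 0 \<or> qpoch_inf (q / x) q = 0"
    using qpoch_inf_q_q_nonzero[OF q(1)] by (auto simp: jtheta_def)
  then consider i where "q ^ i * x = 1" | i where "q ^ i * (q / x) = 1"
    using q by (auto simp: qpoch_inf_eq_0_iff)
  then show "\<exists>k. x = q powi k"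
  proof cases
    case 1
    then have "x = q powi (- int i)"
      using q by (simp add: power_int_minus field_simps)
    then show ?thesis ..
  next
    case 2
    then have "x = q powi (int i + 1)"
      using q x by (simp add: power_int_add field_simps)
    then show ?thesis ..
  qed
next
  assume "\<exists>k. x = q powi k"
  then obtain k where k: "x = q powi k" ..
  have "qpoch_inf 1 q = 0"
    using qpoch_inf_rec[OF q(1), of 1] by simp
  then have "jtheta 1 q = 0"
    by (simp add: jtheta_def)
  then show "jtheta x q = 0"
    using jtheta_mult_q_powi[OF q, of 1 k] by (simp add: k)
qed

text \<open>Quasi-periodicity moves the zero q^k to 1, where j(y;q) = (1 - y) J(y) with J(1) =
  (q)_inf^3. This is the origin of (q)_inf^(-3) in the final formula.\<close>

lemma jtheta_simple_zero:
  assumes q: "norm q < 1" "q \<noteq> 0"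
  shows "((\<lambda>z. (z - q powi k) / jtheta z q) \<longlongrightarrow>
           - ((-1) powi k * q powi (binom2 k + k) / qpoch_inf q q ^ 3)) (at (q powi k))"
proof -
  define Q where "Q = qpoch_inf q q"
  define J where "J y = qpoch_inf (q * y) q * qpoch_inf (q / y) q * Q" for y
  have Q: "Q \<noteq> 0"
    unfolding Q_def by (rule qpoch_inf_q_q_nonzero[OF q(1)])
  have cont: "isCont (\<lambda>x. qpoch_inf x q) x" for x
    using holomorphic_on_imp_continuous_on[OF qpoch_inf_holomorphic[OF q(1), of UNIV]]
    by (simp add: continuous_on_eq_continuous_at)
  define y where "y z = z / q powi k" for z
  have y0: "y (q powi k) = 1"
    using q by (simp add: y_def)
  have y: "(y \<longlongrightarrow> 1) (at (q powi k))"
    unfolding y_def using q by (intro tendsto_eq_intros | simp)+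
  have "((\<lambda>z. - (q powi k) * ((-1) powi k * q powi (binom2 k) * (y z) powi k) / J (y z)) \<longlongrightarrow>
      - (q powi k) * ((-1) powi k * q powi (binom2 k) * 1 powi k) / (qpoch_inf (q * 1) q * qpoch_inf (q / 1) q * Q))
      (at (q powi k))"
    unfolding J_def using y Q
    by (intro tendsto_intros isCont_tendsto_compose[OF cont]) (auto simp: Q_def)
  moreover have "\<forall>\<^sub>F z in at (q powi k).
      - (q powi k) * ((-1) powi k * q powi (binom2 k) * (y z) powi k) / J (y z) = (z - q powi k) / jtheta z q"
  proof -
    have "\<forall>\<^sub>F z in at (q powi k). z \<noteq> q powi k \<and> z \<noteq> 0"
      using q by (intro eventually_conj eventually_neq_at_within)
    then show ?thesis
    proof eventually_elim
      case (elim z)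
      then have yz: "y z \<noteq> 0" "y z \<noteq> 1"
        using q by (auto simp: y_def)
      have z: "z = q powi k * y z"
        using q by (simp add: y_def)
      have "jtheta (y z) q = (1 - y z) * J (y z)"
        unfolding jtheta_def J_def Q_def using qpoch_inf_rec[OF q(1), of "y z"] by simp
      then have j: "jtheta z q = (-1) powi k * q powi (- binom2 k) * (y z) powi (- k) * ((1 - y z) * J (y z))"
        using jtheta_mult_q_powi[OF q yz(1), of k] z by simp
      have "(z - q powi k) = - (q powi k) * (1 - y z)"
        using z by (simp add: algebra_simps)
      moreover have "(-1 :: complex) powi k * (-1) powi k = 1"
        by (simp add: power_int_mult_distrib[symmetric])
      moreover have "- a * (s * b * c) / J' = - a * (1 - y') / (s * inverse b * inverse c * ((1 - y') * J'))"
        if "s * s = 1" "b \<noteq> 0" "c \<noteq> 0" "y' \<noteq> 1" for a b c s J' y' :: complex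
      proof (cases "J' = 0")
        case False
        have "s \<noteq> 0"
          using that(1) by auto
        with False that have "- a * (1 - y') / (s * inverse b * inverse c * ((1 - y') * J')) = - a * b * c / (s * J')"
          by (simp add: field_simps)
        also have "\<dots> = - a * b * c * (s * s) / (s * J')"
          using that(1) by simp
        also have "\<dots> = - a * (s * b * c) / J'"
          using \<open>s \<noteq> 0\<close> by simp
        finally show ?thesis ..
      qed auto
      ultimately show ?case
        unfolding j power_int_minus using q yz by simp
    qed
  qed
  ultimately have "((\<lambda>z. (z - q powi k) / jtheta z q) \<longlongrightarrow>
      - (q powi k) * ((-1) powi k * q powi (binom2 k) * 1 powi k) / (qpoch_inf (q * 1) q * qpoch_inf (q / 1) q * Q))
      (at (q powi k))"
    by (rule Lim_transform_eventually)
  then show ?thesis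
    using q by (simp add: Q_def power_int_add power3_eq_cube mult_ac)
qed

lemma norm_powi_less_1:
  fixes q :: complex
  assumes "norm q < 1" "q \<noteq> 0" "m > 0"
  shows "norm (q powi m) < 1"
proof -
  obtain n where "m = int (Suc n)"
    using assms(3) by (metis Suc_pred' pos_int_cases)
  then show ?thesis
    using assms power_Suc_less_one[of "norm q" n]
    by (simp del: of_nat_Suc power_Suc add: norm_power)
qed

text \<open>The exponent m n^2 + b n is the normal form of every theta series below. Splitting it as
  2 m binom2(n) + (m + b) n and cancelling two signs (-1)^n gives the shape of the triple product
  with nome q^(2m).\<close>

lemma theta_summand:
  fixes q x :: complex
  assumes q: "q \<noteq> 0"
  shows "(-1) powi n * (q powi (2 * m)) powi binom2 n * (- (q powi (m + b)) * x) powi n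
    = q powi (m * n\<^sup>2 + b * n) * x powi n"
proof -
  have "m * n\<^sup>2 + b * n = m * (n * (n - 1)) + (m + b) * n"
    by (simp add: power2_eq_square algebra_simps)
  then have "m * n\<^sup>2 + b * n = 2 * m * binom2 n + (m + b) * n"
    by (simp add: two_binom2[symmetric])
  moreover have "(- (q powi (m + b)) * x) powi n = (-1) powi n * q powi ((m + b) * n) * x powi n"
    using power_int_mult_distrib[of "-1" "q powi (m + b) * x" n]
    by (simp add: power_int_mult_distrib power_int_mult)
  moreover have "(-1 :: complex) powi n * (-1) powi n = 1"
    by (simp add: power_int_mult_distrib[symmetric])
  moreover have "q powi (2 * m * binom2 n + (m + b) * n) = (q powi (2 * m)) powi binom2 n * q powi ((m + b) * n)"
    using q by (simp only: powi_add power_int_mult[symmetric] not_False_eq_True)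
  moreover have "s * A * (s * B * C) = (s * s) * (A * B) * C" for s A B C :: complex
    by simp
  ultimately show ?thesis
    by simp
qed

lemma jtheta_shifted_expansion:
  assumes q: "norm q < 1" "q \<noteq> 0" and x: "x \<noteq> 0" and m: "m > 0"
  shows "((\<lambda>n. q powi (m * n\<^sup>2 + b * n) * x powi n) has_sum jtheta (- (q powi (m + b)) * x) (q powi (2 * m))) UNIV"
proof -
  have "norm (q powi (2 * m)) < 1"
    using q m by (intro norm_powi_less_1) auto
  then have "((\<lambda>n. (-1) powi n * (q powi (2 * m)) powi binom2 n * (- (q powi (m + b)) * x) powi n)
      has_sum jtheta (- (q powi (m + b)) * x) (q powi (2 * m))) UNIV"
    using q x by (intro jacobi_triple_product) auto
  then show ?thesis
    unfolding theta_summand[OF q(2)] .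
qed

lemma summable_on_quadratic_exponent:
  fixes t y :: real
  assumes "0 < t" "t < 1" "0 < y" "m > 0"
  shows "(\<lambda>n::int. t powi (m * n\<^sup>2 + b * n) * y powi n) summable_on UNIV"
proof -
  have "((\<lambda>n. complex_of_real t powi (m * n\<^sup>2 + b * n) * complex_of_real y powi n) summable_on UNIV)"
    using jtheta_shifted_expansion[of "complex_of_real t" "complex_of_real y" m b] assms
    by (auto simp: has_sum_iff)
  then have "(\<lambda>n. norm (complex_of_real t powi (m * n\<^sup>2 + b * n) * complex_of_real y powi n)) summable_on UNIV"
    by (simp add: summable_on_iff_abs_summable_on_complex)
  then show ?thesis
    using assms by (simp add: norm_mult norm_power_int)
qed


subsection \<open>Theta-like sums with simple poles\<close>

text \<open>Weierstrass's theorem on uniform limits, taken along the filter of finite index sets so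
  that it fits bilateral sums.\<close>

lemma holomorphic_on_infsum:
  fixes f :: "'a \<Rightarrow> complex \<Rightarrow> complex"
  assumes hol: "\<And>r. f r holomorphic_on U"
    and bound: "\<And>z. z \<in> U \<Longrightarrow> \<exists>e>0. \<exists>M. cball z e \<subseteq> U \<and> M summable_on UNIV \<and>
                  (\<forall>r. \<forall>x\<in>cball z e. norm (f r x) \<le> M r)"
  shows "(\<lambda>z. \<Sum>\<^sub>\<infinity>r. f r z) holomorphic_on U"
    and "\<And>z. z \<in> U \<Longrightarrow> (\<lambda>r. f r z) summable_on UNIV"
proof -
  have "(\<lambda>z. \<Sum>\<^sub>\<infinity>r. f r z) field_differentiable (at z within U) \<and> (\<lambda>r. f r z) summable_on UNIV"
    if "z \<in> U" for z
  proof -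
    from bound[OF that] obtain e M where e: "e > 0" "cball z e \<subseteq> U" "M summable_on UNIV"
      and M: "\<And>r x. x \<in> cball z e \<Longrightarrow> norm (f r x) \<le> M r"
      by blast
    have "(\<lambda>r. norm (f r z)) summable_on UNIV"
      by (rule summable_on_comparison_test[OF e(3)]) (use M[of z] e(1) in auto)
    then have summ: "(\<lambda>r. f r z) summable_on UNIV"
      by (rule abs_summable_summable)
    have ul: "uniform_limit (cball z e) (\<lambda>X x. \<Sum>r\<in>X. f r x) (\<lambda>x. \<Sum>\<^sub>\<infinity>r. f r x) (finite_subsets_at_top UNIV)"
      by (rule Weierstrass_m_test_general[OF _ e(3)]) (use M in auto)
    have "\<forall>\<^sub>F X in finite_subsets_at_top UNIV.
        continuous_on (cball z e) (\<lambda>x. \<Sum>r\<in>X. f r x) \<and> (\<lambda>x. \<Sum>r\<in>X. f r x) holomorphic_on ball z e"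
    proof (intro always_eventually allI conjI)
      fix X
      have *: "(\<lambda>x. \<Sum>r\<in>X. f r x) holomorphic_on U"
        by (intro holomorphic_intros hol)
      show "continuous_on (cball z e) (\<lambda>x. \<Sum>r\<in>X. f r x)"
        using holomorphic_on_imp_continuous_on[OF *] e(2) by (rule continuous_on_subset)
      show "(\<lambda>x. \<Sum>r\<in>X. f r x) holomorphic_on ball z e"
        using * by (rule holomorphic_on_subset) (use e(2) ball_subset_cball in blast)
    qed
    from holomorphic_uniform_limit[OF this ul] have "(\<lambda>x. \<Sum>\<^sub>\<infinity>r. f r x) holomorphic_on ball z e"
      by auto
    then have "(\<lambda>x. \<Sum>\<^sub>\<infinity>r. f r x) field_differentiable at z"
      using e(1) by (intro holomorphic_on_imp_differentiable_at[of _ "ball z e"]) auto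
    with summ show ?thesis
      by (auto intro: field_differentiable_at_within)
  qed
  then show "(\<lambda>z. \<Sum>\<^sub>\<infinity>r. f r z) holomorphic_on U"
    and "\<And>z. z \<in> U \<Longrightarrow> (\<lambda>r. f r z) summable_on UNIV"
    by (auto simp: holomorphic_on_def)
qed

text \<open>All poles x = q^(-e r) have modulus at least |q|^(-D), so a one-sided half of the sum is
  holomorphic in that disc. Both halves of the bilateral sum take this form, one in x and the other
  in 1 / x.\<close>

lemma half_pole_sum_holomorphic:
  fixes c :: "nat \<Rightarrow> complex" and e :: "nat \<Rightarrow> int"
  assumes q: "norm q < 1" "q \<noteq> 0"
    and c: "\<And>y. y > 0 \<Longrightarrow> (\<lambda>r. norm (c r) * y ^ (J * r)) summable_on UNIV"
    and e: "\<And>r. e r \<ge> D"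
  shows "(\<lambda>x. \<Sum>\<^sub>\<infinity>r. c r * x ^ (J * r) / (1 - x * q powi e r)) holomorphic_on ball 0 (norm q powi (- D))"
    and "norm x < norm q powi (- D) \<Longrightarrow> (\<lambda>r. c r * x ^ (J * r) / (1 - x * q powi e r)) summable_on UNIV"
    and "norm x < norm q powi (- D) \<Longrightarrow> x * q powi e r \<noteq> 1"
proof -
  let ?U = "ball 0 (norm q powi (- D)) :: complex set"
  have le: "norm (x * q powi e r) \<le> y * norm q powi D" if "norm x \<le> y" for x y r
  proof -
    have "norm q powi e r \<le> norm q powi D"
      using q e by (intro power_int_decreasing) auto
    then show ?thesis
      unfolding norm_mult norm_power_int using that q order.trans[OF norm_ge_zero that]
      by (intro mult_mono) auto
  qed
  have lt: "y * norm q powi D < 1" if "y < norm q powi (- D)" for y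
    using that q by (simp add: power_int_minus field_simps)
  show neq: "x * q powi e r \<noteq> 1" if "norm x < norm q powi (- D)" for x r
    using le[of x "norm x" r] lt[OF that] by auto
  have hol: "(\<lambda>x. c r * x ^ (J * r) / (1 - x * q powi e r)) holomorphic_on ?U" for r
    using neq by (intro holomorphic_intros) auto
  have bound: "\<exists>\<epsilon>>0. \<exists>M. cball z \<epsilon> \<subseteq> ?U \<and> M summable_on UNIV \<and>
      (\<forall>r. \<forall>x\<in>cball z \<epsilon>. norm (c r * x ^ (J * r) / (1 - x * q powi e r)) \<le> M r)" if z: "z \<in> ?U" for z
  proof -
    obtain y where y: "norm z < y" "y < norm q powi (- D)"
      using dense[of "norm z" "norm q powi (- D)"] z by auto
    have y0: "y > 0"
      using y(1) norm_ge_zero[of z] by linarith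
    \<comment> \<open>A lower bound for all denominators at once on |x| <= y, a disc that contains
      the chosen ball about z.\<close>
    define \<delta> where "\<delta> = 1 - y * norm q powi D"
    have \<delta>: "\<delta> > 0"
      using lt[OF y(2)] by (simp add: \<delta>_def)
    have norm_le: "norm x \<le> y" if "x \<in> cball z (y - norm z)" for x
      using that norm_triangle_ineq2[of x z] by (simp add: dist_norm norm_minus_commute)
    have "norm (c r * x ^ (J * r) / (1 - x * q powi e r)) \<le> norm (c r) * y ^ (J * r) * (1 / \<delta>)"
      if x: "x \<in> cball z (y - norm z)" for x r
    proof -
      have "\<delta> \<le> norm (1 - x * q powi e r)"
        using le[OF norm_le[OF x], of r] norm_triangle_ineq2[of 1 "x * q powi e r"]
        by (simp add: \<delta>_def)
      then have "norm (c r) * norm x ^ (J * r) / norm (1 - x * q powi e r)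
          \<le> norm (c r) * y ^ (J * r) / \<delta>"
        using norm_le[OF x] \<delta> y0 by (intro frac_le mult_left_mono power_mono mult_nonneg_nonneg) auto
      then show ?thesis
        by (simp add: norm_mult norm_divide norm_power)
    qed
    then show ?thesis
      using y norm_le
      by (intro exI[of _ "y - norm z"] exI[of _ "\<lambda>r. norm (c r) * y ^ (J * r) * (1 / \<delta>)"]
          conjI summable_on_cmult_left c y0) force+
  qed
  show "(\<lambda>x. \<Sum>\<^sub>\<infinity>r. c r * x ^ (J * r) / (1 - x * q powi e r)) holomorphic_on ?U"
    by (rule holomorphic_on_infsum(1)[OF hol bound])
  show "(\<lambda>r. c r * x ^ (J * r) / (1 - x * q powi e r)) summable_on UNIV" if "norm x < norm q powi (- D)"
    by (rule holomorphic_on_infsum(2)[OF hol bound]) (use that in auto)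
qed

text \<open>At a pole the offending summand is \<open>0\<close>, because \<open>x / 0 = 0\<close>.\<close>

definition pole_term :: "complex \<Rightarrow> int \<Rightarrow> int \<Rightarrow> int \<Rightarrow> int \<Rightarrow> complex \<Rightarrow> int \<Rightarrow> complex" where
  "pole_term q p j b d x r = q powi (j * p * r\<^sup>2 + b * r) * x powi (j * r) / (1 - x * q powi (2 * p * r + d))"

text \<open>Two families are covered. With b = p this is the sum S_d of the overview; with
  \<open>p * j\<close> in place of p and 1 in place of j it is the bilateral sum of an Appell
  function of nome q^(2pj).\<close>

definition pole_sum :: "complex \<Rightarrow> int \<Rightarrow> int \<Rightarrow> int \<Rightarrow> int \<Rightarrow> complex \<Rightarrow> complex" where
  "pole_sum q p j b d x = (\<Sum>\<^sub>\<infinity>r. pole_term q p j b d x r)"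

locale pole_sums =
  fixes q :: complex and p j :: int
  assumes q: "norm q < 1" "q \<noteq> 0" and p: "p \<ge> 1" and j: "j \<ge> 1"
begin

text \<open>Both halves are treated together: k = 1 for indices running up from a, k = -1 for those
  running down. As k^2 = 1, the quadratic part of the exponent is the same, and u n absorbs the
  extra power that arises when the lower half is rewritten in 1 / x.\<close>

lemma coeff_summable:
  assumes y: "y > 0" and k: "k = 1 \<or> k = -1"
  shows "(\<lambda>n::nat. norm (q powi (j * p * (a + k * int n)\<^sup>2 + b * (a + k * int n) + u * int n)) * y ^ (nat j * n)) summable_on UNIV"
proof -
  have jp: "j * p > 0"
    using p j by simp
  have exponent: "j * p * (a + k * n)\<^sup>2 + b * (a + k * n) + u * n
      = (j * p * n\<^sup>2 + (2 * j * p * a * k + b * k + u) * n) + (j * p * a\<^sup>2 + b * a)" for n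
    using k by (auto simp: power2_eq_square algebra_simps)
  have "(\<lambda>n::int. norm q powi (j * p * n\<^sup>2 + (2 * j * p * a * k + b * k + u) * n) * (y powi j) powi n) summable_on UNIV"
    using q y jp by (intro summable_on_quadratic_exponent) auto
  then have "(\<lambda>n::int. norm q powi (j * p * n\<^sup>2 + (2 * j * p * a * k + b * k + u) * n) * (y powi j) powi n) summable_on range int"
    by (rule summable_on_subset_banach) auto
  then have "(\<lambda>n. norm q powi (j * p * (int n)\<^sup>2 + (2 * j * p * a * k + b * k + u) * int n) * (y powi j) powi int n) summable_on UNIV"
    by (subst (asm) summable_on_reindex) (auto simp: o_def)
  then have "(\<lambda>n. norm q powi (j * p * (int n)\<^sup>2 + (2 * j * p * a * k + b * k + u) * int n) * (y powi j) powi int n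
      * norm q powi (j * p * a\<^sup>2 + b * a)) summable_on UNIV"
    by (rule summable_on_cmult_left)
  also have "(\<lambda>n. norm q powi (j * p * (int n)\<^sup>2 + (2 * j * p * a * k + b * k + u) * int n) * (y powi j) powi int n
      * norm q powi (j * p * a\<^sup>2 + b * a))
      = (\<lambda>n::nat. norm (q powi (j * p * (a + k * int n)\<^sup>2 + b * (a + k * int n) + u * int n)) * y ^ (nat j * n))"
  proof
    fix n :: nat
    have "y ^ (nat j * n) = (y powi j) powi int n"
      using j by (simp add: power_int_def power_mult)
    then show "norm q powi (j * p * (int n)\<^sup>2 + (2 * j * p * a * k + b * k + u) * int n) * (y powi j) powi int n
      * norm q powi (j * p * a\<^sup>2 + b * a)
      = norm (q powi (j * p * (a + k * int n)\<^sup>2 + b * (a + k * int n) + u * int n)) * y ^ (nat j * n)"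
      using q by (simp only: exponent norm_power_int) (simp add: power_int_add mult_ac)
  qed
  finally show ?thesis .
qed

text \<open>The sum is cut at -N and N. The upper tail is a power series in x with poles far out;
  the lower one becomes such a series in 1 / x through 1 / (1 - x q^(-e)) = -(q^e / x) / (1 - q^e /
  x). The split-off powers of x are the exact leading ones, which for N = 0 exhibits the gap in the
  exponents.\<close>

lemma pole_sum_decomposition:
  assumes N: "2 * p * N + d \<ge> 1" "2 * p * N + 2 * p - d \<ge> 1" "N \<ge> 0"
  defines "D1 \<equiv> 2 * p * N + d" and "D2 \<equiv> 2 * p * N + 2 * p - d"
  obtains E1 E2 where
    "E1 holomorphic_on ball 0 (norm q powi (- D1))" "E2 holomorphic_on ball 0 (norm q powi (- D2))"
    "\<And>x. x \<noteq> 0 \<Longrightarrow> norm x < norm q powi (- D1) \<Longrightarrow> norm x > norm q powi D2 \<Longrightarrow>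
       pole_term q p j b d x summable_on UNIV \<and>
       pole_sum q p j b d x = (\<Sum>r=-N..<N. pole_term q p j b d x r) + x powi (j * N) * E1 x
         + x powi (- (j * N + j + 1)) * E2 (1 / x)"
proof -
  define c1 where "c1 k = q powi (j * p * (N + 1 * int k)\<^sup>2 + b * (N + 1 * int k) + 0 * int k)" for k
  \<comment> \<open>The factor -q^(e2 k) produced by inverting the denominator is spread over
    \<open>q powi D2\<close> and the summand \<open>2 * p * int k\<close>.\<close>
  define c2 where "c2 k = - (q powi D2 *
      q powi (j * p * (- N - 1 + (-1) * int k)\<^sup>2 + b * (- N - 1 + (-1) * int k) + 2 * p * int k))" for k
  define e1 e2 where "e1 k = 2 * p * int k + D1" and "e2 k = 2 * p * int k + D2" for k
  have c1: "(\<lambda>r. norm (c1 r) * y ^ (nat j * r)) summable_on UNIV" if "y > 0" for y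
    unfolding c1_def using that by (intro coeff_summable) auto
  have c2: "(\<lambda>r. norm (c2 r) * y ^ (nat j * r)) summable_on UNIV" if "y > 0" for y
  proof -
    have "(\<lambda>k. norm (q powi D2) *
        (norm (q powi (j * p * (- N - 1 + (-1) * int k)\<^sup>2 + b * (- N - 1 + (-1) * int k) + 2 * p * int k))
          * y ^ (nat j * k))) summable_on UNIV"
      using that by (intro summable_on_cmult_right coeff_summable) auto
    then show ?thesis
      by (simp add: c2_def norm_mult mult.assoc)
  qed
  have e1: "e1 k \<ge> D1" and e2: "e2 k \<ge> D2" for k
    using p by (auto simp: e1_def e2_def)
  define E1 where "E1 x = (\<Sum>\<^sub>\<infinity>r. c1 r * x ^ (nat j * r) / (1 - x * q powi e1 r))" for x
  define E2 where "E2 x = (\<Sum>\<^sub>\<infinity>r. c2 r * x ^ (nat j * r) / (1 - x * q powi e2 r))" for x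
  show thesis
  proof (rule that[of E1 E2])
    show "E1 holomorphic_on ball 0 (norm q powi (- D1))"
      unfolding E1_def by (rule half_pole_sum_holomorphic(1)[OF q c1 e1])
    show "E2 holomorphic_on ball 0 (norm q powi (- D2))"
      unfolding E2_def by (rule half_pole_sum_holomorphic(1)[OF q c2 e2])
  next
    fix x :: complex assume x: "x \<noteq> 0" "norm x < norm q powi (- D1)" "norm x > norm q powi D2"
    have x': "norm (1 / x) < norm q powi (- D2)"
      using x q by (simp add: norm_divide power_int_minus field_simps)
    let ?T = "pole_term q p j b d x"
    have pw: "y ^ (nat j * k) = y powi (j * int k)" for y :: complex and k
      using j by (simp add: power_int_def nat_mult_distrib)
    have "((\<lambda>r. c1 r * x ^ (nat j * r) / (1 - x * q powi e1 r)) has_sum E1 x) UNIV"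
      unfolding E1_def using half_pole_sum_holomorphic(2)[OF q c1 e1 x(2)] by simp
    then have "((\<lambda>r. x powi (j * N) * (c1 r * x ^ (nat j * r) / (1 - x * q powi e1 r)))
        has_sum x powi (j * N) * E1 x) UNIV"
      by (rule has_sum_cmult_right)
    then have 1: "(?T has_sum x powi (j * N) * E1 x) {N..}"
    proof (subst has_sum_reindex_bij_witness[of _ "\<lambda>k. N + int k" "\<lambda>r. nat (r - N)" UNIV
          "\<lambda>r. x powi (j * N) * (c1 r * x ^ (nat j * r) / (1 - x * q powi e1 r))"])
      fix r assume "r \<in> {N..}"
      then have r: "int (nat (r - N)) = r - N"
        by simp
      have "x powi (j * r) = x powi (j * N) * x powi (j * (r - N))"
        using x by (simp add: power_int_add[symmetric] algebra_simps)
      then show "x powi (j * N) * (c1 (nat (r - N)) * x ^ (nat j * nat (r - N)) / (1 - x * q powi e1 (nat (r - N)))) = ?T r"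
        unfolding pw c1_def e1_def r pole_term_def D1_def by (simp add: algebra_simps)
    qed auto
    have "((\<lambda>r. c2 r * (1 / x) ^ (nat j * r) / (1 - (1 / x) * q powi e2 r)) has_sum E2 (1 / x)) UNIV"
      unfolding E2_def using half_pole_sum_holomorphic(2)[OF q c2 e2 x'] by simp
    then have "((\<lambda>r. x powi (- (j * N + j + 1)) * (c2 r * (1 / x) ^ (nat j * r) / (1 - (1 / x) * q powi e2 r)))
        has_sum x powi (- (j * N + j + 1)) * E2 (1 / x)) UNIV"
      by (rule has_sum_cmult_right)
    then have 2: "(?T has_sum x powi (- (j * N + j + 1)) * E2 (1 / x)) {..<-N}"
    proof (subst has_sum_reindex_bij_witness[of _ "\<lambda>k. - N - 1 - int k" "\<lambda>r. nat (- N - 1 - r)" UNIV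
          "\<lambda>r. x powi (- (j * N + j + 1)) * (c2 r * (1 / x) ^ (nat j * r) / (1 - (1 / x) * q powi e2 r))"])
      fix r assume "r \<in> {..<-N}"
      then have r: "int (nat (- N - 1 - r)) = - N - 1 - r"
        by simp
      define e where "e = e2 (nat (- N - 1 - r))"
      have e: "2 * p * r + d = - e"
        unfolding e_def e2_def r D2_def by (simp add: algebra_simps)
      have neq: "(1 / x) * q powi e \<noteq> 1"
        unfolding e_def by (rule half_pole_sum_holomorphic(3)[OF q c2 e2 x'])
      have num: "x powi (- (j * N + j + 1)) * ((1 / x) powi (j * (- N - 1 - r))) = x powi (j * r) / x"
      proof -
        have "(1 / x) powi (j * (- N - 1 - r)) = x powi (- (j * (- N - 1 - r)))"
          by (simp only: power_int_minus power_int_divide_distrib inverse_eq_divide power_int_1_left)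
        moreover have "x powi (- (j * N + j + 1)) * x powi (- (j * (- N - 1 - r)))
            = x powi (- (j * N + j + 1) + - (j * (- N - 1 - r)))"
          using x(1) by (rule powi_add[symmetric])
        moreover have "- (j * N + j + 1) + - (j * (- N - 1 - r)) = j * r - 1"
          by (simp add: algebra_simps)
        moreover have "x powi (j * r - 1) = x powi (j * r) / x"
          using x by (simp add: power_int_diff)
        ultimately show ?thesis
          by (simp only:)
      qed
      have c: "c2 (nat (- N - 1 - r)) = - (q powi (j * p * r\<^sup>2 + b * r) * q powi e)"
        unfolding c2_def r e_def e2_def using q
        by (simp add: power_int_add[symmetric] algebra_simps)
      have "x powi (- (j * N + j + 1)) * (c2 (nat (- N - 1 - r)) * (1 / x) ^ (nat j * nat (- N - 1 - r)) / (1 - (1 / x) * q powi e))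
          = c2 (nat (- N - 1 - r)) * (x powi (- (j * N + j + 1)) * (1 / x) powi (j * (- N - 1 - r))) / (1 - (1 / x) * q powi e)"
        unfolding pw r by (simp add: mult_ac)
      also have "\<dots> = - (q powi (j * p * r\<^sup>2 + b * r) * q powi e) * (x powi (j * r) / x) / (1 - (1 / x) * q powi e)"
        unfolding num c ..
      also have "\<dots> = ?T r"
        using neq x q unfolding pole_term_def e
        by (simp add: power_int_minus divide_simps) (simp add: algebra_simps)
      finally show "x powi (- (j * N + j + 1)) * (c2 (nat (- N - 1 - r)) * (1 / x) ^ (nat j * nat (- N - 1 - r)) / (1 - (1 / x) * q powi e2 (nat (- N - 1 - r)))) = ?T r"
        unfolding e_def .
    qed auto
    have "(?T has_sum (\<Sum>r=-N..<N. ?T r) + x powi (j * N) * E1 x + x powi (- (j * N + j + 1)) * E2 (1 / x))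
        (({-N..<N} \<union> {N..}) \<union> {..<-N})"
      by (intro has_sum_Un_disjoint 1 2) (use N(3) in auto)
    also have "({-N..<N} \<union> {N..}) \<union> {..<-N} = UNIV"
      using N(3) by auto
    finally show "pole_term q p j b d x summable_on UNIV \<and>
       pole_sum q p j b d x = (\<Sum>r=-N..<N. pole_term q p j b d x r) + x powi (j * N) * E1 x
         + x powi (- (j * N + j + 1)) * E2 (1 / x)"
      by (simp add: has_sum_iff pole_sum_def)
  qed
qed


lemma q_powi_inj:
  assumes "q powi a = q powi b"
  shows "a = b"
proof -
  have False if "q powi a = q powi b" "a < b" for a b
  proof -
    have "q powi (b - a) = 1"
      using that q by (simp add: power_int_diff)
    then show False
      using norm_powi_less_1[of q "b - a"] that q by simp
  qed
  from this[of a b] this[of b a] assms show ?thesis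
    by (cases a b rule: linorder_cases) auto
qed

text \<open>As N grows, these annuli exhaust the punctured plane; K lets a prescribed index be
  forced into the finite middle part.\<close>

lemma pole_sum_annulus:
  assumes x: "x \<noteq> 0"
  obtains N where "N > K" "2 * p * N + d \<ge> 1" "2 * p * N + 2 * p - d \<ge> 1" "N \<ge> 0"
    "norm x < norm q powi (- (2 * p * N + d))" "norm x > norm q powi (2 * p * N + 2 * p - d)"
proof -
  have "(\<lambda>n. norm q ^ n) \<longlonglongrightarrow> 0"
    using q by (intro LIMSEQ_power_zero) auto
  then have "\<forall>\<^sub>F n in sequentially. norm q ^ n < min (norm x) (1 / norm x)"
    by (rule order_tendstoD) (use x in auto)
  then obtain n where n: "norm q ^ n < norm x" "norm q ^ n < 1 / norm x"
    by (auto simp: eventually_sequentially)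
  define N where "N = int n + \<bar>d\<bar> + \<bar>K\<bar> + 1"
  have "2 * p * N \<ge> 2 * N"
    using mult_right_mono[of 1 p "2 * N"] p by (simp add: N_def mult_ac)
  moreover have "N \<ge> int n + \<bar>d\<bar> + 1"
    by (simp add: N_def)
  ultimately have ge: "2 * p * N + d \<ge> int n + 1" "2 * p * N + 2 * p - d \<ge> int n + 1"
    using p by (auto simp: abs_le_iff)
  have le: "norm q powi m \<le> norm q ^ n" if "m \<ge> int n" for m
    using power_int_decreasing[OF that, of "norm q"] q by simp
  have "norm q powi (2 * p * N + 2 * p - d) < norm x"
    using le[of "2 * p * N + 2 * p - d"] ge n by simp
  moreover have "norm q powi (2 * p * N + d) < 1 / norm x"
    using le[of "2 * p * N + d"] ge n by simp
  then have "norm x < 1 / norm q powi (2 * p * N + d)"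
    using x q by (simp add: pos_less_divide_eq mult.commute)
  then have "norm x < norm q powi (- (2 * p * N + d))"
    unfolding power_int_minus inverse_eq_divide .
  moreover have "N > K" "N \<ge> 0"
    by (auto simp: N_def)
  ultimately show thesis
    using that[of N] ge by auto
qed

text \<open>Locally the sum is finitely many terms plus a holomorphic remainder, so that
  differentiability and residues can be read off the finite part.\<close>

lemma pole_sum_near:
  assumes x0: "x0 \<noteq> 0"
  obtains N V h where "N > K" "open V" "x0 \<in> V" "0 \<notin> V" "h holomorphic_on V"
    "\<And>x. x \<in> V \<Longrightarrow> pole_sum q p j b d x = (\<Sum>r=-N..<N. pole_term q p j b d x r) + h x"
    "pole_term q p j b d x0 summable_on UNIV"
proof -
  from pole_sum_annulus[OF x0, of K d] obtain N where NK: "N > K"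
    and N: "2 * p * N + d \<ge> 1" "2 * p * N + 2 * p - d \<ge> 1" "N \<ge> 0"
    and x0': "norm x0 < norm q powi (- (2 * p * N + d))" "norm x0 > norm q powi (2 * p * N + 2 * p - d)"
    by blast
  obtain E1 E2 where E: "E1 holomorphic_on ball 0 (norm q powi (- (2 * p * N + d)))"
      "E2 holomorphic_on ball 0 (norm q powi (- (2 * p * N + 2 * p - d)))"
    and eq: "\<And>x. x \<noteq> 0 \<Longrightarrow> norm x < norm q powi (- (2 * p * N + d)) \<Longrightarrow>
       norm x > norm q powi (2 * p * N + 2 * p - d) \<Longrightarrow>
       pole_term q p j b d x summable_on UNIV \<and>
       pole_sum q p j b d x = (\<Sum>r=-N..<N. pole_term q p j b d x r) + x powi (j * N) * E1 x
         + x powi (- (j * N + j + 1)) * E2 (1 / x)"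
    using pole_sum_decomposition[OF N] by blast
  define V where "V = {x. norm x < norm q powi (- (2 * p * N + d))} \<inter>
      {x. norm x > norm q powi (2 * p * N + 2 * p - d)} \<inter> (- {0} :: complex set)"
  define h where "h x = x powi (j * N) * E1 x + x powi (- (j * N + j + 1)) * E2 (1 / x)" for x
  have "open V"
    unfolding V_def by (intro open_Int open_Collect_less continuous_intros)
  moreover have "h holomorphic_on V"
  proof -
    have "E1 holomorphic_on V"
      using E(1) by (rule holomorphic_on_subset) (auto simp: V_def)
    moreover have "(E2 \<circ> (\<lambda>x. 1 / x)) holomorphic_on V"
    proof (rule holomorphic_on_compose_gen[OF _ E(2)])
      show "(\<lambda>x. 1 / x) holomorphic_on V"
        by (intro holomorphic_intros) (auto simp: V_def)
      show "(\<lambda>x. 1 / x) ` V \<subseteq> ball 0 (norm q powi (- (2 * p * N + 2 * p - d)))"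
      proof clarify
        fix x assume "x \<in> V"
        then have x: "x \<noteq> 0" "norm x > norm q powi (2 * p * N + 2 * p - d)"
          by (auto simp: V_def)
        have "norm (1 / x) < 1 / norm q powi (2 * p * N + 2 * p - d)"
          unfolding norm_divide norm_one using x q by (intro divide_strict_left_mono) auto
        then show "1 / x \<in> ball 0 (norm q powi (- (2 * p * N + 2 * p - d)))"
          unfolding mem_ball_0 power_int_minus inverse_eq_divide .
      qed
    qed
    ultimately show ?thesis
      unfolding h_def by (intro holomorphic_intros) (auto simp: V_def o_def)
  qed
  moreover have "x0 \<in> V" "0 \<notin> V"
    using x0 x0' by (simp_all add: V_def)
  moreover have "pole_sum q p j b d x = (\<Sum>r=-N..<N. pole_term q p j b d x r) + h x" if "x \<in> V" for x
    using eq[of x] that unfolding V_def h_def add.assoc by blast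
  moreover have "pole_term q p j b d x0 summable_on UNIV"
    using eq[OF x0 x0'] by blast
  ultimately show thesis
    using NK that by blast
qed

lemma pole_term_holomorphic:
  assumes "0 \<notin> A" "\<And>x. x \<in> A \<Longrightarrow> x * q powi (2 * p * r + d) \<noteq> 1"
  shows "(\<lambda>x. pole_term q p j b d x r) holomorphic_on A"
  unfolding pole_term_def using assms by (intro holomorphic_intros) auto

lemma pole_sum_field_differentiable:
  assumes x0: "x0 \<noteq> 0" and nonpole: "\<And>r. x0 * q powi (2 * p * r + d) \<noteq> 1"
  shows "pole_sum q p j b d field_differentiable at x0"
proof -
  obtain N V h where "N > (0::int)" and V: "open V" "x0 \<in> V" "0 \<notin> V"
    and h: "h holomorphic_on V"
    and eq: "\<And>x. x \<in> V \<Longrightarrow> pole_sum q p j b d x = (\<Sum>r=-N..<N. pole_term q p j b d x r) + h x"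
    and "pole_term q p j b d x0 summable_on UNIV"
    using pole_sum_near[OF x0, where K = 0 and b = b and d = d] by metis
  define U where "U = V \<inter> (\<Inter>r\<in>{-N..<N}. {x. x * q powi (2 * p * r + d) \<noteq> 1})"
  have "open U"
    unfolding U_def using V(1) by (intro open_Int open_INT ballI open_Collect_neq continuous_intros) auto
  moreover have "x0 \<in> U"
    using V nonpole by (auto simp: U_def)
  moreover have "(\<lambda>x. (\<Sum>r=-N..<N. pole_term q p j b d x r) + h x) holomorphic_on U"
    by (intro holomorphic_intros pole_term_holomorphic holomorphic_on_subset[OF h])
       (use V(3) in \<open>auto simp: U_def\<close>)
  then have "pole_sum q p j b d holomorphic_on U"
    by (rule holomorphic_transform) (use eq in \<open>auto simp: U_def\<close>)
  ultimately show ?thesis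
    by (intro holomorphic_on_imp_differentiable_at)
qed

text \<open>Different terms have different poles, because distinct powers of q are distinct numbers;
  hence only the term r0 contributes.\<close>

lemma pole_sum_residue:
  assumes x0: "x0 \<noteq> 0" and pole: "x0 * q powi (2 * p * r0 + d) = 1"
  shows "((\<lambda>x. (x - x0) * pole_sum q p j b d x) \<longlongrightarrow>
           - x0 * (q powi (j * p * r0\<^sup>2 + b * r0) * x0 powi (j * r0))) (at x0)"
proof -
  obtain N V h where N: "N > \<bar>r0\<bar>" and V: "open V" "x0 \<in> V" "0 \<notin> V"
    and h: "h holomorphic_on V"
    and eq: "\<And>x. x \<in> V \<Longrightarrow> pole_sum q p j b d x = (\<Sum>r=-N..<N. pole_term q p j b d x r) + h x"
    and "pole_term q p j b d x0 summable_on UNIV"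
    using pole_sum_near[OF x0, where K = "\<bar>r0\<bar>" and b = b and d = d] by metis
  define L where "L = - x0 * (q powi (j * p * r0\<^sup>2 + b * r0) * x0 powi (j * r0))"
  have "((\<lambda>x. (x - x0) * pole_term q p j b d x r) \<longlongrightarrow> (if r = r0 then L else 0)) (at x0)" for r
  proof (cases "r = r0")
    case True
    have lim: "((\<lambda>x. - x0 * (q powi (j * p * r0\<^sup>2 + b * r0) * x powi (j * r0))) \<longlongrightarrow> L) (at x0)"
      unfolding L_def using x0 by (intro tendsto_intros) auto
    have "\<forall>\<^sub>F x in at x0.
        - x0 * (q powi (j * p * r0\<^sup>2 + b * r0) * x powi (j * r0)) = (x - x0) * pole_term q p j b d x r"
    proof -
      have "\<forall>\<^sub>F x in at x0. x \<noteq> x0"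
        by (rule eventually_neq_at_within)
      then show ?thesis
      proof eventually_elim
        case (elim x)
        have "q powi (2 * p * r0 + d) = 1 / x0"
          using pole x0 by (simp add: field_simps)
        then have den: "1 - x * q powi (2 * p * r0 + d) = - (x - x0) / x0"
          using x0 by (simp add: field_simps)
        have "y * (c / (- y / x0)) = - x0 * c" if "y \<noteq> 0" for y c :: complex
          using that x0 by simp
        from this[of "x - x0"] elim show ?case
          unfolding pole_term_def True den by simp
      qed
    qed
    from Lim_transform_eventually[OF lim this] show ?thesis
      using True by simp
  next
    case False
    have "x0 * q powi (2 * p * r + d) \<noteq> 1"
    proof
      assume "x0 * q powi (2 * p * r + d) = 1"
      then have "q powi (2 * p * r + d) = q powi (2 * p * r0 + d)"
        using pole x0 mult_left_cancel[of x0 "q powi (2 * p * r + d)" "q powi (2 * p * r0 + d)"] by simp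
      then have "2 * p * r + d = 2 * p * r0 + d"
        by (rule q_powi_inj)
      then show False
        using False p by simp
    qed
    then have "((\<lambda>x. (x - x0) * pole_term q p j b d x r) \<longlongrightarrow> (x0 - x0) * pole_term q p j b d x0 r) (at x0)"
      unfolding pole_term_def using x0 by (intro tendsto_intros) auto
    then show ?thesis
      using False by simp
  qed
  then have "((\<lambda>x. \<Sum>r=-N..<N. (x - x0) * pole_term q p j b d x r) \<longlongrightarrow> (\<Sum>r=-N..<N. if r = r0 then L else 0)) (at x0)"
    by (intro tendsto_sum)
  also have "(\<Sum>r=-N..<N. if r = r0 then L else 0) = L"
    using N by (auto simp: abs_less_iff)
  finally have 1: "((\<lambda>x. \<Sum>r=-N..<N. (x - x0) * pole_term q p j b d x r) \<longlongrightarrow> L) (at x0)" .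
  have "isCont h x0"
    using holomorphic_on_imp_continuous_on[OF h] V by (simp add: continuous_on_eq_continuous_at)
  then have 2: "((\<lambda>x. (x - x0) * h x) \<longlongrightarrow> (x0 - x0) * h x0) (at x0)"
    by (intro tendsto_intros) (simp add: isCont_def)
  have "((\<lambda>x. (\<Sum>r=-N..<N. (x - x0) * pole_term q p j b d x r) + (x - x0) * h x) \<longlongrightarrow> L) (at x0)"
    using tendsto_add[OF 1 2] by simp
  then have "((\<lambda>x. (x - x0) * pole_sum q p j b d x) \<longlongrightarrow> L) (at x0)"
  proof (rule Lim_transform_eventually)
    have "\<forall>\<^sub>F x in at x0. x \<in> V"
      using V by (simp add: eventually_at_in_open')
    then show "\<forall>\<^sub>F x in at x0. (\<Sum>r=-N..<N. (x - x0) * pole_term q p j b d x r) + (x - x0) * h x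
        = (x - x0) * pole_sum q p j b d x"
      by eventually_elim (simp add: eq sum_distrib_left distrib_left)
  qed
  then show ?thesis
    by (simp add: L_def)
qed

text \<open>The decomposition with N = 0 has no middle terms. The bounds on d give |q|^(-d) >= 1 and
  |q|^(2p-d) <= |q|, so both halves converge throughout the open annulus.\<close>

lemma pole_sum_laurent:
  assumes d: "0 < d" "d < 2 * p"
  shows "\<exists>c. (\<forall>n. - j \<le> n \<longrightarrow> n \<le> -1 \<longrightarrow> c n = 0) \<and>
    (\<forall>x. norm q < norm x \<longrightarrow> norm x < 1 \<longrightarrow> ((\<lambda>n. c n * x powi n) has_sum pole_sum q p j b d x) UNIV)"
proof -
  have "2 * p * 0 + d \<ge> 1" "2 * p * 0 + 2 * p - d \<ge> 1" "(0::int) \<ge> 0"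
    using d by auto
  from pole_sum_decomposition[OF this] obtain E1 E2 where
    E: "E1 holomorphic_on ball 0 (norm q powi (- d))" "E2 holomorphic_on ball 0 (norm q powi (- (2 * p - d)))"
    and eq: "\<And>x. x \<noteq> 0 \<Longrightarrow> norm x < norm q powi (- d) \<Longrightarrow> norm x > norm q powi (2 * p - d) \<Longrightarrow>
       pole_sum q p j b d x = E1 x + x powi (- (j + 1)) * E2 (1 / x)"
    by (simp; metis)
  obtain c1 where c1: "\<And>n. n < 0 \<Longrightarrow> c1 n = 0"
      "\<And>z. norm z < norm q powi (- d) \<Longrightarrow> ((\<lambda>n. c1 n * z powi n) has_sum E1 z) UNIV"
    using holomorphic_power_series_int[OF E(1)] by blast
  obtain c2 where c2: "\<And>n. n < 0 \<Longrightarrow> c2 n = 0"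
      "\<And>z. norm z < norm q powi (- (2 * p - d)) \<Longrightarrow> ((\<lambda>n. c2 n * z powi n) has_sum E2 z) UNIV"
    using holomorphic_power_series_int[OF E(2)] by blast
  define c where "c n = c1 n + c2 (- n - j - 1)" for n
  show ?thesis
  proof (intro exI[of _ c] conjI allI impI)
    show "c n = 0" if "- j \<le> n" "n \<le> -1" for n
      using that c1(1)[of n] c2(1)[of "- n - j - 1"] by (simp add: c_def)
  next
    fix x :: complex assume x: "norm q < norm x" "norm x < 1"
    then have x0: "x \<noteq> 0"
      using norm_ge_zero[of q] by auto
    have "1 \<le> norm q powi (- d)"
      using power_int_decreasing[of 0 d "norm q"] d q by (simp add: power_int_minus one_le_inverse_iff)
    then have 1: "norm x < norm q powi (- d)"
      using x by linarith
    have "norm q powi (2 * p - d) \<le> norm q powi 1"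
      using d q by (intro power_int_decreasing) auto
    then have 2: "norm x > norm q powi (2 * p - d)"
      using x by simp
    then have "norm (1 / x) < 1 / norm q powi (2 * p - d)"
      unfolding norm_divide norm_one using x0 q by (intro divide_strict_left_mono) auto
    then have 3: "norm (1 / x) < norm q powi (- (2 * p - d))"
      unfolding power_int_minus inverse_eq_divide .
    have "((\<lambda>n. x powi (- (j + 1)) * (c2 n * (1 / x) powi n)) has_sum x powi (- (j + 1)) * E2 (1 / x)) UNIV"
      by (intro has_sum_cmult_right c2(2) 3)
    then have "((\<lambda>n. c2 (- n - j - 1) * x powi n) has_sum x powi (- (j + 1)) * E2 (1 / x)) UNIV"
    proof (subst has_sum_reindex_bij_witness[of _ "\<lambda>n. - n - j - 1" "\<lambda>n. - n - j - 1" UNIV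
          "\<lambda>n. x powi (- (j + 1)) * (c2 n * (1 / x) powi n)"])
      fix n
      have "(1 / x) powi (- n - j - 1) = x powi (- (- n - j - 1))"
        by (simp only: power_int_minus power_int_divide_distrib inverse_eq_divide power_int_1_left)
      moreover have "x powi n = x powi (- (j + 1)) * x powi (- (- n - j - 1))"
        using powi_add[OF x0, of "- (j + 1)" "- (- n - j - 1)"] by simp
      ultimately show "x powi (- (j + 1)) * (c2 (- n - j - 1) * (1 / x) powi (- n - j - 1))
          = c2 (- n - j - 1) * x powi n"
        by (simp only: mult_ac)
    qed auto
    then have "((\<lambda>n. c1 n * x powi n + c2 (- n - j - 1) * x powi n) has_sum
        E1 x + x powi (- (j + 1)) * E2 (1 / x)) UNIV"
      by (intro has_sum_add c1(2) 1)
    then show "((\<lambda>n. c n * x powi n) has_sum pole_sum q p j b d x) UNIV"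
      using eq[OF x0 1 2] by (simp add: c_def distrib_right)
  qed
qed

text \<open>The dilation carries term r to term r + 1 with an unchanged denominator, so the relation
  also holds at the poles, where both sides lose the same term.\<close>

lemma pole_sum_shift:
  assumes x: "x \<noteq> 0"
  shows "pole_sum q p j b d (q powi (2 * p) * x) = q powi (- (j * p) - b) * x powi (- j) * pole_sum q p j b d x"
proof -
  have shift: "pole_term q p j b d (q powi (2 * p) * x) r = q powi (- (j * p) - b) * x powi (- j) * pole_term q p j b d x (r + 1)" for r
  proof -
    have "q powi (j * p * r\<^sup>2 + b * r) * (q powi (2 * p) * x) powi (j * r)
        = q powi (j * p * r\<^sup>2 + b * r + 2 * p * (j * r)) * x powi (j * r)"
      using q by (simp add: power_int_mult_distrib powi_add power_int_mult[symmetric])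
    also have "j * p * r\<^sup>2 + b * r + 2 * p * (j * r) = (- (j * p) - b) + (j * p * (r + 1)\<^sup>2 + b * (r + 1))"
      by (simp add: power2_eq_square algebra_simps)
    also have "q powi \<dots> = q powi (- (j * p) - b) * q powi (j * p * (r + 1)\<^sup>2 + b * (r + 1))"
      by (rule powi_add[OF q(2)])
    also have "x powi (j * r) = x powi (- j) * x powi (j * (r + 1))"
      using powi_add[OF x, of "- j" "j * (r + 1)"] by (simp add: algebra_simps)
    finally have num: "q powi (j * p * r\<^sup>2 + b * r) * (q powi (2 * p) * x) powi (j * r)
        = q powi (- (j * p) - b) * x powi (- j) * (q powi (j * p * (r + 1)\<^sup>2 + b * (r + 1)) * x powi (j * (r + 1)))"
      by (simp only: mult_ac)
    have "q powi (2 * p) * x * q powi (2 * p * r + d) = x * q powi (2 * p + (2 * p * r + d))"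
      using q(2) by (simp only: powi_add not_False_eq_True mult_ac)
    also have "2 * p + (2 * p * r + d) = 2 * p * (r + 1) + d"
      by (simp add: algebra_simps)
    finally show ?thesis
      unfolding pole_term_def num by simp
  qed
  have "pole_sum q p j b d (q powi (2 * p) * x)
      = q powi (- (j * p) - b) * x powi (- j) * (\<Sum>\<^sub>\<infinity>r. pole_term q p j b d x (r + 1))"
    unfolding pole_sum_def shift by (rule infsum_cmult_right')
  also have "(\<Sum>\<^sub>\<infinity>r. pole_term q p j b d x (r + 1)) = pole_sum q p j b d x"
    unfolding pole_sum_def
    by (rule infsum_reindex_bij_witness[of _ "\<lambda>r. r - 1" "\<lambda>r. r + 1"]) auto
  finally show ?thesis .
qed

end

subsection \<open>Removal of singularities and quasi-periodic functions\<close>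

text \<open>Riemann's criterion at each point of P. As P may be infinite, one extension is defined
  globally by limits and then compared with the local extension on a disc about each point.\<close>

lemma removable_singularities:
  assumes U: "open U" and f: "f holomorphic_on U - P"
    and isol: "\<And>z. z \<in> U \<Longrightarrow> \<forall>\<^sub>F x in at z. x \<notin> P"
    and lim: "\<And>z. z \<in> U \<Longrightarrow> z \<in> P \<Longrightarrow> ((\<lambda>x. (x - z) * f x) \<longlongrightarrow> 0) (at z)"
  shows "\<exists>g. g holomorphic_on U \<and> (\<forall>z\<in>U - P. g z = f z)"
proof -
  define g where "g z = (if z \<in> P then Lim (at z) f else f z)" for z
  have "g field_differentiable at z" if z: "z \<in> U" for z
  proof -
    obtain e1 where e1: "e1 > 0" "ball z e1 \<subseteq> U"
      using U z by (auto simp: open_contains_ball)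
    obtain e2 where e2: "e2 > 0" "\<And>x. x \<noteq> z \<Longrightarrow> dist x z < e2 \<Longrightarrow> x \<notin> P"
      using isol[OF z] by (auto simp: eventually_at)
    define e where "e = min e1 e2"
    have e: "e > 0" "ball z e \<subseteq> U" "\<And>x. x \<in> ball z e \<Longrightarrow> x \<noteq> z \<Longrightarrow> x \<notin> P"
      using e1 e2 by (auto simp: e_def dist_commute)
    have holf: "f holomorphic_on ball z e - {z}"
      using f by (rule holomorphic_on_subset) (use e in auto)
    obtain h where h: "h holomorphic_on ball z e" "\<And>x. x \<in> ball z e - {z} \<Longrightarrow> h x = f x"
      and hz: "z \<notin> P \<Longrightarrow> h z = f z"
    proof (cases "z \<in> P")
      case True
      have "\<exists>h. h holomorphic_on ball z e \<and> (\<forall>x\<in>ball z e - {z}. h x = f x)"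
        using holomorphic_on_extend_lim[OF holf] lim[OF z True] e(1) by simp
      then show ?thesis
        using that True by blast
    next
      case False
      have "f holomorphic_on ball z e"
        using f by (rule holomorphic_on_subset) (use e False in \<open>metis DiffI subsetD subsetI\<close>)
      then show ?thesis
        using that[of f] by blast
    qed
    have gh: "g x = h x" if x: "x \<in> ball z e" for x
    proof (cases "x = z")
      case True
      show ?thesis
      proof (cases "z \<in> P")
        case zP: True
        have "isCont h z"
          using holomorphic_on_imp_continuous_on[OF h(1)] e(1)
          by (simp add: continuous_on_eq_continuous_at)
        then have hlim: "(h \<longlongrightarrow> h z) (at z)"
          by (simp add: isCont_def)
        have "\<forall>\<^sub>F x in at z. x \<in> ball z e - {z}"
          using e(1) by (intro eventually_at_in_open) auto
        then have "\<forall>\<^sub>F x in at z. h x = f x"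
          by eventually_elim (use h(2) in auto)
        with hlim have "(f \<longlongrightarrow> h z) (at z)"
          by (rule Lim_transform_eventually)
        then show ?thesis
          using zP True by (simp add: g_def tendsto_Lim)
      qed (use hz True in \<open>simp add: g_def\<close>)
    next
      case False
      then show ?thesis
        using x h(2)[of x] e(3)[of x] by (simp add: g_def)
    qed
    have "g holomorphic_on ball z e"
      using h(1) by (rule holomorphic_transform) (simp add: gh)
    then show ?thesis
      using e(1) by (intro holomorphic_on_imp_differentiable_at[of _ "ball z e"]) auto
  qed
  then have "g holomorphic_on U"
    by (auto simp: holomorphic_on_def intro: field_differentiable_at_within)
  then show ?thesis
    by (intro exI[of _ g]) (simp add: g_def)
qed

text \<open>The classes modulo j are written as j n - s - 1 so that n = 0 gives exactly the window
  -1, ..., -j from which the coefficients will be read.\<close>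

lemma has_sum_residue_classes:
  fixes f :: "int \<Rightarrow> complex"
  assumes j: "j > 0" and f: "(f has_sum S) UNIV"
    and g: "\<And>s. s \<in> {0..j-1} \<Longrightarrow> ((\<lambda>n. f (j * n - s - 1)) has_sum g s) UNIV"
  shows "S = (\<Sum>s=0..j-1. g s)"
proof -
  have "((\<lambda>(s, n). f (j * n - s - 1)) has_sum S) ({0..j-1} \<times> UNIV)"
  proof (subst has_sum_reindex_bij_witness[of _ "\<lambda>m. ((- m - 1) mod j, - ((- m - 1) div j))"
        "\<lambda>(s, n). j * n - s - 1" UNIV f])
    fix a assume "a \<in> {0..j-1} \<times> (UNIV :: int set)"
    then obtain s n where a: "a = (s, n)" and s: "0 \<le> s" "s < j"
      by auto
    have *: "- (j * n - s - 1) - 1 = s + j * (- n)"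
      by simp
    have "(s + j * (- n)) mod j = s" "(s + j * (- n)) div j = - n"
      unfolding mod_mult_self2 div_mult_self2[OF less_imp_neq[OF j, symmetric]] using s by simp_all
    then show "((- (case a of (s, n) \<Rightarrow> j * n - s - 1) - 1) mod j,
        - ((- (case a of (s, n) \<Rightarrow> j * n - s - 1) - 1) div j)) = a"
      unfolding a split * by simp
  next
    fix m :: int
    have "- m - 1 = j * ((- m - 1) div j) + (- m - 1) mod j"
      by simp
    then show "(case ((- m - 1) mod j, - ((- m - 1) div j)) of (s, n) \<Rightarrow> j * n - s - 1) = m"
      by (simp only: split)
  qed (use f j in \<open>auto simp: zle_diff1_eq\<close>)
  then have "(g has_sum S) {0..j-1}"
    by (rule has_sum_SigmaD) (use g in auto)
  then show ?thesis
    by (simp add: has_sum_finite_iff)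
qed

context pole_sums
begin

lemma jtheta_isolated_zeros:
  assumes "z \<noteq> 0"
  shows "\<forall>\<^sub>F x in at z. jtheta x q \<noteq> 0"
proof (cases "\<exists>k. z = q powi k")
  case True
  then obtain k where k: "z = q powi k" ..
  have "- ((-1) powi k * q powi (binom2 k + k) / qpoch_inf q q ^ 3) \<noteq> 0"
    using q qpoch_inf_q_q_nonzero[OF q(1)] by simp
  from tendsto_imp_eventually_ne[OF jtheta_simple_zero[OF q] this]
  show ?thesis
    unfolding k by (rule eventually_mono) auto
next
  case False
  have "isCont (\<lambda>x. jtheta x q) z"
    using holomorphic_on_imp_continuous_on[OF jtheta_holomorphic[OF q(1), of "-{0}"]] assms
    by (simp add: continuous_on_eq_continuous_at open_Compl)
  then show ?thesis
    unfolding isCont_def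
    by (rule tendsto_imp_eventually_ne) (use False jtheta_eq_0_iff[OF q assms] in auto)
qed

lemma jtheta_nonzero_annulus:
  assumes z: "norm q < norm z" "norm z < 1"
  shows "jtheta z q \<noteq> 0"
proof
  assume "jtheta z q = 0"
  moreover have "z \<noteq> 0"
    using z norm_ge_zero[of q] by auto
  ultimately obtain k where "z = q powi k"
    using jtheta_eq_0_iff[OF q] by auto
  then have k: "norm q powi k = norm z"
    by (simp add: norm_power_int)
  consider "k \<le> 0" | "k \<ge> 1"
    by linarith
  then show False
  proof cases
    case 1
    then show ?thesis
      using power_int_decreasing[of k 0 "norm q"] q k z by simp
  next
    case 2
    then show ?thesis
      using power_int_decreasing[of 1 k "norm q"] q k z by simp
  qed
qed

text \<open>Comparing Laurent coefficients in the functional equation gives c (n + j) = q^(2pn+jp+p)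
  c n, and solving this along each class modulo j leaves a theta series. The equation is demanded
  only off the zeros of j(z;q), since the extended function agrees with the explicit one only there;
  a single circle without zeros is enough to compare coefficients.\<close>

lemma quasi_periodic_expansion:
  assumes g: "g holomorphic_on -{0}"
    and shift: "\<And>z. z \<noteq> 0 \<Longrightarrow> jtheta z q \<noteq> 0 \<Longrightarrow>
                  g (q powi (2 * p) * z) = q powi (- (j * p) - p) * z powi (- j) * g z"
  shows "\<exists>c. \<forall>z. z \<noteq> 0 \<longrightarrow> ((\<lambda>n. c n * z powi n) has_sum g z) UNIV \<and>
    g z = (\<Sum>s=0..j-1. c (- s - 1) * z powi (- s - 1) *
        jtheta (- (q powi (p * (j - 2 * s - 1))) * z powi j) (q powi (2 * p * j)))"
proof -
  obtain c where c: "\<And>z. z \<noteq> 0 \<Longrightarrow> ((\<lambda>n. c n * z powi n) has_sum g z) UNIV"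
    using laurent_series_exists[OF g] by blast
  \<comment> \<open>The radius |q|^(1/2) lies strictly between |q| and 1, so the circle meets no
    power of q.\<close>
  define R where "R = sqrt (norm q)"
  have R: "R > 0" "norm q < R" "R < 1"
    using q by (auto simp: R_def real_less_rsqrt power2_eq_square real_sqrt_lt_1_iff)
  have off: "jtheta z q \<noteq> 0" "z \<noteq> 0" if "norm z = R" for z :: complex
    using that R jtheta_nonzero_annulus[of z] by auto
  have "(\<lambda>n. c n * q powi (2 * p * n)) = (\<lambda>n. q powi (- (j * p) - p) * c (n + j))"
  proof (rule laurent_series_unique[OF R(1)])
    fix z :: complex assume z: "norm z = R"
    have "((\<lambda>n. c n * (q powi (2 * p) * z) powi n) has_sum g (q powi (2 * p) * z)) UNIV"
      using off[OF z] q by (intro c) auto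
    then show "((\<lambda>n. c n * q powi (2 * p * n) * z powi n) has_sum g (q powi (2 * p) * z)) UNIV"
      by (simp add: power_int_mult_distrib power_int_mult mult.assoc)
    have "((\<lambda>n. c (n + j) * z powi (n + j)) has_sum g z) UNIV"
      unfolding has_sum_int_shift[where f = "\<lambda>n. c n * z powi n"] using off[OF z] by (intro c)
    then have "((\<lambda>n. q powi (- (j * p) - p) * z powi (- j) * (c (n + j) * z powi (n + j)))
        has_sum q powi (- (j * p) - p) * z powi (- j) * g z) UNIV"
      by (rule has_sum_cmult_right)
    moreover have "z powi (- j) * z powi (n + j) = z powi n" for n
      using powi_add[OF off(2)[OF z], of "- j" "n + j"] by simp
    then have "q powi (- (j * p) - p) * z powi (- j) * (c (n + j) * z powi (n + j))
        = q powi (- (j * p) - p) * c (n + j) * z powi n" for n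
      by (metis (no_types, lifting) mult.assoc mult.left_commute)
    ultimately show "((\<lambda>n. q powi (- (j * p) - p) * c (n + j) * z powi n)
        has_sum g (q powi (2 * p) * z)) UNIV"
      using shift[of z] off[OF z] by simp
  qed
  then have rec: "c (n + j) = q powi (2 * p * n + j * p + p) * c n" for n
  proof -
    have "q powi (2 * p * n + j * p + p) * c n = q powi (j * p + p) * (c n * q powi (2 * p * n))"
      using powi_add[OF q(2), of "2 * p * n" "j * p + p"] by (simp add: add.assoc mult_ac)
    also have "c n * q powi (2 * p * n) = q powi (- (j * p) - p) * c (n + j)"
      using \<open>(\<lambda>n. c n * q powi (2 * p * n)) = (\<lambda>n. q powi (- (j * p) - p) * c (n + j))\<close> by metis
    also have "q powi (j * p + p) * (q powi (- (j * p) - p) * c (n + j)) = c (n + j)"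
      using powi_add[OF q(2), of "j * p + p" "- (j * p) - p"] by (simp add: mult.assoc[symmetric])
    finally show ?thesis ..
  qed
  \<comment> \<open>At the index j i - s - 1 the recurrence contributes the exponent p j (2i+1) - p
    (2s+1); summing over 0 <= i < n gives p j n^2 - p (2s+1) n.\<close>
  have coeff: "c (j * n - s - 1) = q powi (p * j * n\<^sup>2 + (- p * (2 * s + 1)) * n) * c (- s - 1)" for n s
  proof -
    have step: "q powi (2 * p * (j * n - s - 1) + j * p + p) * q powi (p * j * n\<^sup>2 + (- p * (2 * s + 1)) * n)
        = q powi (p * j * (n + 1)\<^sup>2 + (- p * (2 * s + 1)) * (n + 1))" for n
    proof -
      have "2 * p * (j * n - s - 1) + j * p + p + (p * j * n\<^sup>2 + (- p * (2 * s + 1)) * n)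
          = p * j * (n + 1)\<^sup>2 + (- p * (2 * s + 1)) * (n + 1)"
        by (simp add: power2_eq_square algebra_simps)
      then show ?thesis
        using powi_add[OF q(2)] by metis
    qed
    have rec': "c (j * (n + 1) - s - 1) = q powi (2 * p * (j * n - s - 1) + j * p + p) * c (j * n - s - 1)" for n
      using rec[of "j * n - s - 1"] by (simp add: algebra_simps)
    show ?thesis
    proof (induction n rule: int_induct[where k = 0])
      case base
      show ?case
        by simp
    next
      case (step1 n)
      show ?case
        unfolding rec' step1.IH step[symmetric] by (simp only: mult.assoc)
    next
      case (step2 n)
      have "q powi (2 * p * (j * (n - 1) - s - 1) + j * p + p) * c (j * (n - 1) - s - 1)
          = q powi (2 * p * (j * (n - 1) - s - 1) + j * p + p) *
             (q powi (p * j * (n - 1)\<^sup>2 + (- p * (2 * s + 1)) * (n - 1)) * c (- s - 1))"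
        using step2.IH rec'[of "n - 1"] step[of "n - 1"] by (simp only: diff_add_cancel mult.assoc[symmetric])
      then show ?case
        using q by simp
    qed
  qed
  have "g z = (\<Sum>s=0..j-1. c (- s - 1) * z powi (- s - 1) *
      jtheta (- (q powi (p * (j - 2 * s - 1))) * z powi j) (q powi (2 * p * j)))" if z: "z \<noteq> 0" for z
  proof (rule has_sum_residue_classes[OF _ c[OF z]])
    fix s
    have pj: "p * j > 0"
      using p j by simp
    have "((\<lambda>n. c (- s - 1) * z powi (- s - 1) * (q powi (p * j * n\<^sup>2 + (- p * (2 * s + 1)) * n) * (z powi j) powi n))
        has_sum c (- s - 1) * z powi (- s - 1) *
          jtheta (- (q powi (p * j + (- p * (2 * s + 1)))) * z powi j) (q powi (2 * (p * j)))) UNIV"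
      using z pj by (intro has_sum_cmult_right jtheta_shifted_expansion q) auto
    also have "p * j + (- p * (2 * s + 1)) = p * (j - 2 * s - 1)"
      by (simp add: algebra_simps)
    also have "2 * (p * j) = 2 * p * j"
      by simp
    also have "(\<lambda>n. c (- s - 1) * z powi (- s - 1) * (q powi (p * j * n\<^sup>2 + (- p * (2 * s + 1)) * n) * (z powi j) powi n))
        = (\<lambda>n. c (j * n - s - 1) * z powi (j * n - s - 1))"
    proof
      fix n
      have "z powi (j * n - s - 1) = z powi (- s - 1) * (z powi j) powi n"
        using powi_add[OF z, of "- s - 1" "j * n"] by (simp add: power_int_mult algebra_simps)
      then show "c (- s - 1) * z powi (- s - 1) * (q powi (p * j * n\<^sup>2 + (- p * (2 * s + 1)) * n) * (z powi j) powi n)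
          = c (j * n - s - 1) * z powi (j * n - s - 1)"
        unfolding coeff[of n s] by (simp only: mult_ac)
    qed
    finally show "((\<lambda>n. c (j * n - s - 1) * z powi (j * n - s - 1)) has_sum c (- s - 1) * z powi (- s - 1) *
        jtheta (- (q powi (p * (j - 2 * s - 1))) * z powi j) (q powi (2 * p * j))) UNIV" .
  qed (use j in auto)
  with c show ?thesis
    by blast
qed

end

subsection \<open>The numerator of the character\<close>

text \<open>Here P is p' and the spin is l = 2a - 1. For odd spin w^(-(l+1)) is the integral power
  z^(-a), so the numerator is a function of z; keeping this factor inside is what makes it odd under
  z -> 1/z.\<close>

definition char_num :: "complex \<Rightarrow> int \<Rightarrow> int \<Rightarrow> int \<Rightarrow> complex \<Rightarrow> complex" where
  "char_num q p P a z = z powi (- a) *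
     (jtheta (- (q powi (p * (2 * a) + p * P)) * z powi (- P)) (q powi (2 * p * P))
      - z powi (2 * a) * jtheta (- (q powi (- p * (2 * a) + p * P)) * z powi (- P)) (q powi (2 * p * P)))"

text \<open>Up to a power of \<open>q\<close>, the value of the numerator at \<open>q\<^bsup>p-m\<^esup>\<close>.\<close>

definition char_val :: "complex \<Rightarrow> int \<Rightarrow> int \<Rightarrow> int \<Rightarrow> int \<Rightarrow> complex" where
  "char_val q p P a m = jtheta (- (q powi (m * P + p * (2 * a)))) (q powi (2 * p * P))
     - q powi (m * P - m * (2 * a)) * jtheta (- (q powi (- m * P + p * (2 * a)))) (q powi (2 * p * P))"

context
  fixes q :: complex and p P a :: int
  assumes q: "norm q < 1" "q \<noteq> 0" and p: "p \<ge> 1" and P: "P \<ge> 1"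
begin

lemma nome: "norm (q powi (2 * p * P)) < 1" "q powi (2 * p * P) \<noteq> 0"
  using q p P by (auto intro!: norm_powi_less_1)

lemma char_num_holomorphic: "char_num q p P a holomorphic_on -{0}"
proof -
  have "(\<lambda>z. jtheta (- (q powi b) * z powi (- P)) (q powi (2 * p * P))) holomorphic_on -{0}" for b
  proof -
    have "((\<lambda>x. jtheta x (q powi (2 * p * P))) \<circ> (\<lambda>z. - (q powi b) * z powi (- P))) holomorphic_on -{0}"
      by (rule holomorphic_on_compose)
         (use q in \<open>auto intro!: holomorphic_intros jtheta_holomorphic nome\<close>)
    then show ?thesis
      by (simp add: o_def)
  qed
  then show ?thesis
    unfolding char_num_def[abs_def] by (intro holomorphic_intros) auto
qed

text \<open>The reflection j(Q/x;Q) = j(x;Q) interchanges the two theta functions of the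
  numerator.\<close>

lemma char_num_reflect:
  assumes z: "z \<noteq> 0"
  shows "char_num q p P a (1 / z) = - char_num q p P a z"
proof -
  let ?Q = "q powi (2 * p * P)"
  have refl: "jtheta (- (q powi (p * P + b)) * (1 / z) powi (- P)) ?Q = jtheta (- (q powi (p * P - b)) * z powi (- P)) ?Q" for b
  proof -
    define y where "y = - (q powi (p * P - b)) * z powi (- P)"
    have "?Q = q powi (p * P + b) * q powi (p * P - b)"
      using powi_add[OF q(2), of "p * P + b" "p * P - b"] by (simp add: algebra_simps)
    moreover have "(1 / z) powi (- P) = z powi P"
      by (simp add: power_int_minus power_int_divide_distrib inverse_eq_divide)
    moreover have "A * B / (- B * inverse Z) = - A * Z" if "B \<noteq> 0" "Z \<noteq> 0" for A B Z :: complex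
      using that by (simp add: field_simps)
    ultimately have "?Q / y = - (q powi (p * P + b)) * (1 / z) powi (- P)"
      using q z unfolding y_def power_int_minus by simp
    moreover have "y \<noteq> 0"
      using q z by (simp add: y_def)
    ultimately show ?thesis
      using jtheta_reflect[OF nome(2), of y] by (simp add: y_def)
  qed
  have zz: "(1 / z) powi (- a) = z powi a" "(1 / z) powi (- a) * (1 / z) powi (2 * a) = z powi (- a)"
      "z powi (- a) * z powi (2 * a) = z powi a"
    using z powi_add[OF z, of "- a" "2 * a"] powi_add[of "1 / z" "- a" "2 * a"]
    by (simp_all add: power_int_minus power_int_divide_distrib inverse_eq_divide)
  have c: "p * (2 * a) + p * P = p * P + p * (2 * a)" "- p * (2 * a) + p * P = p * P - p * (2 * a)"
    by simp_all
  have "char_num q p P a (1 / z) = (1 / z) powi (- a) * jtheta (- (q powi (p * P + p * (2 * a))) * (1 / z) powi (- P)) ?Q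
      - ((1 / z) powi (- a) * (1 / z) powi (2 * a)) * jtheta (- (q powi (p * P + - (p * (2 * a)))) * (1 / z) powi (- P)) ?Q"
    unfolding char_num_def c by (simp add: right_diff_distrib mult.assoc)
  also have "\<dots> = z powi a * jtheta (- (q powi (p * P - p * (2 * a))) * z powi (- P)) ?Q
      - z powi (- a) * jtheta (- (q powi (p * P + p * (2 * a))) * z powi (- P)) ?Q"
    unfolding refl unfolding zz(2) unfolding zz(1) by simp
  also have "\<dots> = - char_num q p P a z"
  proof -
    have "char_num q p P a z = z powi (- a) * jtheta (- (q powi (p * P + p * (2 * a))) * z powi (- P)) ?Q
        - (z powi (- a) * z powi (2 * a)) * jtheta (- (q powi (p * P - p * (2 * a))) * z powi (- P)) ?Q"
      unfolding char_num_def c by (simp add: right_diff_distrib mult.assoc)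
    then show ?thesis
      unfolding zz(3) by simp
  qed
  finally show ?thesis .
qed

text \<open>The dilation multiplies z^(-P) by q^(-2pP), one period of both theta functions. Their
  multipliers differ, but agree once the prefactors z^(-a) and z^a of the two terms are
  included.\<close>

lemma char_num_shift:
  assumes z: "z \<noteq> 0"
  shows "char_num q p P a (q powi (2 * p) * z) = q powi (- (p * P)) * z powi (- P) * char_num q p P a z"
proof -
  let ?Q = "q powi (2 * p * P)"
  have shift: "jtheta (- (q powi (b + p * P)) * (q powi (2 * p) * z) powi (- P)) ?Q
      = q powi (b - p * P) * z powi (- P) * jtheta (- (q powi (b + p * P)) * z powi (- P)) ?Q" for b
  proof -
    define y where "y = - (q powi (b + p * P)) * (q powi (2 * p) * z) powi (- P)"
    have y0: "y \<noteq> 0"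
      using q z by (simp add: y_def)
    have pw: "(q powi (2 * p) * z) powi (- P) = q powi (- (2 * p * P)) * z powi (- P)"
      by (simp add: power_int_mult_distrib power_int_mult[symmetric])
    have Qy: "?Q * y = - (q powi (b + p * P)) * z powi (- P)"
      using powi_add[OF q(2), of "2 * p * P" "- (2 * p * P)"] q z unfolding y_def pw by simp
    have "y = - (q powi (b - p * P) * z powi (- P))"
      using powi_add[OF q(2), of "b + p * P" "- (2 * p * P)"] unfolding y_def pw
      by (simp add: algebra_simps)
    then have "jtheta y ?Q = q powi (b - p * P) * z powi (- P) * jtheta (?Q * y) ?Q"
      using jtheta_mult_q[OF nome y0] y0 by simp
    then show ?thesis
      unfolding Qy unfolding y_def .
  qed
  have 1: "(q powi (2 * p) * z) powi (- a) * q powi (p * (2 * a) - p * P) = q powi (- (p * P)) * z powi (- a)"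
  proof -
    have "(q powi (2 * p) * z) powi (- a) = q powi (- (p * (2 * a))) * z powi (- a)"
      by (simp add: power_int_mult_distrib power_int_mult[symmetric] mult_ac)
    then show ?thesis
      using powi_add[OF q(2), of "- (p * (2 * a))" "p * (2 * a) - p * P"] by simp
  qed
  have 2: "(q powi (2 * p) * z) powi (- a) * ((q powi (2 * p) * z) powi (2 * a) * q powi (- p * (2 * a) - p * P))
      = q powi (- (p * P)) * z powi (- a) * z powi (2 * a)"
  proof -
    have "(q powi (2 * p) * z) powi (- a) * (q powi (2 * p) * z) powi (2 * a) = (q powi (2 * p) * z) powi a"
      using powi_add[of "q powi (2 * p) * z" "- a" "2 * a"] q z by simp
    also have "\<dots> = q powi (p * (2 * a)) * z powi a"
      by (simp add: power_int_mult_distrib power_int_mult[symmetric] mult_ac)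
    finally have "(q powi (2 * p) * z) powi (- a) * ((q powi (2 * p) * z) powi (2 * a) * q powi (- p * (2 * a) - p * P))
        = (q powi (p * (2 * a)) * q powi (- p * (2 * a) - p * P)) * z powi a"
      by (simp only: mult.assoc[symmetric]) (simp only: mult_ac)
    also have "\<dots> = q powi (- (p * P)) * z powi a"
      using powi_add[OF q(2), of "p * (2 * a)" "- p * (2 * a) - p * P"] by simp
    also have "z powi a = z powi (- a) * z powi (2 * a)"
      using powi_add[OF z, of "- a" "2 * a"] by simp
    finally show ?thesis
      by (simp only: mult.assoc)
  qed
  define T1 where "T1 = jtheta (- (q powi (p * (2 * a) + p * P)) * z powi (- P)) ?Q"
  define T2 where "T2 = jtheta (- (q powi (- p * (2 * a) + p * P)) * z powi (- P)) ?Q"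
  have "char_num q p P a (q powi (2 * p) * z)
      = ((q powi (2 * p) * z) powi (- a) * q powi (p * (2 * a) - p * P)) * z powi (- P) * T1
        - ((q powi (2 * p) * z) powi (- a) * ((q powi (2 * p) * z) powi (2 * a) * q powi (- p * (2 * a) - p * P))) * z powi (- P) * T2"
    unfolding char_num_def shift T1_def T2_def by (simp only: right_diff_distrib mult.assoc)
  also have "\<dots> = q powi (- (p * P)) * z powi (- P) * (z powi (- a) * (T1 - z powi (2 * a) * T2))"
    unfolding 1 2 by (simp add: algebra_simps)
  finally show ?thesis
    unfolding char_num_def T1_def T2_def .
qed

text \<open>The first theta function needs only collecting exponents; the second one needs a
  reflection and a shift by one period to reach the exponent -m P + 2 a p, which is the form used in
  the final formula.\<close>

lemma char_num_at_q_powi: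
  "char_num q p P a (q powi (p - m)) = q powi (- (p - m) * a) * char_val q p P a m"
proof -
  let ?Q = "q powi (2 * p * P)"
  have 1: "q powi (p * (2 * a) + p * P) * (q powi (p - m)) powi (- P) = q powi (m * P + p * (2 * a))"
    unfolding power_int_mult[symmetric] powi_add[OF q(2), symmetric] by (simp add: algebra_simps)
  define y where "y = - (q powi (- m * P + p * (2 * a)))"
  have y0: "y \<noteq> 0"
    using q by (simp add: y_def)
  have "?Q / (?Q * y) = - (q powi (m * P - p * (2 * a)))"
    using q powi_add[OF q(2), of "- m * P + p * (2 * a)" "m * P - p * (2 * a)"]
    by (simp add: y_def divide_simps mult.commute)
  also have "\<dots> = - (q powi (- p * (2 * a) + p * P)) * (q powi (p - m)) powi (- P)"
    unfolding power_int_mult[symmetric] mult_minus_left powi_add[OF q(2), symmetric] by (simp add: algebra_simps)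
  finally have e: "?Q / (?Q * y) = - (q powi (- p * (2 * a) + p * P)) * (q powi (p - m)) powi (- P)" .
  have "jtheta (?Q / (?Q * y)) ?Q = jtheta (?Q * y) ?Q"
    by (rule jtheta_reflect) (use y0 nome(2) in auto)
  then have "jtheta (- (q powi (- p * (2 * a) + p * P)) * (q powi (p - m)) powi (- P)) ?Q = jtheta (?Q * y) ?Q"
    unfolding e .
  also have "\<dots> = q powi (m * P - p * (2 * a)) * jtheta y ?Q"
  proof -
    have "- (1 / y) = q powi (m * P - p * (2 * a))"
      using q powi_add[OF q(2), of "- m * P + p * (2 * a)" "m * P - p * (2 * a)"]
      by (simp add: y_def divide_simps mult.commute)
    moreover have "jtheta (?Q * y) ?Q = - (1 / y) * jtheta y ?Q"
      using jtheta_mult_q[OF nome y0] by simp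
    ultimately show ?thesis
      by (simp only:)
  qed
  finally have 2: "jtheta (- (q powi (- p * (2 * a) + p * P)) * (q powi (p - m)) powi (- P)) ?Q
      = q powi (m * P - p * (2 * a)) * jtheta y ?Q" .
  have 3: "(q powi (p - m)) powi (2 * a) * q powi (m * P - p * (2 * a)) = q powi (m * P - m * (2 * a))"
    unfolding power_int_mult[symmetric] powi_add[OF q(2), symmetric] by (simp add: algebra_simps)
  have 4: "(q powi (p - m)) powi (2 * a) * (q powi (m * P - p * (2 * a)) * J) = q powi (m * P - m * (2 * a)) * J" for J
    using 3 by (simp only: mult.assoc[symmetric])
  have 5: "(q powi (p - m)) powi (- a) = q powi (- (p - m) * a)"
    unfolding power_int_mult[symmetric] by (simp add: algebra_simps)
  show ?thesis
    unfolding char_num_def 2 unfolding char_val_def mult_minus_left 1 4 5 y_def by simp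
qed

lemma char_num_zero_1: "char_num q p P a 1 = 0"
  using char_num_reflect[of 1] by simp

text \<open>The points q^p and q^(-p) are inverse to each other and one dilation apart. The
  multiplier at q^(-p) is 1, so the two values are equal by dilation and opposite by
  reflection.\<close>

lemma char_num_zero_q_powi_p: "char_num q p P a (q powi (- p)) = 0"
proof -
  have 1: "q powi (2 * p) * q powi (- p) = q powi p"
    using powi_add[OF q(2), of "2 * p" "- p"] by simp
  have 2: "q powi (- (p * P)) * (q powi (- p)) powi (- P) = 1"
    unfolding power_int_mult[symmetric] powi_add[OF q(2), symmetric] by simp
  have "char_num q p P a (q powi p) = char_num q p P a (q powi (- p))"
    using char_num_shift[of "q powi (- p)"] q unfolding 1 2 by simp
  moreover have "1 / q powi (- p) = q powi p"
    by (simp add: power_int_minus divide_inverse)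
  ultimately show ?thesis
    using char_num_reflect[of "q powi (- p)"] q by simp
qed

end

subsection \<open>The polar part of the character\<close>

locale admissible = pole_sums q p j for q :: complex and p j :: int +
  fixes r :: int
begin

abbreviation num :: "complex \<Rightarrow> complex" where
  "num \<equiv> char_num q p (2 * p + j) (r + 1)"

text \<open>Written with the factors of the final formula; \<open>polar_coeff_eq\<close> expresses
  it through p - m, the exponent of the pole.\<close>

definition polar_coeff :: "int \<Rightarrow> complex" where
  "polar_coeff m = (-1) powi p * q powi (binom2 p - p * r) / qpoch_inf q q ^ 3 *
     ((-1) powi m * q powi (binom2 (m + 1) + m * (r - p))) * char_val q p (2 * p + j) (r + 1) m"

text \<open>The factor q^(m(1-j)) normalises the residue of S_(p+m) at q^(p-m) to -1. The same
  factor comes out of the geometric summation in \<open>sum_pole_sums_plus\<close>.\<close>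

definition polar_part :: "complex \<Rightarrow> complex" where
  "polar_part z = (\<Sum>m=1..p-1. polar_coeff m *
     (q powi (m * (1 - j)) * pole_sum q p j p (p + m) z - pole_sum q p j p (p - m) z))"

definition regular_part :: "complex \<Rightarrow> complex" where
  "regular_part z = num z / jtheta z q - polar_part z"

section \<open>Cancellation of the poles\<close>

lemma P_pos: "2 * p + j \<ge> 1"
  using p j by simp

lemmas num_simps = char_num_holomorphic[OF q p P_pos] char_num_reflect[OF q p P_pos]
  char_num_shift[OF q p P_pos] char_num_at_q_powi[OF q p P_pos]
  char_num_zero_1[OF q p P_pos] char_num_zero_q_powi_p[OF q p P_pos]

lemma regular_part_shift:
  assumes z: "z \<noteq> 0"
  shows "regular_part (q powi (2 * p) * z) = q powi (- (j * p) - p) * z powi (- j) * regular_part z"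
proof -
  let ?c = "q powi (- (j * p) - p) * z powi (- j)"
  have "jtheta (q powi (2 * p) * z) q = q powi (- (p * (2 * p - 1))) * z powi (- (2 * p)) * jtheta z q"
  proof -
    have "binom2 (2 * p) = p * (2 * p - 1)"
      using two_binom2[of "2 * p"] by simp
    then show ?thesis
      using jtheta_mult_q_powi[OF q z, of "2 * p"] by simp
  qed
  moreover have "q powi (- (p * (2 * p + j))) * z powi (- (2 * p + j))
      = ?c * (q powi (- (p * (2 * p - 1))) * z powi (- (2 * p)))"
  proof -
    have "q powi (- (p * (2 * p + j))) = q powi (- (j * p) - p) * q powi (- (p * (2 * p - 1)))"
      using powi_add[OF q(2), of "- (j * p) - p" "- (p * (2 * p - 1))"] by (simp add: algebra_simps)
    moreover have "z powi (- (2 * p + j)) = z powi (- j) * z powi (- (2 * p))"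
      using powi_add[OF z, of "- j" "- (2 * p)"] by (simp add: algebra_simps)
    ultimately show ?thesis
      by (simp only: mult_ac)
  qed
  moreover have "X * Y * A / (Y * J) = X * (A / J)" if "Y \<noteq> 0" for X Y A J :: complex
    using that by simp
  ultimately have "num (q powi (2 * p) * z) / jtheta (q powi (2 * p) * z) q = ?c * (num z / jtheta z q)"
    unfolding num_simps(3)[OF z] using q z by simp
  moreover have "polar_part (q powi (2 * p) * z) = ?c * polar_part z"
    unfolding polar_part_def pole_sum_shift[OF z] sum_distrib_left
    by (intro sum.cong refl) (simp add: algebra_simps)
  ultimately show ?thesis
    by (simp add: regular_part_def right_diff_distrib)
qed

text \<open>The exponents match by binom2(p-m) = binom2(p) + binom2(m+1) - m p. With k = p - m the
  coefficient becomes (-1)^k q^(binom2(k) - k r) times \<open>char_val\<close>, over (q)_inf^3,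
  which is what the residue of the character at q^k dictates.\<close>

lemma polar_coeff_eq:
  "polar_coeff m = (-1) powi (p - m) * q powi (binom2 (p - m) - (p - m) * r) / qpoch_inf q q ^ 3 *
     char_val q p (2 * p + j) (r + 1) m"
proof -
  have "2 * (binom2 p - p * r + (binom2 (m + 1) + m * (r - p))) = 2 * (binom2 (p - m) - (p - m) * r)"
    using two_binom2[of p] two_binom2[of "m + 1"] two_binom2[of "p - m"]
    by (simp add: algebra_simps)
  then have "q powi (binom2 p - p * r) * q powi (binom2 (m + 1) + m * (r - p)) = q powi (binom2 (p - m) - (p - m) * r)"
    using powi_add[OF q(2)] by (metis mult_cancel_left zero_neq_numeral)
  moreover have "(-1 :: complex) powi p * (-1) powi m = (-1) powi (p - m)"
    by (simp add: power_int_diff power_int_minus_left)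
  moreover have "polar_coeff m = ((-1) powi p * (-1) powi m) *
      (q powi (binom2 p - p * r) * q powi (binom2 (m + 1) + m * (r - p))) / qpoch_inf q q ^ 3 *
      char_val q p (2 * p + j) (r + 1) m"
    unfolding polar_coeff_def by simp
  ultimately show ?thesis
    by (simp only:)
qed

lemma pole_sum_limit_0:
  assumes "\<And>r. 2 * p * r + d \<noteq> - k"
  shows "((\<lambda>x. (x - q powi k) * pole_sum q p j p d x) \<longlongrightarrow> 0) (at (q powi k))"
proof -
  have "q powi k * q powi (2 * p * r + d) \<noteq> 1" for r
  proof
    assume "q powi k * q powi (2 * p * r + d) = 1"
    then have "q powi (k + (2 * p * r + d)) = q powi 0"
      using powi_add[OF q(2)] by simp
    then have "k + (2 * p * r + d) = 0"
      by (rule q_powi_inj)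
    then show False
      using assms[of r] by simp
  qed
  then have "pole_sum q p j p d field_differentiable at (q powi k)"
    using q by (intro pole_sum_field_differentiable) auto
  then have "isCont (pole_sum q p j p d) (q powi k)"
    by (rule field_differentiable_imp_continuous_at)
  then have "((\<lambda>x. (x - q powi k) * pole_sum q p j p d x) \<longlongrightarrow> (q powi k - q powi k) * pole_sum q p j p d (q powi k)) (at (q powi k))"
    by (intro tendsto_intros) (simp add: isCont_def)
  then show ?thesis
    by simp
qed

lemma pole_sum_limit:
  assumes "2 * p * n + d = - k"
  shows "((\<lambda>x. (x - q powi k) * pole_sum q p j p d x) \<longlongrightarrow>
           - (q powi (k + j * p * n\<^sup>2 + p * n + k * j * n))) (at (q powi k))"
proof -
  have "q powi k * q powi (2 * p * n + d) = 1"
    using powi_add[OF q(2), of k "2 * p * n + d"] assms by simp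
  from pole_sum_residue[OF _ this, of p]
  have "((\<lambda>x. (x - q powi k) * pole_sum q p j p d x) \<longlongrightarrow>
       - (q powi k) * (q powi (j * p * n\<^sup>2 + p * n) * (q powi k) powi (j * n))) (at (q powi k))"
    using q by simp
  moreover have "q powi k * (q powi (j * p * n\<^sup>2 + p * n) * (q powi k) powi (j * n))
      = q powi (k + j * p * n\<^sup>2 + p * n + k * j * n)"
    unfolding power_int_mult[symmetric] powi_add[OF q(2), symmetric] by (simp add: algebra_simps)
  ultimately show ?thesis
    by simp
qed

text \<open>Consecutive terms have poles 2p apart in the exponent, so for -p <= k < p the only
  candidates for a pole at q^k are n = -1 in S_(p+m) and n = 0 in S_(p-m).\<close>

lemma polar_term_limit:
  assumes k: "- p \<le> k" "k < p" and m: "1 \<le> m" "m \<le> p - 1"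
  shows "((\<lambda>z. (z - q powi k) * (q powi (m * (1 - j)) * pole_sum q p j p (p + m) z - pole_sum q p j p (p - m) z))
    \<longlongrightarrow> (if m = p + k then q powi k else 0) - (if m = p - k then 1 else 0)) (at (q powi k))"
proof -
  have dist: "\<bar>2 * p * n\<bar> \<ge> 2 * p" if "n \<noteq> 0" for n
    using that p by (simp add: abs_mult)
  have 1: "((\<lambda>z. (z - q powi k) * pole_sum q p j p (p + m) z) \<longlongrightarrow>
      (if m = p - k then - (q powi (- (m * (1 - j)))) else 0)) (at (q powi k))"
  proof (cases "m = p - k")
    case True
    have "2 * p * (-1) + (p + m) = - k"
      using True by simp
    note lim = pole_sum_limit[OF this]
    have "k + j * p * (-1)\<^sup>2 + p * (-1) + k * j * (-1) = - (m * (1 - j))"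
      unfolding True by (simp add: algebra_simps)
    from lim[unfolded this] show ?thesis
      using True by simp
  next
    case False
    have "2 * p * n + (p + m) \<noteq> - k" for n
      using False k m dist[of "n + 1"] by (cases "n = -1") (auto simp: algebra_simps)
    from pole_sum_limit_0[OF this] show ?thesis
      using False by simp
  qed
  have 2: "((\<lambda>z. (z - q powi k) * pole_sum q p j p (p - m) z) \<longlongrightarrow>
      (if m = p + k then - (q powi k) else 0)) (at (q powi k))"
  proof (cases "m = p + k")
    case True
    have "2 * p * 0 + (p - m) = - k"
      using True by simp
    from pole_sum_limit[OF this] show ?thesis
      using True by simp
  next
    case False
    have "2 * p * n + (p - m) \<noteq> - k" for n
      using False k m dist[of n] by (cases "n = 0") auto
    from pole_sum_limit_0[OF this] show ?thesis
      using False by simp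
  qed
  have lim: "((\<lambda>z. q powi (m * (1 - j)) * ((z - q powi k) * pole_sum q p j p (p + m) z)
        - (z - q powi k) * pole_sum q p j p (p - m) z)
      \<longlongrightarrow> q powi (m * (1 - j)) * (if m = p - k then - (q powi (- (m * (1 - j)))) else 0)
        - (if m = p + k then - (q powi k) else 0)) (at (q powi k))"
    by (intro tendsto_intros 1 2)
  have "q powi (m * (1 - j)) * q powi (- (m * (1 - j))) = 1"
    using powi_add[OF q(2), of "m * (1 - j)" "- (m * (1 - j))"] by simp
  then have val: "q powi (m * (1 - j)) * (if m = p - k then - (q powi (- (m * (1 - j)))) else 0)
        - (if m = p + k then - (q powi k) else 0)
      = (if m = p + k then q powi k else 0) - (if m = p - k then 1 else 0)"
    by (cases "m = p - k"; cases "m = p + k") (simp_all only: if_True if_False, simp_all)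
  have "(\<lambda>z. q powi (m * (1 - j)) * ((z - q powi k) * pole_sum q p j p (p + m) z)
        - (z - q powi k) * pole_sum q p j p (p - m) z)
      = (\<lambda>z. (z - q powi k) * (q powi (m * (1 - j)) * pole_sum q p j p (p + m) z - pole_sum q p j p (p - m) z))"
    by (simp add: right_diff_distrib mult.left_commute)
  then show ?thesis
    using lim unfolding val by simp
qed

text \<open>The exponents k form one fundamental domain modulo 2p. For k = 0 and k = -p the
  numerator vanishes and no polar term is singular; for k > 0 the pole belongs to m = p - k, and for
  -p < k < 0 to m = p + k, where the oddness of the numerator reduces q^k to q^(-k).\<close>

lemma regular_part_limit_base:
  assumes k: "- p \<le> k" "k < p"
  shows "((\<lambda>z. (z - q powi k) * regular_part z) \<longlongrightarrow> 0) (at (q powi k))"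
proof -
  let ?Q = "qpoch_inf q q ^ 3"
  define L where "L m = (if m = p + k then q powi k else 0) - (if m = p - k then 1 else 0)" for m :: int
  have "isCont num (q powi k)"
    using holomorphic_on_imp_continuous_on[OF num_simps(1)] q
    by (simp add: continuous_on_eq_continuous_at open_Compl)
  then have "((\<lambda>z. num z * ((z - q powi k) / jtheta z q) - (\<Sum>m=1..p-1. polar_coeff m * ((z - q powi k) *
      (q powi (m * (1 - j)) * pole_sum q p j p (p + m) z - pole_sum q p j p (p - m) z))))
    \<longlongrightarrow> num (q powi k) * - ((-1) powi k * q powi (binom2 k + k) / ?Q)
      - (\<Sum>m=1..p-1. polar_coeff m * L m)) (at (q powi k))"
    unfolding L_def
    by (intro tendsto_intros jtheta_simple_zero[OF q] polar_term_limit k) (auto simp: isCont_def)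
  moreover have "(\<lambda>z. num z * ((z - q powi k) / jtheta z q) - (\<Sum>m=1..p-1. polar_coeff m * ((z - q powi k) *
      (q powi (m * (1 - j)) * pole_sum q p j p (p + m) z - pole_sum q p j p (p - m) z))))
      = (\<lambda>z. (z - q powi k) * regular_part z)"
    by (simp add: regular_part_def polar_part_def right_diff_distrib sum_distrib_left mult_ac)
  moreover have "num (q powi k) * - ((-1) powi k * q powi (binom2 k + k) / ?Q) - (\<Sum>m=1..p-1. polar_coeff m * L m) = 0"
  proof -
    consider "k = 0 \<or> k = - p" | "1 \<le> k" | "- p < k" "k \<le> -1"
      using k by linarith
    then show ?thesis
    proof cases
      case 1
      then have "num (q powi k) = 0"
        using num_simps(5,6) by auto
      moreover have "(\<Sum>m=1..p-1. polar_coeff m * L m) = 0"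
        using 1 p by (intro sum.neutral) (auto simp: L_def)
      ultimately show ?thesis
        by simp
    next
      case 2
      have "(\<Sum>m=1..p-1. polar_coeff m * L m) = (\<Sum>m=1..p-1. if m = p - k then - polar_coeff m else 0)"
        using 2 by (intro sum.cong) (auto simp: L_def)
      also have "\<dots> = - polar_coeff (p - k)"
        using 2 k by simp
      also have "\<dots> = - ((-1) powi k * q powi (binom2 k - k * r) / ?Q * char_val q p (2 * p + j) (r + 1) (p - k))"
        unfolding polar_coeff_eq by simp
      also have "q powi (binom2 k - k * r) = q powi (binom2 k + k) * q powi (- k * (r + 1))"
        using powi_add[OF q(2), of "binom2 k + k" "- k * (r + 1)"] by (simp add: algebra_simps)
      finally show ?thesis
        using num_simps(4)[of "r + 1" "p - k"] by (simp add: mult_ac)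
    next
      case 3
      have "(\<Sum>m=1..p-1. polar_coeff m * L m) = (\<Sum>m=1..p-1. if m = p + k then polar_coeff m * q powi k else 0)"
        using 3 by (intro sum.cong) (auto simp: L_def)
      also have "\<dots> = polar_coeff (p + k) * q powi k"
        using 3 by simp
      also have "\<dots> = (-1) powi (- k) * (q powi (binom2 (- k) + k * r) * q powi k) / ?Q * char_val q p (2 * p + j) (r + 1) (p + k)"
        unfolding polar_coeff_eq by simp
      also have "q powi (binom2 (- k) + k * r) * q powi k = q powi (binom2 k + k) * q powi (k * (r + 1))"
      proof -
        have "2 * (binom2 (- k) + k * r + k) = 2 * (binom2 k + k + k * (r + 1))"
          using two_binom2[of k] two_binom2[of "- k"] by (simp add: algebra_simps)
        then show ?thesis
          using powi_add[OF q(2)] by (metis mult_cancel_left zero_neq_numeral)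
      qed
      finally have "(\<Sum>m=1..p-1. polar_coeff m * L m) = (-1) powi k * (q powi (binom2 k + k) * q powi (k * (r + 1))) / ?Q
          * char_val q p (2 * p + j) (r + 1) (p + k)"
        by (simp add: power_int_minus_left)
      moreover have "num (q powi k) = - (q powi (k * (r + 1)) * char_val q p (2 * p + j) (r + 1) (p + k))"
      proof -
        have "1 / q powi (- k) = q powi k"
          by (simp add: power_int_minus divide_inverse)
        then show ?thesis
          using num_simps(2)[of "q powi (- k)" "r + 1"] num_simps(4)[of "r + 1" "p + k"] q by simp
      qed
      ultimately show ?thesis
        by (simp add: mult_ac)
    qed
  qed
  ultimately show ?thesis
    by metis
qed

text \<open>The functional equation transports the vanishing of the residue from q^k to q^(k+2p) and
  back; both directions are needed to reach all integers from one fundamental domain.\<close>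

lemma regular_part_limit: "((\<lambda>z. (z - q powi k) * regular_part z) \<longlongrightarrow> 0) (at (q powi k))"
proof -
  let ?good = "\<lambda>z0. ((\<lambda>z. (z - z0) * regular_part z) \<longlongrightarrow> 0) (at z0)"
  define t where "t = q powi (2 * p)"
  have t: "t \<noteq> 0"
    using q by (simp add: t_def)
  have up: "?good (t * z0)" if z0: "z0 \<noteq> 0" and good: "?good z0" for z0
  proof -
    have "((\<lambda>z. t * (q powi (- (j * p) - p) * z powi (- j)) * ((z - z0) * regular_part z))
        \<longlongrightarrow> t * (q powi (- (j * p) - p) * z0 powi (- j)) * 0) (at z0)"
      using z0 by (intro tendsto_intros good) auto
    moreover have "filterlim (\<lambda>z. z / t) (at z0) (at (t * z0))"
    proof (rule filterlim_atI)
      show "((\<lambda>z. z / t) \<longlongrightarrow> z0) (at (t * z0))"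
        using t by (auto intro!: tendsto_eq_intros)
      have "\<forall>\<^sub>F z in at (t * z0). z \<noteq> t * z0"
        by (rule eventually_neq_at_within)
      then show "\<forall>\<^sub>F z in at (t * z0). z / t \<noteq> z0"
        by eventually_elim (use t in \<open>auto simp: field_simps\<close>)
    qed
    ultimately have lim: "((\<lambda>z. t * (q powi (- (j * p) - p) * (z / t) powi (- j)) * ((z / t - z0) * regular_part (z / t)))
        \<longlongrightarrow> t * (q powi (- (j * p) - p) * z0 powi (- j)) * 0) (at (t * z0))"
      by (rule filterlim_compose)
    have "\<forall>\<^sub>F z in at (t * z0). z \<noteq> 0"
      by (rule eventually_neq_at_within)
    then have "\<forall>\<^sub>F z in at (t * z0). t * (q powi (- (j * p) - p) * (z / t) powi (- j)) * ((z / t - z0) * regular_part (z / t))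
        = (z - t * z0) * regular_part z"
    proof eventually_elim
      case (elim z)
      have "regular_part z = q powi (- (j * p) - p) * (z / t) powi (- j) * regular_part (z / t)"
        using regular_part_shift[of "z / t"] elim t by (simp add: t_def)
      moreover have "z - t * z0 = t * (z / t - z0)"
        using t by (simp add: field_simps)
      ultimately show ?case
        by (simp only: mult_ac)
    qed
    from Lim_transform_eventually[OF lim this] show ?thesis
      by simp
  qed
  have down: "?good z0" if z0: "z0 \<noteq> 0" and good: "?good (t * z0)" for z0
  proof -
    have lim0: "((\<lambda>z. inverse (t * (q powi (- (j * p) - p) * (z / t) powi (- j))) * ((z - t * z0) * regular_part z))
        \<longlongrightarrow> inverse (t * (q powi (- (j * p) - p) * (t * z0 / t) powi (- j))) * 0) (at (t * z0))"
      using z0 t q by (intro tendsto_intros good) auto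
    have "filterlim (\<lambda>z. t * z) (at (t * z0)) (at z0)"
    proof (rule filterlim_atI)
      show "((\<lambda>z. t * z) \<longlongrightarrow> t * z0) (at z0)"
        by (intro tendsto_intros)
      have "\<forall>\<^sub>F z in at z0. z \<noteq> z0"
        by (rule eventually_neq_at_within)
      then show "\<forall>\<^sub>F z in at z0. t * z \<noteq> t * z0"
        by eventually_elim (use t in auto)
    qed
    from filterlim_compose[OF lim0 this]
    have lim: "((\<lambda>z. inverse (t * (q powi (- (j * p) - p) * (t * z / t) powi (- j))) * ((t * z - t * z0) * regular_part (t * z)))
        \<longlongrightarrow> 0) (at z0)"
      by simp
    have "\<forall>\<^sub>F z in at z0. z \<noteq> 0"
      by (rule eventually_neq_at_within)
    then have "\<forall>\<^sub>F z in at z0. inverse (t * (q powi (- (j * p) - p) * (t * z / t) powi (- j))) * ((t * z - t * z0) * regular_part (t * z))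
        = (z - z0) * regular_part z"
    proof eventually_elim
      case (elim z)
      have 1: "regular_part (t * z) = q powi (- (j * p) - p) * z powi (- j) * regular_part z"
        using regular_part_shift[OF elim] by (simp add: t_def)
      have 2: "t * z - t * z0 = t * (z - z0)" "t * z / t = z"
        using t by (simp_all add: right_diff_distrib)
      have "inverse (t * X) * (t * A * (X * B)) = A * B" if "X \<noteq> 0" for X A B
        using that t by (simp add: field_simps)
      then show ?case
        unfolding 1 2 by this (use q elim in simp)
    qed
    from Lim_transform_eventually[OF lim this] show ?thesis .
  qed
  define k0 where "k0 = (k + p) mod (2 * p) - p"
  define n where "n = (k + p) div (2 * p)"
  have k: "k = k0 + 2 * p * n"
    using mult_div_mod_eq[of "2 * p" "k + p"] unfolding k0_def n_def by linarith
  have k0: "- p \<le> k0" "k0 < p"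
    using p pos_mod_bound[of "2 * p" "k + p"] by (auto simp: k0_def)
  have next_eq: "t * q powi (k0 + 2 * p * n) = q powi (k0 + 2 * p * (n + 1))" for n
    unfolding t_def using powi_add[OF q(2), of "2 * p" "k0 + 2 * p * n"] by (simp add: algebra_simps)
  have "?good (q powi (k0 + 2 * p * n))" for n
  proof (induction n rule: int_induct[where k = 0])
    case base
    show ?case
      using regular_part_limit_base[OF k0] by simp
  next
    case (step1 n)
    show ?case
      using up[OF _ step1.IH] q unfolding next_eq by simp
  next
    case (step2 n)
    have "?good (t * q powi (k0 + 2 * p * (n - 1)))"
      using step2.IH unfolding next_eq by simp
    with _ show ?case
      by (rule down) (use q in auto)
  qed
  then show ?thesis
    unfolding k .
qed

end

lemma has_sum_sum:
  fixes f :: "'i \<Rightarrow> 'a \<Rightarrow> complex"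
  assumes "\<And>i. i \<in> A \<Longrightarrow> (f i has_sum s i) X"
  shows "((\<lambda>x. \<Sum>i\<in>A. f i x) has_sum (\<Sum>i\<in>A. s i)) X"
  using assms by (induction A rule: infinite_finite_induct) (auto intro!: has_sum_add)

section \<open>Expansion of the character in theta functions and its polar part\<close>

context admissible
begin

text \<open>Every pole of a pole sum is a power of q and hence already a zero of j(z;q), so that one
  exceptional set serves all summands.\<close>

lemma regular_part_holomorphic: "regular_part holomorphic_on -{0} - {z. jtheta z q = 0}"
proof -
  let ?A = "-{0} - {z. jtheta z q = 0}"
  have "pole_sum q p j p d holomorphic_on ?A" for d
    unfolding holomorphic_on_def
  proof
    fix z assume z: "z \<in> ?A"
    have "z * q powi (2 * p * n + d) \<noteq> 1" for n
    proof
      assume "z * q powi (2 * p * n + d) = 1"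
      then have "z = q powi (- (2 * p * n + d))"
        unfolding power_int_minus by (metis inverse_unique mult.commute)
      then show False
        using z jtheta_eq_0_iff[OF q, of z] by auto
    qed
    with z have "pole_sum q p j p d field_differentiable at z"
      by (intro pole_sum_field_differentiable) auto
    then show "pole_sum q p j p d field_differentiable at z within ?A"
      by (rule field_differentiable_at_within)
  qed
  moreover have "num holomorphic_on ?A"
    using num_simps(1) by (rule holomorphic_on_subset) auto
  moreover have "(\<lambda>z. jtheta z q) holomorphic_on ?A"
    by (rule jtheta_holomorphic[OF q(1)]) auto
  ultimately show ?thesis
    unfolding regular_part_def[abs_def] polar_part_def by (intro holomorphic_intros) auto
qed

text \<open>Two expansions meet: the regular part has coefficients \<open>c\<close> on the whole
  punctured plane, the character has coefficients \<open>d\<close> in the annulus only. They differ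
  by the coefficients of the pole sums, which vanish on the window -j, ..., -1, so there the theta
  coefficients can be read off \<open>d\<close>.\<close>

theorem char_expansion:
  "\<exists>d. (\<forall>z. norm q < norm z \<longrightarrow> norm z < 1 \<longrightarrow> ((\<lambda>n. d n * z powi n) has_sum num z / jtheta z q) UNIV) \<and>
    (\<forall>z. z \<noteq> 0 \<longrightarrow> jtheta z q \<noteq> 0 \<longrightarrow> num z / jtheta z q =
       (\<Sum>s=0..j-1. d (- s - 1) * z powi (- s - 1) *
          jtheta (- (q powi (p * (j - 2 * s - 1))) * z powi j) (q powi (2 * p * j))) + polar_part z)"
proof -
  have isol: "\<forall>\<^sub>F x in at z. x \<notin> {z. jtheta z q = 0}" if "z \<in> -{0}" for z
    using jtheta_isolated_zeros[of z] that by simp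
  have lim: "((\<lambda>x. (x - z) * regular_part x) \<longlongrightarrow> 0) (at z)" if a: "z \<in> -{0}" "z \<in> {z. jtheta z q = 0}" for z
  proof -
    obtain k where "z = q powi k"
      using a jtheta_eq_0_iff[OF q, of z] by auto
    then show ?thesis
      using regular_part_limit by simp
  qed
  have op: "open (-{0 :: complex})"
    by (simp add: open_Compl)
  have "\<exists>g. g holomorphic_on -{0} \<and> (\<forall>z\<in>-{0} - {z. jtheta z q = 0}. g z = regular_part z)"
    by (rule removable_singularities[OF op regular_part_holomorphic isol lim]) auto
  then obtain g where g: "g holomorphic_on -{0}"
      "\<forall>z\<in>-{0} - {z. jtheta z q = 0}. g z = regular_part z"
    by (elim exE conjE)
  have gz: "g z = regular_part z" if "z \<noteq> 0" "jtheta z q \<noteq> 0" for z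
    using g(2) that by simp
  have shift: "g (q powi (2 * p) * z) = q powi (- (j * p) - p) * z powi (- j) * g z"
    if z: "z \<noteq> 0" "jtheta z q \<noteq> 0" for z
  proof -
    have "jtheta (q powi (2 * p) * z) q \<noteq> 0"
      using jtheta_mult_q_powi[OF q z(1), of "2 * p"] z q by simp
    then show ?thesis
      using gz z regular_part_shift[OF z(1)] q by simp
  qed
  have "\<exists>c. \<forall>z. z \<noteq> 0 \<longrightarrow> ((\<lambda>n. c n * z powi n) has_sum g z) UNIV \<and>
    g z = (\<Sum>s=0..j-1. c (- s - 1) * z powi (- s - 1) *
        jtheta (- (q powi (p * (j - 2 * s - 1))) * z powi j) (q powi (2 * p * j)))"
    by (rule quasi_periodic_expansion[OF g(1) shift])
  then obtain c where c: "\<And>z. z \<noteq> 0 \<Longrightarrow> ((\<lambda>n. c n * z powi n) has_sum g z) UNIV"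
    "\<And>z. z \<noteq> 0 \<Longrightarrow> g z = (\<Sum>s=0..j-1. c (- s - 1) * z powi (- s - 1) *
        jtheta (- (q powi (p * (j - 2 * s - 1))) * z powi j) (q powi (2 * p * j)))"
    by blast
  have "\<exists>C. (\<forall>n. - j \<le> n \<longrightarrow> n \<le> -1 \<longrightarrow> C n = 0) \<and>
      (\<forall>x. norm q < norm x \<longrightarrow> norm x < 1 \<longrightarrow> ((\<lambda>n. C n * x powi n) has_sum
        (q powi (m * (1 - j)) * pole_sum q p j p (p + m) x - pole_sum q p j p (p - m) x)) UNIV)"
    (is "\<exists>C. ?P m C") if m: "m \<in> {1..p-1}" for m
  proof -
    have d: "0 < p + m" "p + m < 2 * p" "0 < p - m" "p - m < 2 * p"
      using m by auto
    obtain C1 where C1: "\<And>n. - j \<le> n \<Longrightarrow> n \<le> -1 \<Longrightarrow> C1 n = 0"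
      "\<And>x. norm q < norm x \<Longrightarrow> norm x < 1 \<Longrightarrow> ((\<lambda>n. C1 n * x powi n) has_sum pole_sum q p j p (p + m) x) UNIV"
      using pole_sum_laurent[OF d(1,2), where b = p] by blast
    obtain C2 where C2: "\<And>n. - j \<le> n \<Longrightarrow> n \<le> -1 \<Longrightarrow> C2 n = 0"
      "\<And>x. norm q < norm x \<Longrightarrow> norm x < 1 \<Longrightarrow> ((\<lambda>n. C2 n * x powi n) has_sum pole_sum q p j p (p - m) x) UNIV"
      using pole_sum_laurent[OF d(3,4), where b = p] by blast
    have "((\<lambda>n. (q powi (m * (1 - j)) * C1 n - C2 n) * x powi n) has_sum
        (q powi (m * (1 - j)) * pole_sum q p j p (p + m) x - pole_sum q p j p (p - m) x)) UNIV"
      if x: "norm q < norm x" "norm x < 1" for x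
    proof -
      have "((\<lambda>n. q powi (m * (1 - j)) * (C1 n * x powi n) + - (C2 n * x powi n)) has_sum
          (q powi (m * (1 - j)) * pole_sum q p j p (p + m) x + - pole_sum q p j p (p - m) x)) UNIV"
        by (intro has_sum_add has_sum_cmult_right has_sum_uminusI C1 C2 x)
      then show ?thesis
        by (simp add: left_diff_distrib mult.assoc)
    qed
    then show ?thesis
      using C1(1) C2(1) by (intro exI[of _ "\<lambda>n. q powi (m * (1 - j)) * C1 n - C2 n"]) auto
  qed
  then have "\<forall>m\<in>{1..p-1}. \<exists>C. ?P m C"
    by blast
  then obtain C where "\<forall>m\<in>{1..p-1}. ?P m (C m)"
    unfolding bchoice_iff by (elim exE)
  then have C: "\<And>m n. m \<in> {1..p-1} \<Longrightarrow> - j \<le> n \<Longrightarrow> n \<le> -1 \<Longrightarrow> C m n = 0"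
      "\<And>m x. m \<in> {1..p-1} \<Longrightarrow> norm q < norm x \<Longrightarrow> norm x < 1 \<Longrightarrow> ((\<lambda>n. C m n * x powi n) has_sum
        (q powi (m * (1 - j)) * pole_sum q p j p (p + m) x - pole_sum q p j p (p - m) x)) UNIV"
    by blast+
  define d where "d n = c n + (\<Sum>m=1..p-1. polar_coeff m * C m n)" for n
  show ?thesis
  proof (intro exI[of _ d] conjI allI impI)
    fix z :: complex assume z: "norm q < norm z" "norm z < 1"
    then have z0: "z \<noteq> 0"
      using norm_ge_zero[of q] by auto
    have nz: "jtheta z q \<noteq> 0"
      using z by (rule jtheta_nonzero_annulus)
    have "((\<lambda>n. c n * z powi n + (\<Sum>m=1..p-1. polar_coeff m * (C m n * z powi n))) has_sum
        (g z + polar_part z)) UNIV"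
      unfolding polar_part_def by (intro has_sum_add has_sum_sum has_sum_cmult_right c z0 C z)
    also have "g z + polar_part z = num z / jtheta z q"
      using gz[OF z0 nz] by (simp add: regular_part_def)
    finally show "((\<lambda>n. d n * z powi n) has_sum num z / jtheta z q) UNIV"
      by (simp add: d_def distrib_right sum_distrib_right mult.assoc)
  next
    fix z :: complex assume z: "z \<noteq> 0" "jtheta z q \<noteq> 0"
    have "d (- s - 1) = c (- s - 1)" if "s \<in> {0..j-1}" for s
      using that C(1) by (auto simp: d_def)
    then show "num z / jtheta z q = (\<Sum>s=0..j-1. d (- s - 1) * z powi (- s - 1) *
          jtheta (- (q powi (p * (j - 2 * s - 1))) * z powi j) (q powi (2 * p * j))) + polar_part z"
      using gz[OF z] c(2)[OF z(1)] by (simp add: regular_part_def)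
  qed
qed

subsection \<open>Appell functions\<close>

lemma pole_term_summable:
  assumes "x \<noteq> 0"
  shows "pole_term q (p * j) 1 b d x summable_on UNIV"
proof -
  interpret big: pole_sums q "p * j" 1
    using q mult_mono[of 1 p 1 j] p j by unfold_locales auto
  show ?thesis
    using big.pole_sum_near[OF assms, where K = 0 and b = b and d = d] by metis
qed

lemma appell_denominator:
  "(q powi (2 * (p * j))) powi (n - 1) * (- (q powi (d + p * j - b))) * (- (q powi (p * j + b)) * x)
    = x * q powi (2 * (p * j) * n + d)"
proof -
  have "(q powi (2 * (p * j))) powi (n - 1) * (- (q powi (d + p * j - b))) * (- (q powi (p * j + b)) * x)
      = x * (q powi (2 * (p * j) * (n - 1)) * q powi (d + p * j - b) * q powi (p * j + b))"
    unfolding power_int_mult[of q] by simp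
  also have "\<dots> = x * q powi (2 * (p * j) * n + d)"
    unfolding powi_add[OF q(2), symmetric] by (simp add: algebra_simps)
  finally show ?thesis .
qed

text \<open>Clearing the theta denominator leaves the bilateral sum. The second argument Z fixes the
  linear exponent b, and the first argument X is then such that Q^(n-1) X Z = x q^(2pjn+d), with Q
  the nome.\<close>

lemma appell_m_eq_pole_sum:
  assumes "jtheta (- (q powi (p * j + b)) * x) (q powi (2 * (p * j))) \<noteq> 0"
  shows "jtheta (- (q powi (p * j + b)) * x) (q powi (2 * (p * j))) *
      appell_m (- (q powi (d + p * j - b))) (- (q powi (p * j + b)) * x) (q powi (2 * (p * j)))
    = pole_sum q (p * j) 1 b d x"
proof -
  let ?Q = "q powi (2 * (p * j))"
  let ?X = "- (q powi (d + p * j - b))"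
  let ?Z = "- (q powi (p * j + b)) * x"
  have "(-1) powi n * ?Q powi binom2 n * ?Z powi n / (1 - ?Q powi (n - 1) * ?X * ?Z) = pole_term q (p * j) 1 b d x n" for n
    unfolding pole_term_def theta_summand[OF q(2)] appell_denominator by simp
  then show ?thesis
    using assms by (simp add: appell_m_def pole_sum_def)
qed

lemma geometric_powi:
  fixes y :: complex
  assumes "y \<noteq> 1" "y \<noteq> 0"
  shows "(\<Sum>s=0..j-1. y powi s) = (1 - y powi j) / (1 - y)"
  using j
proof (induction j rule: int_ge_induct)
  case base
  show ?case
    using assms by simp
next
  case (step i)
  have "{0..i + 1 - 1} = insert i {0..i - 1}"
    using step(1) by auto
  then have "(\<Sum>s=0..i+1-1. y powi s) = y powi i + (1 - y powi i) / (1 - y)"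
    using step(2) by simp
  also have "\<dots> = (1 - y powi (i + 1)) / (1 - y)"
    using assms by (simp add: power_int_add field_simps)
  finally show ?case .
qed

text \<open>For fixed n the s-th term is a common factor times y^(-s) / (1 - y^j), where y = z
  q^(2pn-p+m). The finite geometric series turns this into y^(1-j) / (1 - y): of the j simple poles
  at y^j = 1 only y = 1 survives.\<close>

lemma sum_pole_sums_plus:
  assumes z: "z \<noteq> 0" and nonpole: "\<And>n. z powi j * q powi (2 * (p * j) * n + j * (m - p)) \<noteq> 1"
  shows "(\<Sum>s=0..j-1. q powi ((p - m) * s) * z powi (- s) *
      pole_sum q (p * j) 1 (- (p * (2 * s + 1))) (j * (m - p)) (z powi j))
    = z * q powi (m * (1 - j)) * pole_sum q p j p (p + m) z"
proof -
  let ?T = "\<lambda>s n. q powi ((p - m) * s) * z powi (- s) *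
      pole_term q (p * j) 1 (- (p * (2 * s + 1))) (j * (m - p)) (z powi j) n"
  \<comment> \<open>The index moves to n - 1 because 2pn - p + m = 2p(n-1) + (p+m).\<close>
  have summand: "(\<Sum>s=0..j-1. ?T s n) = z * q powi (m * (1 - j)) * pole_term q p j p (p + m) z (n - 1)" for n
  proof -
    define e where "e = 2 * p * n - p + m"
    define y where "y = z * q powi e"
    have y0: "y \<noteq> 0"
      using z q by (simp add: y_def)
    have yj: "z powi j * q powi (2 * (p * j) * n + j * (m - p)) = y powi j"
      unfolding y_def power_int_mult_distrib power_int_mult[symmetric] by (simp add: e_def algebra_simps)
    have y1: "y powi j \<noteq> 1" "y \<noteq> 1"
      using nonpole[of n] unfolding yj by auto
    have T: "?T s n = q powi (j * p * n\<^sup>2 - p * n) * z powi (j * n) / (1 - y powi j) * (1 / y) powi s" for s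
    proof -
      have "(1 / y) powi s = z powi (- s) * q powi (- (e * s))"
        unfolding y_def by (simp add: power_int_divide_distrib power_int_mult_distrib power_int_minus
            power_int_mult power_int_inverse divide_inverse)
      moreover have "q powi ((p - m) * s) * q powi (1 * (p * j) * n\<^sup>2 + - (p * (2 * s + 1)) * n)
          = q powi (j * p * n\<^sup>2 - p * n) * q powi (- (e * s))"
        unfolding powi_add[OF q(2), symmetric] by (simp add: e_def algebra_simps)
      moreover have "(z powi j) powi (1 * n) = z powi (j * n)"
        by (simp add: power_int_mult)
      moreover have "A * Zs * (B * C / D) = (A * B) * Zs * C / D" for A Zs B C D :: complex
        by simp
      ultimately show ?thesis
        unfolding pole_term_def yj by (simp only:) (simp add: mult_ac)
    qed
    have geo: "(\<Sum>s=0..j-1. (1 / y) powi s) = y powi (1 - j) * (1 - y powi j) / (1 - y)"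
    proof -
      have "(\<Sum>s=0..j-1. (1 / y) powi s) = (1 - (1 / y) powi j) / (1 - 1 / y)"
        using y0 y1 by (intro geometric_powi) auto
      also have "\<dots> = y powi (1 - j) * (1 - y powi j) / (1 - y)"
        using y0 y1 by (simp add: power_int_divide_distrib power_int_diff field_simps)
      finally show ?thesis .
    qed
    have "(\<Sum>s=0..j-1. ?T s n) = q powi (j * p * n\<^sup>2 - p * n) * z powi (j * n) / (1 - y powi j) * (\<Sum>s=0..j-1. (1 / y) powi s)"
      unfolding T sum_distrib_left ..
    also have "\<dots> = q powi (j * p * n\<^sup>2 - p * n) * z powi (j * n) * y powi (1 - j) / (1 - y)"
      unfolding geo using y1 by simp
    also have "\<dots> = (q powi (j * p * n\<^sup>2 - p * n) * q powi (e * (1 - j))) * (z powi (j * n) * z powi (1 - j)) / (1 - y)"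
      unfolding y_def power_int_mult_distrib power_int_mult[symmetric] by (simp only: mult_ac)
    also have "z powi (j * n) * z powi (1 - j) = z * z powi (j * (n - 1))"
      using powi_add[OF z, of "j * n" "1 - j"] powi_add[OF z, of 1 "j * (n - 1)"] by (simp add: algebra_simps)
    also have "q powi (j * p * n\<^sup>2 - p * n) * q powi (e * (1 - j)) = q powi (m * (1 - j)) * q powi (j * p * (n - 1)\<^sup>2 + p * (n - 1))"
      unfolding powi_add[OF q(2), symmetric] by (simp add: e_def power2_eq_square algebra_simps)
    also have "y = z * q powi (2 * p * (n - 1) + (p + m))"
      by (simp add: y_def e_def algebra_simps)
    finally show ?thesis
      unfolding pole_term_def by (simp only: mult_ac times_divide_eq_right)
  qed
  have "((\<lambda>n. \<Sum>s=0..j-1. ?T s n) has_sum (\<Sum>s=0..j-1. q powi ((p - m) * s) * z powi (- s) *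
      pole_sum q (p * j) 1 (- (p * (2 * s + 1))) (j * (m - p)) (z powi j))) UNIV"
    unfolding pole_sum_def using z
    by (intro has_sum_sum has_sum_cmult_right has_sum_infsum pole_term_summable) auto
  then have "(\<Sum>s=0..j-1. q powi ((p - m) * s) * z powi (- s) *
      pole_sum q (p * j) 1 (- (p * (2 * s + 1))) (j * (m - p)) (z powi j))
    = (\<Sum>\<^sub>\<infinity>n. z * q powi (m * (1 - j)) * pole_term q p j p (p + m) z (n - 1))"
    unfolding summand by (rule infsumI[symmetric])
  also have "\<dots> = z * q powi (m * (1 - j)) * (\<Sum>\<^sub>\<infinity>n. pole_term q p j p (p + m) z (n - 1))"
    by (rule infsum_cmult_right')
  also have "(\<Sum>\<^sub>\<infinity>n. pole_term q p j p (p + m) z (n - 1)) = pole_sum q p j p (p + m) z"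
    unfolding pole_sum_def by (rule infsum_reindex_bij_witness[of _ "\<lambda>n. n + 1" "\<lambda>n. n - 1"]) auto
  finally show ?thesis .
qed

text \<open>The same collapse with y = q^(2pn-p+m) / z. The argument z^(-j) reverses the direction
  of the sum, whence the index -n and the offset p - m; the sign comes from 1 / (1 - y) = -(1/y) /
  (1 - 1/y).\<close>

lemma sum_pole_sums_minus:
  assumes z: "z \<noteq> 0" and nonpole: "\<And>n. z powi (- j) * q powi (2 * (p * j) * n + j * (m - p)) \<noteq> 1"
  shows "(\<Sum>s=0..j-1. q powi ((m - p) * (s + 1)) * z powi (- s) *
      pole_sum q (p * j) 1 (p * (2 * s + 1)) (j * (m - p)) (z powi (- j)))
    = - z * pole_sum q p j p (p - m) z"
proof -
  let ?T = "\<lambda>s n. q powi ((m - p) * (s + 1)) * z powi (- s) *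
      pole_term q (p * j) 1 (p * (2 * s + 1)) (j * (m - p)) (z powi (- j)) n"
  have summand: "(\<Sum>s=0..j-1. ?T s n) = - z * pole_term q p j p (p - m) z (- n)" for n
  proof -
    define e where "e = 2 * p * n - p + m"
    define y where "y = q powi e / z"
    have y0: "y \<noteq> 0"
      using z q by (simp add: y_def)
    have yj: "z powi (- j) * q powi (2 * (p * j) * n + j * (m - p)) = y powi j"
    proof -
      have "q powi (2 * (p * j) * n + j * (m - p)) = q powi (e * j)"
        by (simp add: e_def algebra_simps)
      then show ?thesis
        unfolding y_def power_int_divide_distrib power_int_mult[symmetric] by (simp add: power_int_minus divide_inverse)
    qed
    have y1: "y powi j \<noteq> 1" "y \<noteq> 1"
      using nonpole[of n] unfolding yj by auto
    have T: "?T s n = q powi (j * p * n\<^sup>2 + p * n + (m - p)) * z powi (- j * n) / (1 - y powi j) * y powi s" for s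
    proof -
      have "y powi s = z powi (- s) * q powi (e * s)"
        unfolding y_def power_int_divide_distrib power_int_mult[symmetric] by (simp add: power_int_minus divide_inverse)
      moreover have "q powi ((m - p) * (s + 1)) * q powi (1 * (p * j) * n\<^sup>2 + p * (2 * s + 1) * n)
          = q powi (j * p * n\<^sup>2 + p * n + (m - p)) * q powi (e * s)"
        unfolding powi_add[OF q(2), symmetric] by (simp add: e_def algebra_simps)
      moreover have "(z powi (- j)) powi (1 * n) = z powi (- j * n)"
        unfolding power_int_mult by simp
      moreover have "A * Zs * (B * C / D) = (A * B) * Zs * C / D" for A Zs B C D :: complex
        by simp
      ultimately show ?thesis
        unfolding pole_term_def yj by (simp only:) (simp add: mult_ac)
    qed
    have "(\<Sum>s=0..j-1. ?T s n) = q powi (j * p * n\<^sup>2 + p * n + (m - p)) * z powi (- j * n) / (1 - y powi j) * (\<Sum>s=0..j-1. y powi s)"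
      unfolding T sum_distrib_left ..
    also have "\<dots> = q powi (j * p * n\<^sup>2 + p * n + (m - p)) * z powi (- j * n) / (1 - y)"
      unfolding geometric_powi[OF y1(2) y0] using y1 by simp
    also have "q powi (j * p * n\<^sup>2 + p * n + (m - p)) = q powi (j * p * (- n)\<^sup>2 + p * (- n)) * (y * z)"
    proof -
      have "y * z = q powi e"
        using z by (simp add: y_def)
      then show ?thesis
        using powi_add[OF q(2), of "j * p * (- n)\<^sup>2 + p * (- n)" e] by (simp add: e_def algebra_simps)
    qed
    also have "q powi (j * p * (- n)\<^sup>2 + p * (- n)) * (y * z) * z powi (- j * n) / (1 - y)
        = - z * (q powi (j * p * (- n)\<^sup>2 + p * (- n)) * z powi (j * (- n)) / (1 - 1 / y))"
    proof -
      have "A * (y * z) * B / (1 - y) = - z * (A * B / (1 - 1 / y))" for A B :: complex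
        using y0 y1(2) by (simp add: divide_simps) (simp add: algebra_simps)
      then show ?thesis
        by simp
    qed
    also have "1 / y = z * q powi (2 * p * (- n) + (p - m))"
    proof -
      have "2 * p * (- n) + (p - m) = - e"
        by (simp add: e_def)
      then show ?thesis
        by (simp add: y_def power_int_minus divide_inverse)
    qed
    finally show ?thesis
      unfolding pole_term_def .
  qed
  have "((\<lambda>n. \<Sum>s=0..j-1. ?T s n) has_sum (\<Sum>s=0..j-1. q powi ((m - p) * (s + 1)) * z powi (- s) *
      pole_sum q (p * j) 1 (p * (2 * s + 1)) (j * (m - p)) (z powi (- j)))) UNIV"
    unfolding pole_sum_def using z
    by (intro has_sum_sum has_sum_cmult_right has_sum_infsum pole_term_summable) auto
  then have "(\<Sum>s=0..j-1. q powi ((m - p) * (s + 1)) * z powi (- s) *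
      pole_sum q (p * j) 1 (p * (2 * s + 1)) (j * (m - p)) (z powi (- j)))
    = (\<Sum>\<^sub>\<infinity>n. - z * pole_term q p j p (p - m) z (- n))"
    unfolding summand by (rule infsumI[symmetric])
  also have "\<dots> = - z * (\<Sum>\<^sub>\<infinity>n. pole_term q p j p (p - m) z (- n))"
    by (rule infsum_cmult_right')
  also have "(\<Sum>\<^sub>\<infinity>n. pole_term q p j p (p - m) z (- n)) = pole_sum q p j p (p - m) z"
    unfolding pole_sum_def by (rule infsum_reindex_bij_witness[of _ uminus uminus]) auto
  finally show ?thesis .
qed

end

context admissible
begin

text \<open>The theta prefactor equals the theta denominator of both Appell functions, for the first
  one by reflection, and cancels it. Once the sums over s and m are exchanged, the inner sums over s
  are the two geometric ones.\<close>

lemma polar_part_appell: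
  assumes z: "z \<noteq> 0"
    and defined1: "\<And>s m. s \<in> {0..j-1} \<Longrightarrow> m \<in> {1..p-1} \<Longrightarrow>
           appell_defined (- (q powi (j * m - p * (2 * s + 1))))
             (- (q powi (p * (j + 2 * s + 1))) * z powi (- j)) (q powi (2 * j * p))"
    and defined2: "\<And>s m. s \<in> {0..j-1} \<Longrightarrow> m \<in> {1..p-1} \<Longrightarrow>
           appell_defined (- (q powi (j * m + p * (2 * s + 1))))
             (- (q powi (p * (j - 2 * s - 1))) * z powi j) (q powi (2 * j * p))"
  defines "\<theta> \<equiv> \<lambda>s. jtheta (- (q powi (p * (j - 2 * s - 1))) * z powi j) (q powi (2 * j * p))"
    and "M1 \<equiv> \<lambda>s m. appell_m (- (q powi (j * m - p * (2 * s + 1))))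
             (- (q powi (p * (j + 2 * s + 1))) * z powi (- j)) (q powi (2 * j * p))"
    and "M2 \<equiv> \<lambda>s m. appell_m (- (q powi (j * m + p * (2 * s + 1))))
             (- (q powi (p * (j - 2 * s - 1))) * z powi j) (q powi (2 * j * p))"
  shows "z * polar_part z = 1 / qpoch_inf q q ^ 3 *
    (\<Sum>s=0..j-1. (-1) powi p * q powi (binom2 p - p * (r - s)) * z powi (- s) * \<theta> s *
       (\<Sum>m=1..p-1. (-1) powi m * q powi (binom2 (m + 1) + m * (r - p)) *
          char_val q p (2 * p + j) (r + 1) m *
          (q powi (m * (s + 1) - p * (2 * s + 1)) * M1 s m + q powi (- m * s) * M2 s m)))"
proof -
  define S1 where "S1 s m = pole_sum q (p * j) 1 (p * (2 * s + 1)) (j * (m - p)) (z powi (- j))" for s m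
  define S2 where "S2 s m = pole_sum q (p * j) 1 (- (p * (2 * s + 1))) (j * (m - p)) (z powi j)" for s m
  have exps: "2 * j * p = 2 * (p * j)" "p * (j + 2 * s + 1) = p * j + p * (2 * s + 1)"
    "p * (j - 2 * s - 1) = p * j + - (p * (2 * s + 1))"
    "j * m - p * (2 * s + 1) = j * (m - p) + p * j - p * (2 * s + 1)"
    "j * m + p * (2 * s + 1) = j * (m - p) + p * j - (- (p * (2 * s + 1)))" for s m
    by (simp_all add: algebra_simps)
  have \<theta>_reflect: "jtheta (- (q powi (p * j + p * (2 * s + 1))) * z powi (- j)) (q powi (2 * (p * j))) = \<theta> s" for s
  proof -
    let ?y = "- (q powi (p * j + - (p * (2 * s + 1)))) * z powi j"
    have "q powi (2 * (p * j)) = q powi (p * j + p * (2 * s + 1)) * q powi (p * j + - (p * (2 * s + 1)))"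
      unfolding powi_add[OF q(2), symmetric] by (simp add: mult.commute)
    moreover have "A * B / (- B * Z) = - A * inverse Z" if "B \<noteq> 0" for A B Z :: complex
      using that by (simp add: divide_inverse)
    ultimately have "q powi (2 * (p * j)) / ?y = - (q powi (p * j + p * (2 * s + 1))) * z powi (- j)"
      unfolding power_int_minus using q by simp
    moreover have "jtheta (q powi (2 * (p * j)) / ?y) (q powi (2 * (p * j))) = jtheta ?y (q powi (2 * (p * j)))"
      using q z by (intro jtheta_reflect) auto
    ultimately show ?thesis
      by (simp only: \<theta>_def exps)
  qed
  have M1: "\<theta> s * M1 s m = S1 s m" if "s \<in> {0..j-1}" "m \<in> {1..p-1}" for s m
    using defined1[OF that] unfolding appell_defined_def M1_def S1_def \<theta>_reflect[symmetric] exps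
    by (intro appell_m_eq_pole_sum) blast
  have M2: "\<theta> s * M2 s m = S2 s m" if "s \<in> {0..j-1}" "m \<in> {1..p-1}" for s m
    using defined2[OF that] unfolding appell_defined_def M2_def S2_def \<theta>_def exps
    by (intro appell_m_eq_pole_sum) blast
  \<comment> \<open>The denominators of the Appell functions do not depend on s, so the assumption
    at s = 0 gives all of them.\<close>
  have nonpole1: "z powi (- j) * q powi (2 * (p * j) * n + j * (m - p)) \<noteq> 1" if "m \<in> {1..p-1}" for m n
    using defined1[of 0 m] that j unfolding appell_defined_def exps appell_denominator by auto
  have nonpole2: "z powi j * q powi (2 * (p * j) * n + j * (m - p)) \<noteq> 1" if "m \<in> {1..p-1}" for m n
    using defined2[of 0 m] that j unfolding appell_defined_def exps appell_denominator by auto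
  have summand: "1 / qpoch_inf q q ^ 3 * ((-1) powi p * q powi (binom2 p - p * (r - s)) * z powi (- s) * \<theta> s *
       ((-1) powi m * q powi (binom2 (m + 1) + m * (r - p)) * char_val q p (2 * p + j) (r + 1) m *
          (q powi (m * (s + 1) - p * (2 * s + 1)) * M1 s m + q powi (- m * s) * M2 s m)))
      = polar_coeff m * (q powi ((m - p) * (s + 1)) * z powi (- s) * S1 s m + q powi ((p - m) * s) * z powi (- s) * S2 s m)"
    if "s \<in> {0..j-1}" "m \<in> {1..p-1}" for s m
  proof -
    \<comment> \<open>The power q^(ps) of the prefactor completes the powers in the bracket to the
      exponents (m-p)(s+1) and (p-m)s, the weights of the two geometric sums.\<close>
    have e0: "q powi (binom2 p - p * (r - s)) = q powi (binom2 p - p * r) * q powi (p * s)"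
      unfolding powi_add[OF q(2), symmetric] by (simp add: algebra_simps)
    have e1: "q powi ((m - p) * (s + 1)) = q powi (p * s) * q powi (m * (s + 1) - p * (2 * s + 1))"
      unfolding powi_add[OF q(2), symmetric] by (simp add: algebra_simps)
    have e2: "q powi ((p - m) * s) = q powi (p * s) * q powi (- m * s)"
      unfolding powi_add[OF q(2), symmetric] by (simp add: algebra_simps)
    have "1 / Q * (a * (b * c) * zs * t * (d * e * B * (x * m1 + y * m2)))
        = a * b / Q * (d * e) * B * (c * x * zs * (t * m1) + c * y * zs * (t * m2))"
      for Q a b c zs t d e B x m1 y m2 :: complex
      by (simp add: algebra_simps)
    then show ?thesis
      unfolding polar_coeff_def M1[OF that, symmetric] M2[OF that, symmetric] e0 e1 e2 by this
  qed
  have "1 / qpoch_inf q q ^ 3 *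
    (\<Sum>s=0..j-1. (-1) powi p * q powi (binom2 p - p * (r - s)) * z powi (- s) * \<theta> s *
       (\<Sum>m=1..p-1. (-1) powi m * q powi (binom2 (m + 1) + m * (r - p)) *
          char_val q p (2 * p + j) (r + 1) m *
          (q powi (m * (s + 1) - p * (2 * s + 1)) * M1 s m + q powi (- m * s) * M2 s m)))
     = (\<Sum>s=0..j-1. \<Sum>m=1..p-1. polar_coeff m *
         (q powi ((m - p) * (s + 1)) * z powi (- s) * S1 s m + q powi ((p - m) * s) * z powi (- s) * S2 s m))"
    unfolding sum_distrib_left by (intro sum.cong refl summand)
  also have "\<dots> = (\<Sum>m=1..p-1. polar_coeff m *
      ((\<Sum>s=0..j-1. q powi ((m - p) * (s + 1)) * z powi (- s) * S1 s m)
       + (\<Sum>s=0..j-1. q powi ((p - m) * s) * z powi (- s) * S2 s m)))"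
    unfolding sum.distrib[symmetric] sum_distrib_left by (rule sum.swap)
  also have "\<dots> = (\<Sum>m=1..p-1. polar_coeff m *
      (- z * pole_sum q p j p (p - m) z + z * q powi (m * (1 - j)) * pole_sum q p j p (p + m) z))"
    unfolding S1_def S2_def
    by (intro sum.cong refl, subst sum_pole_sums_minus[OF z nonpole1], assumption,
        subst sum_pole_sums_plus[OF z nonpole2], assumption) rule
  also have "\<dots> = z * polar_part z"
    unfolding polar_part_def sum_distrib_left by (intro sum.cong refl) (simp add: algebra_simps)
  finally show ?thesis ..
qed

end

subsection \<open>String functions\<close>

lemma qpow_add: "qpow \<tau> (a + b) = qpow \<tau> a * qpow \<tau> b"
  by (simp add: qpow_def exp_add[symmetric] algebra_simps)

lemma qpow_nonzero [simp]: "qpow \<tau> a \<noteq> 0"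
  by (simp add: qpow_def)

lemma norm_qpow_1_less_1:
  assumes "Im \<tau> > 0"
  shows "norm (qpow \<tau> 1) < 1"
  using assms by (simp add: qpow_def)

text \<open>The power w^(2n+1) is w^(-m) with m = -(2n+1), so m = 2s+1 corresponds to n = -s-1.
  Resolving the definite description also takes uniqueness, which follows by comparing Laurent
  coefficients in w on one circle.\<close>

lemma string_fun_laurent:
  assumes q: "0 < norm (qpow \<tau> 1)" "norm (qpow \<tau> 1) < 1"
    and sum: "\<And>w. norm (qpow \<tau> 1) < norm (w\<^sup>2) \<Longrightarrow> norm (w\<^sup>2) < 1 \<Longrightarrow>
           ((\<lambda>n. d n * (w\<^sup>2) powi n) has_sum X w) UNIV"
    and char: "\<And>w. norm (qpow \<tau> 1) < norm (w\<^sup>2) \<Longrightarrow> norm (w\<^sup>2) < 1 \<Longrightarrow> adm_char p P (2 * r + 1) \<tau> w = E * w * X w"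
  shows "string_fun p P (2 * r + 1) \<tau> (2 * s + 1) * qpow \<tau> ((of_int (2 * s + 1))\<^sup>2 / (4 * adm_level p P)) = E * d (- s - 1)"
proof -
  define Q where "Q m = qpow \<tau> ((of_int m)\<^sup>2 / (4 * adm_level p P))" for m :: int
  have Q: "Q m \<noteq> 0" for m
    by (simp add: Q_def)
  let ?annulus = "\<lambda>w::complex. norm (qpow \<tau> 1) < norm (w\<^sup>2) \<and> norm (w\<^sup>2) < 1"
  let ?P = "\<lambda>C. (\<forall>m. odd (m - (2 * r + 1)) \<longrightarrow> C m = 0) \<and>
      (\<forall>w. ?annulus w \<longrightarrow> ((\<lambda>m. C m * Q m * w powi (- m)) has_sum adm_char p P (2 * r + 1) \<tau> w) {m. even (m - (2 * r + 1))})"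
  \<comment> \<open>For odd spin the expansion runs over odd m, so the dummy value 0 belongs to the
    even ones.\<close>
  define C where "C m = (if even m then 0 else E * d (- ((m + 1) div 2)) / Q m)" for m :: int
  have PC: "?P C"
  proof (intro conjI allI impI)
    fix m assume "odd (m - (2 * r + 1))"
    then show "C m = 0"
      by (simp add: C_def)
  next
    fix w :: complex assume w: "?annulus w"
    have w0: "w \<noteq> 0"
      using w q by auto
    have "((\<lambda>n. E * w * (d n * (w\<^sup>2) powi n)) has_sum E * w * X w) UNIV"
      using w by (intro has_sum_cmult_right sum) auto
    also have "E * w * X w = adm_char p P (2 * r + 1) \<tau> w"
      using w char[of w] by simp
    finally show "((\<lambda>m. C m * Q m * w powi (- m)) has_sum adm_char p P (2 * r + 1) \<tau> w) {m. even (m - (2 * r + 1))}"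
    proof (subst has_sum_reindex_bij_witness[of _ "\<lambda>n. - (2 * n + 1)" "\<lambda>m. - ((m + 1) div 2)" UNIV
          "\<lambda>n. E * w * (d n * (w\<^sup>2) powi n)"])
      fix m assume "m \<in> {m. even (m - (2 * r + 1))}"
      then have m: "odd m"
        by simp
      then obtain k where k: "m = 2 * k + 1"
        by (elim oddE)
      have e: "- ((m + 1) div 2) = - (k + 1)"
        by (simp add: k)
      have "w * (w\<^sup>2) powi (- (k + 1)) = w powi 1 * w powi (2 * - (k + 1))"
        using power_int_mult[of w 2 "- (k + 1)"] by simp
      also have "\<dots> = w powi (- m)"
        unfolding powi_add[OF w0, symmetric] by (simp add: k algebra_simps)
      finally have wm: "w powi (- m) = w * (w\<^sup>2) powi (- (k + 1))" ..
      have Cm: "C m * Q m = E * d (- (k + 1))"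
        unfolding C_def e using m Q by simp
      show "E * w * (d (- ((m + 1) div 2)) * (w\<^sup>2) powi (- ((m + 1) div 2))) = C m * Q m * w powi (- m)"
        unfolding e Cm wm by (simp only: mult_ac)
      show "- (2 * - ((m + 1) div 2) + 1) = m"
        unfolding e by (simp add: k)
    qed auto
  qed
  have "C' = C" if PC': "?P C'" for C'
  proof -
    \<comment> \<open>With |w| = |q|^(1/4) the modulus of w^2 is |q|^(1/2), inside the
      annulus.\<close>
    define R where "R = sqrt (sqrt (norm (qpow \<tau> 1)))"
    have R: "R > 0" "norm (qpow \<tau> 1) < R\<^sup>2" "R\<^sup>2 < 1"
      using q by (auto simp: R_def real_less_rsqrt power2_eq_square)
    have UN: "((\<lambda>n. (D (- n) * Q (- n)) * w powi n) has_sum adm_char p P (2 * r + 1) \<tau> w) UNIV"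
      if D: "?P D" and w: "norm w = R" for D and w :: complex
    proof -
      have "((\<lambda>m. D m * Q m * w powi (- m)) has_sum adm_char p P (2 * r + 1) \<tau> w) {m. even (m - (2 * r + 1))}"
        using D w R by (auto simp: norm_power)
      \<comment> \<open>The dummy zeros extend the sum to all integers, the form in which Laurent
        series are compared.\<close>
      also have "?this \<longleftrightarrow> ((\<lambda>m. D m * Q m * w powi (- m)) has_sum adm_char p P (2 * r + 1) \<tau> w) UNIV"
        using D by (intro has_sum_cong_neutral) auto
      finally show ?thesis
        by (subst has_sum_reindex_bij_witness[of _ uminus uminus UNIV "\<lambda>m. D m * Q m * w powi (- m)"]) auto
    qed
    have "(\<lambda>n. C' (- n) * Q (- n)) = (\<lambda>n. C (- n) * Q (- n))"
      by (rule laurent_series_unique[OF R(1) UN[OF PC'] UN[OF PC]])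
    then have "C' (- n) * Q (- n) = C (- n) * Q (- n)" for n
      by (rule fun_cong)
    from this[of "- m" for m] show ?thesis
      using Q by (auto simp: fun_eq_iff)
  qed
  with PC have "(THE C. ?P C) = C"
    by (rule the_equality)
  then have "string_fun p P (2 * r + 1) \<tau> = C"
    unfolding string_fun_def Q_def .
  moreover have "C (2 * s + 1) * Q (2 * s + 1) = E * d (- s - 1)"
  proof -
    have e: "- ((2 * s + 1 + 1) div 2) = - s - 1"
      by simp
    show ?thesis
      unfolding C_def e using Q by simp
  qed
  ultimately have "string_fun p P (2 * r + 1) \<tau> (2 * s + 1) * Q (2 * s + 1) = E * d (- s - 1)"
    by simp
  then show ?thesis
    by (simp add: Q_def)
qed

text \<open>The power w^(-(2r+2)) = z^(-(r+1)) goes into \<open>char_num\<close>; the only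
  half-integral power left is the w that comes from dividing by w^(-1).\<close>

lemma adm_char_eq:
  assumes w: "w \<noteq> 0"
  shows "adm_char p P (2 * r + 1) \<tau> w
    = qpow \<tau> (- 1 / 8 + of_int (p * (2 * r + 2)\<^sup>2) / of_int (4 * P)) * w *
      (char_num (qpow \<tau> 1) p P (r + 1) (w\<^sup>2) / jtheta (w\<^sup>2) (qpow \<tau> 1))"
proof -
  have l: "2 * r + 1 + 1 = 2 * (r + 1)" "2 * r + 2 = 2 * (r + 1)"
    by simp_all
  have "qpow \<tau> (1 / 8) * qpow \<tau> (- 1 / 8) = 1"
    using qpow_add[of \<tau> "1 / 8" "- 1 / 8"] by (simp add: qpow_def)
  then have e8: "qpow \<tau> (- 1 / 8) = 1 / qpow \<tau> (1 / 8)"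
    by (simp add: field_simps)
  have wp: "w powi (- (2 * (r + 1))) = (w\<^sup>2) powi (- (r + 1))"
    using power_int_mult[of w 2 "- (r + 1)"] by simp
  have "A * B * T / (w powi (- 1) * e * J) = 1 / e * B * w * (A * T / J)" for A B T e J :: complex
    using w by (simp add: power_int_minus field_simps)
  then show ?thesis
    unfolding adm_char_def Let_def l wp char_num_def qpow_add e8 by this
qed

section \<open>The expansion in string functions and Appell functions\<close>

theorem theorem2p2:
  fixes p j r :: int and \<tau> q w z :: complex
  assumes "Im \<tau> > 0" and "q = qpow \<tau> 1"
    and "p \<ge> 1" and "j \<ge> 1" and "gcd p (2 * p + j) = 1"
    and "0 \<le> 2 * r + 1" and "2 * r + 1 \<le> 2 * p + j - 2"
    and "w\<^sup>2 = z" and "z \<noteq> 0" and "jtheta z q \<noteq> 0"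
    and "\<And>s m. s \<in> {0..j-1} \<Longrightarrow> m \<in> {1..p-1} \<Longrightarrow>
           appell_defined (- (q powi (j * m - p * (2 * s + 1))))
             (- (q powi (p * (j + 2 * s + 1))) * z powi (- j)) (q powi (2 * j * p))"
    and "\<And>s m. s \<in> {0..j-1} \<Longrightarrow> m \<in> {1..p-1} \<Longrightarrow>
           appell_defined (- (q powi (j * m + p * (2 * s + 1))))
             (- (q powi (p * (j - 2 * s - 1))) * z powi j) (q powi (2 * j * p))"
  shows "adm_char p (2 * p + j) (2 * r + 1) \<tau> w =
    (\<Sum>s=0..j-1. w powi (- (2 * s + 1)) * qpow \<tau> (of_int p / of_int (4 * j) * (of_int (2 * s + 1))\<^sup>2)
        * string_fun p (2 * p + j) (2 * r + 1) \<tau> (2 * s + 1)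
        * jtheta (- (z powi j) * q powi (p * (j - 2 * s - 1))) (q powi (2 * p * j)))
    + 1 / (qpoch_inf q q) ^ 3 *
      (\<Sum>s=0..j-1. (-1) powi p
        * qpow \<tau> (- 1 / 8 + of_int (p * (2 * r + 2)\<^sup>2) / of_int (4 * (2 * p + j)))
        * q powi (binom2 p - p * (r - s)) * w powi (- (2 * s + 1))
        * jtheta (- (q powi (p * (j - 2 * s - 1))) * z powi j) (q powi (2 * j * p))
        * (\<Sum>m=1..p-1. (-1) powi m * q powi (binom2 (m + 1) + m * (r - p))
            * (jtheta (- (q powi (m * (2 * p + j) + p * (2 * r + 2)))) (q powi (2 * p * (2 * p + j)))
               - q powi (m * (2 * p + j) - m * (2 * r + 2))
                 * jtheta (- (q powi (- m * (2 * p + j) + p * (2 * r + 2))))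
                     (q powi (2 * p * (2 * p + j))))
            * (q powi (m * (s + 1) - p * (2 * s + 1))
                 * appell_m (- (q powi (j * m - p * (2 * s + 1))))
                     (- (q powi (p * (j + 2 * s + 1))) * z powi (- j)) (q powi (2 * j * p))
               + q powi (- m * s)
                 * appell_m (- (q powi (j * m + p * (2 * s + 1))))
                     (- (q powi (p * (j - 2 * s - 1))) * z powi j) (q powi (2 * j * p)))))"
proof -
  have q: "norm q < 1" "q \<noteq> 0"
    using assms(1,2) norm_qpow_1_less_1 by auto
  interpret admissible q p j r
    using q assms(3,4) by unfold_locales
  define E where "E = qpow \<tau> (- 1 / 8 + of_int (p * (2 * r + 2)\<^sup>2) / of_int (4 * (2 * p + j)))"
  have w: "w \<noteq> 0"
    using assms(8,9) by auto
  obtain d where d: "\<And>z. norm q < norm z \<Longrightarrow> norm z < 1 \<Longrightarrow> ((\<lambda>n. d n * z powi n) has_sum num z / jtheta z q) UNIV"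
    "\<And>z. z \<noteq> 0 \<Longrightarrow> jtheta z q \<noteq> 0 \<Longrightarrow> num z / jtheta z q =
       (\<Sum>s=0..j-1. d (- s - 1) * z powi (- s - 1) *
          jtheta (- (q powi (p * (j - 2 * s - 1))) * z powi j) (q powi (2 * p * j))) + polar_part z"
    using char_expansion by blast
  have char: "adm_char p (2 * p + j) (2 * r + 1) \<tau> v = E * v * (num (v\<^sup>2) / jtheta (v\<^sup>2) q)" if "v \<noteq> 0" for v
    using adm_char_eq[OF that, of p "2 * p + j" r \<tau>] unfolding E_def assms(2) .
  \<comment> \<open>The level is N = (2p+j)/p - 2 = j/p, hence 1/(4N) = p/(4j).\<close>
  have level: "of_int p / of_int (4 * j) * (of_int (2 * s + 1))\<^sup>2
      = (of_int (2 * s + 1))\<^sup>2 / (4 * adm_level p (2 * p + j))" for s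
    using assms(3,4) by (simp add: adm_level_def field_simps)
  have string: "string_fun p (2 * p + j) (2 * r + 1) \<tau> (2 * s + 1) *
      qpow \<tau> (of_int p / of_int (4 * j) * (of_int (2 * s + 1))\<^sup>2) = E * d (- s - 1)" for s
    unfolding level
  proof (rule string_fun_laurent)
    fix v :: complex assume v: "norm (qpow \<tau> 1) < norm (v\<^sup>2)" "norm (v\<^sup>2) < 1"
    then show "((\<lambda>n. d n * (v\<^sup>2) powi n) has_sum num (v\<^sup>2) / jtheta (v\<^sup>2) q) UNIV"
      using assms(2) by (intro d(1)) auto
    have "v \<noteq> 0"
      using v by auto
    then show "adm_char p (2 * p + j) (2 * r + 1) \<tau> v = E * v * (num (v\<^sup>2) / jtheta (v\<^sup>2) q)"
      by (rule char)
  qed (use q assms(2) in auto)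
  have wp: "w * z powi (- s - 1) = w powi (- (2 * s + 1))" "w powi (- (2 * s + 1)) = inverse w * z powi (- s)" for s
  proof -
    have zw: "z powi k = w powi (2 * k)" for k
      using power_int_mult[of w 2 k] assms(8) by simp
    show "w * z powi (- s - 1) = w powi (- (2 * s + 1))"
      using powi_add[OF w, of 1 "2 * (- s - 1)"] by (simp add: zw algebra_simps)
    show "w powi (- (2 * s + 1)) = inverse w * z powi (- s)"
      using powi_add[OF w, of "-1" "2 * (- s)"] by (simp add: zw algebra_simps)
  qed
  have first: "E * w * (d (- s - 1) * z powi (- s - 1) * J)
      = w powi (- (2 * s + 1)) * qpow \<tau> (of_int p / of_int (4 * j) * (of_int (2 * s + 1))\<^sup>2)
        * string_fun p (2 * p + j) (2 * r + 1) \<tau> (2 * s + 1) * J" for s J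
  proof -
    have "E * w * (d (- s - 1) * z powi (- s - 1) * J) = (E * d (- s - 1)) * (w * z powi (- s - 1)) * J"
      by (simp only: mult_ac)
    also have "\<dots> = w powi (- (2 * s + 1)) * qpow \<tau> (of_int p / of_int (4 * j) * (of_int (2 * s + 1))\<^sup>2)
        * string_fun p (2 * p + j) (2 * r + 1) \<tau> (2 * s + 1) * J"
      unfolding string[symmetric] wp(1) by (simp only: mult_ac)
    finally show ?thesis .
  qed
  define V where "V m = jtheta (- (q powi (m * (2 * p + j) + p * (2 * r + 2)))) (q powi (2 * p * (2 * p + j)))
       - q powi (m * (2 * p + j) - m * (2 * r + 2))
         * jtheta (- (q powi (- m * (2 * p + j) + p * (2 * r + 2)))) (q powi (2 * p * (2 * p + j)))" for m
  have val: "char_val q p (2 * p + j) (r + 1) m = V m" for m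
  proof -
    have "2 * (r + 1) = 2 * r + 2"
      by simp
    then show ?thesis
      unfolding char_val_def V_def by (simp only:)
  qed
  define \<theta> where "\<theta> s = jtheta (- (q powi (p * (j - 2 * s - 1))) * z powi j) (q powi (2 * j * p))" for s
  define I where "I s = (\<Sum>m=1..p-1. (-1) powi m * q powi (binom2 (m + 1) + m * (r - p)) * V m
            * (q powi (m * (s + 1) - p * (2 * s + 1))
                 * appell_m (- (q powi (j * m - p * (2 * s + 1))))
                     (- (q powi (p * (j + 2 * s + 1))) * z powi (- j)) (q powi (2 * j * p))
               + q powi (- m * s)
                 * appell_m (- (q powi (j * m + p * (2 * s + 1))))
                     (- (q powi (p * (j - 2 * s - 1))) * z powi j) (q powi (2 * j * p))))" for s
  have polar: "z * polar_part z = 1 / qpoch_inf q q ^ 3 *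
      (\<Sum>s=0..j-1. (-1) powi p * q powi (binom2 p - p * (r - s)) * z powi (- s) * \<theta> s * I s)"
    unfolding I_def \<theta>_def val[symmetric]
    by (rule polar_part_appell[OF assms(9)]) (rule assms(11) assms(12); assumption)+
  have second: "E * w * polar_part z = 1 / qpoch_inf q q ^ 3 *
      (\<Sum>s=0..j-1. (-1) powi p * E * q powi (binom2 p - p * (r - s)) * w powi (- (2 * s + 1)) * \<theta> s * I s)"
  proof -
    \<comment> \<open>Writing w = z / w brings in \<open>z * polar_part z\<close>, whose Appell form
      is known, and the leftover 1 / w turns z^(-s) into w^(-(2s+1)).\<close>
    have "E * w * polar_part z = E * inverse w * (z * polar_part z)"
      using w assms(8) by (simp add: power2_eq_square field_simps)
    also have "\<dots> = 1 / qpoch_inf q q ^ 3 * (\<Sum>s=0..j-1. E * inverse w *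
        ((-1) powi p * q powi (binom2 p - p * (r - s)) * z powi (- s) * \<theta> s * I s))"
      unfolding polar sum_distrib_left[symmetric] by (simp only: mult_ac)
    also have "(\<Sum>s=0..j-1. E * inverse w *
        ((-1) powi p * q powi (binom2 p - p * (r - s)) * z powi (- s) * \<theta> s * I s))
        = (\<Sum>s=0..j-1. (-1) powi p * E * q powi (binom2 p - p * (r - s)) * w powi (- (2 * s + 1)) * \<theta> s * I s)"
      unfolding wp(2) by (intro sum.cong refl) (simp only: mult_ac)
    finally show ?thesis .
  qed
  have arg: "- (q powi (p * (j - 2 * s - 1))) * z powi j = - (z powi j) * q powi (p * (j - 2 * s - 1))" for s
    by simp
  have "adm_char p (2 * p + j) (2 * r + 1) \<tau> w = E * w *
       ((\<Sum>s=0..j-1. d (- s - 1) * z powi (- s - 1) *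
          jtheta (- (q powi (p * (j - 2 * s - 1))) * z powi j) (q powi (2 * p * j))) + polar_part z)"
    using char[OF w] d(2)[OF assms(9,10)] assms(8) by simp
  also have "\<dots> = (\<Sum>s=0..j-1. E * w * (d (- s - 1) * z powi (- s - 1) *
          jtheta (- (q powi (p * (j - 2 * s - 1))) * z powi j) (q powi (2 * p * j)))) + E * w * polar_part z"
    by (simp only: distrib_left sum_distrib_left)
  also have "(\<Sum>s=0..j-1. E * w * (d (- s - 1) * z powi (- s - 1) *
          jtheta (- (q powi (p * (j - 2 * s - 1))) * z powi j) (q powi (2 * p * j))))
      = (\<Sum>s=0..j-1. w powi (- (2 * s + 1)) * qpow \<tau> (of_int p / of_int (4 * j) * (of_int (2 * s + 1))\<^sup>2)
        * string_fun p (2 * p + j) (2 * r + 1) \<tau> (2 * s + 1)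
        * jtheta (- (z powi j) * q powi (p * (j - 2 * s - 1))) (q powi (2 * p * j)))"
    unfolding first arg ..
  finally show ?thesis
    unfolding second unfolding E_def \<theta>_def I_def V_def .
qed

end
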